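(* Let $\lambda\subset\mu$ be partitions with $\lambda\ne\mu$, and let $a_{\lambda\mu}$ be the coefficient of $s_\mu$ in $SQ^{|\mu|-|\lambda|}s_\lambda$. Then $$a_{\lambda\mu}=\operatorname{ps}^1_{c(\lambda,\mu)}\left(\bigl(\mathcal{S}^{|\pi(\lambda,\mu)|}\,s_{\pi'(\lambda,\mu)}\bigr)^\perp\,s_{\rho'(\lambda,\mu)}\right),$$ where $\mathcal{S}^n=\sum_{i=0}^n(-1)^i\,SQ^i$.
   Context: Operators. Let $\partial_i=\partial/\partial x_i$ and $D_1:=\sum_{i\ge1}x_i^2\partial_i$, acting on symmetric functions in $x_1,x_2,\ldots$. For operators in standard form (polynomial part on the left, derivatives on the right) $\vee$ is the bilinear product with $(x_\lambda\partial_\mu)\vee(x_\nu\partial_\pi):=x_\lambda x_\nu\partial_\mu\partial_\pi$. $SQ^n:=D_{(1^n)}:=\frac1{n!}D_1^{\vee n}$, $SQ^0=\mathrm{id}$. One has $SQ^ns_\lambda=\sum_{\mu\supset\lambda,\,|\mu|-|\lambda|=n}a_{\lambda\mu}s_\mu$, where $s_\lambda$ are Schur functions. For a symmetric function $f$, $f^\perp$ is the adjoint of multiplication by $f$ for the standard scalar product on symmetric functions (Schur functions orthonormal). For an integer $n\ge0$, $\operatorname{ps}_n^1$ sends a symmetric function $f(x_1,x_2,\ldots)$ to the integer obtained by setting $x_1=\cdots=x_n=1$ and $x_k=0$ for $k>n$; for $n<0$, $\operatorname{ps}_n^1(f)=\operatorname{ps}_{-n}^1(S(f))$, where $S$ is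 the antipode of the Hopf algebra of symmetric functions (the ring homomorphism with $S(p_k)=-p_k$ on power sums). Thus $\operatorname{ps}^1_n$ is the ring homomorphism with $\operatorname{ps}_n^1(p_k)=n$ for all $k\ge1$. Diagrams (English convention): $\pi(\lambda,\mu)$ and $\rho(\lambda,\mu)$ are the Young diagrams of smallest weight ($\pi$ possibly empty) for which $\mu/\lambda=\rho/\pi$ up to translation; $c(\lambda,\mu)$ is the content (column index minus row index) of the top left box of $\rho(\lambda,\mu)$ in its embedding in $\mu$, i.e. $j_0-i_0$ where $i_0,j_0$ are the smallest row and column indices of boxes of $\mu/\lambda$. A prime denotes the conjugate partition, so $\pi'(\lambda,\mu)$ and $\rho'(\lambda,\mu)$ are the conjugates of $\pi(\lambda,\mu)$, $\rho(\lambda,\mu)$. *)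

theory Defs
  imports Complex_Main "HOL-Library.Multiset" "HOL-Library.FuncSet"
begin

section \<open>Power series in infinitely many variables\<close>

text \<open>
  A monomial in variables from \<^typ>\<open>'v\<close> is a finite multiset of variables, the multiplicity of a
  variable being its exponent; multiset addition is multiplication of monomials. A power series is
  an arbitrary family of rational coefficients. The variables of symmetric functions are indexed
  by \<^typ>\<open>nat\<close> starting from 0.
\<close>

typedef 'v pseries = "UNIV :: ('v multiset \<Rightarrow> rat) set"
  morphisms mcoeff Abs_pseries ..

lemma mcoeff_Abs [simp]: "mcoeff (Abs_pseries f) = f"
  by (simp add: Abs_pseries_inverse)

lemma pseries_eqI: "(\<And>m. mcoeff f m = mcoeff g m) \<Longrightarrow> f = g"
  by (metis ext mcoeff_inject)

definition splits :: "'a multiset \<Rightarrow> ('a multiset \<times> 'a multiset) set" where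
  "splits m = {(a, b). a + b = m}"

lemma finite_submultisets: "finite {a. a \<subseteq># m}"
proof (induction m)
  case (add x m)
  have "{a. a \<subseteq># add_mset x m} \<subseteq> {a. a \<subseteq># m} \<union> add_mset x ` {a. a \<subseteq># m}"
  proof
    fix a assume "a \<in> {a. a \<subseteq># add_mset x m}"
    hence a: "a \<subseteq># add_mset x m" by simp
    show "a \<in> {a. a \<subseteq># m} \<union> add_mset x ` {a. a \<subseteq># m}"
    proof (cases "x \<in># a")
      case True
      then obtain b where "a = add_mset x b" by (metis insert_DiffM)
      with a show ?thesis by auto
    next
      case False
      with a have "a \<subseteq># m"
        by (metis diff_single_trivial subset_eq_diff_conv add_mset_add_single)
      thus ?thesis by simp
    qed
  qed
  thus ?case using add.IH by (meson finite_Un finite_imageI finite_subset)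
qed simp

lemma finite_splits [simp]: "finite (splits m)"
proof -
  have "splits m \<subseteq> {a. a \<subseteq># m} \<times> {a. a \<subseteq># m}"
    by (auto simp: splits_def)
  thus ?thesis using finite_subset[OF _ finite_cartesian_product[OF finite_submultisets finite_submultisets]] by blast
qed

instantiation pseries :: (type) comm_ring_1
begin

definition "0 = Abs_pseries (\<lambda>_. 0)"
definition "1 = Abs_pseries (\<lambda>m. if m = {#} then 1 else 0)"
definition "f + g = Abs_pseries (\<lambda>m. mcoeff f m + mcoeff g m)"
definition "f - g = Abs_pseries (\<lambda>m. mcoeff f m - mcoeff g m)"
definition "- f = Abs_pseries (\<lambda>m. - mcoeff f m)"
definition "f * g = Abs_pseries (\<lambda>m. \<Sum>(a, b)\<in>splits m. mcoeff f a * mcoeff g b)"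

lemma mcoeff_basic:
  "mcoeff 0 m = 0"
  "mcoeff 1 m = (if m = {#} then 1 else 0)"
  "mcoeff (f + g) m = mcoeff f m + mcoeff g m"
  "mcoeff (f - g) m = mcoeff f m - mcoeff g m"
  "mcoeff (- f) m = - mcoeff f m"
  by (simp_all only: zero_pseries_def one_pseries_def plus_pseries_def minus_pseries_def
        uminus_pseries_def mcoeff_Abs)

lemma mcoeff_times: "mcoeff (f * g) m = (\<Sum>(a, b)\<in>splits m. mcoeff f a * mcoeff g b)"
  by (simp only: times_pseries_def mcoeff_Abs)

instance
proof
  fix f g h :: "'a pseries"
  show "f * g * h = f * (g * h)"
  proof (rule pseries_eqI)
    fix m
    have "mcoeff (f * g * h) m =
      (\<Sum>(p, q)\<in>(SIGMA p:splits m. splits (fst p)).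
         mcoeff f (fst q) * mcoeff g (snd q) * mcoeff h (snd p))"
      by (simp add: mcoeff_times sum.Sigma sum_distrib_right split_def)
    also have "\<dots> =
      (\<Sum>(p, q)\<in>(SIGMA p:splits m. splits (snd p)).
         mcoeff f (fst p) * (mcoeff g (fst q) * mcoeff h (snd q)))"
      by (rule sum.reindex_bij_witness
            [where i = "\<lambda>((a, _), (b, c)). ((a + b, c), (a, b))"
               and j = "\<lambda>((_, c), (a, b)). ((a, b + c), (b, c))"])
         (auto simp: splits_def add.assoc)
    also have "\<dots> = mcoeff (f * (g * h)) m"
      by (simp add: mcoeff_times sum.Sigma sum_distrib_left split_def)
    finally show "mcoeff (f * g * h) m = mcoeff (f * (g * h)) m" .
  qed
  show "f * g = g * f"
  proof (rule pseries_eqI)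
    fix m
    show "mcoeff (f * g) m = mcoeff (g * f) m"
      unfolding mcoeff_times
      by (rule sum.reindex_bij_witness[where i = prod.swap and j = prod.swap])
         (auto simp: splits_def add.commute)
  qed
  show "1 * f = f"
  proof (rule pseries_eqI)
    fix m
    have "mcoeff (1 * f) m = (\<Sum>(a, b)\<in>{({#}, m)}. mcoeff 1 a * mcoeff f b)"
      unfolding mcoeff_times
    proof (rule sum.mono_neutral_right)
      show "\<forall>i\<in>splits m - {({#}, m)}. (case i of (a, b) \<Rightarrow> mcoeff 1 a * mcoeff f b) = 0"
      proof
        fix i assume i: "i \<in> splits m - {({#}, m)}"
        obtain a b where "i = (a, b)" by fastforce
        with i have "a \<noteq> {#}" by (auto simp: splits_def)
        with \<open>i = (a, b)\<close> show "(case i of (a, b) \<Rightarrow> mcoeff 1 a * mcoeff f b) = 0"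
          by (simp add: mcoeff_basic)
      qed
    qed (simp, simp add: splits_def)
    thus "mcoeff (1 * f) m = mcoeff f m" by (simp add: mcoeff_basic)
  qed
  show "(f + g) * h = f * h + g * h"
    by (rule pseries_eqI)
       (simp add: mcoeff_times mcoeff_basic split_def distrib_right sum.distrib)
  show "(0 :: 'a pseries) \<noteq> 1"
  proof
    assume "(0 :: 'a pseries) = 1"
    hence "mcoeff (0 :: 'a pseries) {#} = mcoeff 1 {#}" by (rule arg_cong)
    thus False by (simp add: mcoeff_basic)
  qed
qed (rule pseries_eqI, simp add: mcoeff_basic)+

end

definition scale :: "rat \<Rightarrow> 'v pseries \<Rightarrow> 'v pseries" where
  "scale c f = Abs_pseries (\<lambda>m. c * mcoeff f m)"


section \<open>Symmetric functions\<close>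

definition Sym :: "nat pseries set" where
  "Sym = {f. (\<exists>d. \<forall>m. size m > d \<longrightarrow> mcoeff f m = 0) \<and>
             (\<forall>\<sigma>. bij \<sigma> \<longrightarrow> (\<forall>m. mcoeff f (image_mset \<sigma> m) = mcoeff f m))}"

definition power_sum :: "nat \<Rightarrow> nat pseries" where
  "power_sum k = Abs_pseries (\<lambda>m. if \<exists>i. m = replicate_mset k i then 1 else 0)"

text \<open>
  Partitions are identified with their Young diagrams: the box \<^term>\<open>(i, j)\<close> lies in row \<open>i\<close> and
  column \<open>j\<close>, both counted from 0, with row 0 at the top. The weight of a partition is the
  cardinality of its diagram, and containment of partitions is inclusion.
\<close>

definition young :: "(nat \<times> nat) set \<Rightarrow> bool" where
  "young D \<longleftrightarrow> finite D \<and> (\<forall>i j i' j'. (i, j) \<in> D \<and> i' \<le> i \<and> j' \<le> j \<longrightarrow> (i', j') \<in> D)"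

definition conjugate :: "(nat \<times> nat) set \<Rightarrow> (nat \<times> nat) set" where
  "conjugate D = prod.swap ` D"

text \<open>Semistandard tableaux, with entries the indices of variables (hence possibly 0).\<close>

definition ssyt :: "(nat \<times> nat) set \<Rightarrow> (nat \<times> nat \<Rightarrow> nat) set" where
  "ssyt D = {T \<in> extensional D.
     (\<forall>i j. (i, j) \<in> D \<and> (i, Suc j) \<in> D \<longrightarrow> T (i, j) \<le> T (i, Suc j)) \<and>
     (\<forall>i j. (i, j) \<in> D \<and> (Suc i, j) \<in> D \<longrightarrow> T (i, j) < T (Suc i, j))}"

definition schur :: "(nat \<times> nat) set \<Rightarrow> nat pseries" where
  "schur D = Abs_pseries (\<lambda>m. of_nat (card {T \<in> ssyt D. image_mset T (mset_set D) = m}))"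

text \<open>The coefficients of a symmetric function in the basis of Schur functions.\<close>

definition schur_coeff :: "nat pseries \<Rightarrow> (nat \<times> nat) set \<Rightarrow> rat" where
  "schur_coeff f = (THE c. finite {D. c D \<noteq> 0} \<and> (\<forall>D. c D \<noteq> 0 \<longrightarrow> young D) \<and>
                       f = (\<Sum>D | c D \<noteq> 0. scale (c D) (schur D)))"

text \<open>The bilinear form on symmetric functions for which the Schur functions are orthonormal.\<close>

definition scalar_prod :: "nat pseries \<Rightarrow> nat pseries \<Rightarrow> rat" where
  "scalar_prod f g = (\<Sum>D | schur_coeff f D \<noteq> 0. schur_coeff f D * schur_coeff g D)"

definition perp :: "nat pseries \<Rightarrow> nat pseries \<Rightarrow> nat pseries" where
  "perp f g = (THE h. h \<in> Sym \<and> (\<forall>u\<in>Sym. scalar_prod h u = scalar_prod g (f * u)))"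

text \<open>The antipode; outside \<^const>\<open>Sym\<close> it takes the dummy value \<^const>\<open>undefined\<close>.\<close>

definition antipode :: "nat pseries \<Rightarrow> nat pseries" where
  "antipode = (THE S. S \<in> Sym \<rightarrow>\<^sub>E Sym \<and> S 1 = 1 \<and>
     (\<forall>f\<in>Sym. \<forall>g\<in>Sym. S (f + g) = S f + S g \<and> S (f * g) = S f * S g) \<and>
     (\<forall>k\<ge>1. S (power_sum k) = - power_sum k))"

text \<open>
  Setting the first \<open>n\<close> variables to 1 and the others to 0 adds up the coefficients of the monomials
  in the first \<open>n\<close> variables; for symmetric functions this sum has finite support.
\<close>

definition eval_ones :: "nat \<Rightarrow> nat pseries \<Rightarrow> rat" where
  "eval_ones n f = (\<Sum>m | set_mset m \<subseteq> {..<n} \<and> mcoeff f m \<noteq> 0. mcoeff f m)"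

definition ps1 :: "int \<Rightarrow> nat pseries \<Rightarrow> rat" where
  "ps1 n f = (if n \<ge> 0 then eval_ones (nat n) f else eval_ones (nat (- n)) (antipode f))"


section \<open>Differential operators in standard form\<close>

text \<open>
  The operator \<open>\<Sum>\<^sub>\<alpha>\<^sub>\<beta> P(\<alpha>,\<beta>) x\<^sup>\<alpha> \<partial>\<^sup>\<beta>\<close>, with all derivatives on the right, is represented by its
  coefficient family \<open>P\<close>.
\<close>

type_synonym diffop = "nat multiset \<Rightarrow> nat multiset \<Rightarrow> rat"

definition vee :: "diffop \<Rightarrow> diffop \<Rightarrow> diffop" where
  "vee P Q \<alpha> \<beta> = (\<Sum>(\<alpha>1, \<alpha>2)\<in>splits \<alpha>. \<Sum>(\<beta>1, \<beta>2)\<in>splits \<beta>. P \<alpha>1 \<beta>1 * Q \<alpha>2 \<beta>2)"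

definition id_op :: diffop where
  "id_op \<alpha> \<beta> = (if \<alpha> = {#} \<and> \<beta> = {#} then 1 else 0)"

definition vee_power :: "nat \<Rightarrow> diffop \<Rightarrow> diffop" where
  "vee_power n P = (vee P ^^ n) id_op"

text \<open>
  The coefficient of \<open>x\<^sup>m\<close> in \<open>\<partial>\<^sup>\<beta> f\<close>, by
  \<open>(\<partial>/\<partial>x)\<^sup>b x\<^sup>a\<^sup>+\<^sup>b = ((a + b)! / a!) x\<^sup>a\<close> in each variable.
\<close>

definition partial_deriv :: "'v multiset \<Rightarrow> 'v pseries \<Rightarrow> 'v pseries" where
  "partial_deriv \<beta> f = Abs_pseries (\<lambda>m.
     (\<Prod>i\<in>set_mset \<beta>. fact (count (m + \<beta>) i) / fact (count m i)) * mcoeff f (m + \<beta>))"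

text \<open>
  The action on power series is computed coefficientwise. It is meaningful for operators having,
  for each \<open>\<alpha>\<close>, only finitely many terms \<open>x\<^sup>\<alpha> \<partial>\<^sup>\<beta>\<close>.
\<close>

definition apply_op :: "diffop \<Rightarrow> nat pseries \<Rightarrow> nat pseries" where
  "apply_op P f = Abs_pseries (\<lambda>m.
     \<Sum>(\<alpha>, \<beta>) | \<alpha> \<subseteq># m \<and> P \<alpha> \<beta> \<noteq> 0. P \<alpha> \<beta> * mcoeff (partial_deriv \<beta> f) (m - \<alpha>))"

text \<open>\<open>D\<^sub>1 = \<Sum>\<^sub>i x\<^sub>i\<^sup>2 \<partial>\<^sub>i\<close>\<close>

definition D1 :: diffop where
  "D1 \<alpha> \<beta> = (if \<exists>i. \<alpha> = {#i, i#} \<and> \<beta> = {#i#} then 1 else 0)"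

definition SQ :: "nat \<Rightarrow> nat pseries \<Rightarrow> nat pseries" where
  "SQ n = apply_op (\<lambda>\<alpha> \<beta>. vee_power n D1 \<alpha> \<beta> / fact n)"

definition SQ_alt :: "nat \<Rightarrow> nat pseries \<Rightarrow> nat pseries" where
  "SQ_alt n f = (\<Sum>i\<le>n. (- 1) ^ i * SQ i f)"

definition sq_coeff :: "(nat \<times> nat) set \<Rightarrow> (nat \<times> nat) set \<Rightarrow> rat" where
  "sq_coeff lam mu = schur_coeff (SQ (card mu - card lam) (schur lam)) mu"


section \<open>Reduced skew shapes\<close>

definition translate_of :: "(nat \<times> nat) set \<Rightarrow> (nat \<times> nat) set \<Rightarrow> bool" where
  "translate_of A B \<longleftrightarrow> (\<exists>a b :: int.
     (\<lambda>(i, j). (int i, int j)) ` A = (\<lambda>(i, j). (int i + a, int j + b)) ` B)"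

definition is_presentation ::
  "(nat \<times> nat) set \<Rightarrow> (nat \<times> nat) set \<Rightarrow> (nat \<times> nat) set \<times> (nat \<times> nat) set \<Rightarrow> bool" where
  "is_presentation lam mu = (\<lambda>(p, r). young p \<and> young r \<and> p \<subseteq> r \<and> translate_of (r - p) (mu - lam))"

text \<open>
  Since \<open>|\<rho>| - |\<pi>| = |\<mu>| - |\<lambda>|\<close> is fixed, minimising the weight of \<open>\<rho>\<close> is the same as minimising that
  of \<open>\<pi>\<close>; for \<open>\<lambda> \<noteq> \<mu>\<close> the minimal pair is unique.
\<close>

definition pi_rho :: "(nat \<times> nat) set \<Rightarrow> (nat \<times> nat) set \<Rightarrow> (nat \<times> nat) set \<times> (nat \<times> nat) set" where
  "pi_rho lam mu = (ARG_MIN (\<lambda>(p, r). card r) pr. is_presentation lam mu pr)"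

definition pi_shape :: "(nat \<times> nat) set \<Rightarrow> (nat \<times> nat) set \<Rightarrow> (nat \<times> nat) set" where
  "pi_shape lam mu = fst (pi_rho lam mu)"

definition rho_shape :: "(nat \<times> nat) set \<Rightarrow> (nat \<times> nat) set \<Rightarrow> (nat \<times> nat) set" where
  "rho_shape lam mu = snd (pi_rho lam mu)"

definition top_left_content :: "(nat \<times> nat) set \<Rightarrow> (nat \<times> nat) set \<Rightarrow> int" where
  "top_left_content lam mu = int (Min (snd ` (mu - lam))) - int (Min (fst ` (mu - lam)))"

end

theory Submission
  imports Defs "Jordan_Normal_Form.Determinant" "HOL-Combinatorics.Permutations"
begin

text \<open>
  The operators \<open>SQ\<^sup>n\<close> are the components of the ring homomorphism \<open>\<phi>\<close> substituting \<open>x\<^sub>i + x\<^sub>i\<^sup>2\<close> for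
  \<open>x\<^sub>i\<close>, and \<open>\<S>\<close> is the substitution of \<open>x\<^sub>i - x\<^sub>i\<^sup>2\<close>. Conjugation \<open>\<omega>\<close> exchanges the two substitutions
  and sends \<open>\<Prod>(1 + x\<^sub>i)\<^sup>c\<close> to \<open>\<Prod>(1 - x\<^sub>i)\<^sup>-\<^sup>c\<close>, whose coefficient at \<open>s\<^sub>\<nu>\<close> is \<open>ps\<^sup>1\<^sub>c(s\<^sub>\<nu>)\<close>. Hence the right-hand side
  is the coefficient of \<open>s\<^sub>\<rho>\<close> in \<open>\<phi>(s\<^sub>\<pi>) \<Prod>(1 + x\<^sub>i)\<^sup>c\<close>.

  In \<open>n\<close> variables, the bialternant formula writes \<open>\<phi>(s\<^sub>\<lambda>)\<close> times the Vandermonde determinant as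
  \<open>det ((x\<^sub>i + x\<^sub>i\<^sup>2)^l\<^sub>j) / \<Prod>(1 + x\<^sub>i + x\<^sub>j)\<close>, where the \<open>l\<^sub>j\<close> are the beta numbers of \<open>\<lambda>\<close>, and \<open>a\<^sub>\<lambda>\<^sub>\<mu>\<close> is its coefficient
  at the beta numbers of \<open>\<mu>\<close>. A row without boxes of \<open>\<mu>/\<lambda>\<close> can be deleted at the cost of a factor
  \<open>\<Prod>(1 + x\<^sub>i)\<^sup>-\<^sup>1\<close>, and removing a full column contributes \<open>\<Prod>(1 + x\<^sub>i)\<close>. So \<open>(\<lambda>, \<mu>)\<close> and \<open>(\<pi>, \<rho>)\<close> reduce
  to the same data, with \<open>c\<close> counting columns minus rows.
\<close>

text \<open>A substitution respects products, so it may be applied to numerator and denominator of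
  the bialternant formula; 1 + x_i + x_j is the factor by which it multiplies x_j - x_i. For y = x +
  x^2 the power y^l = x^l (1 + x)^l starts at x^l. At an index where the exponents of both diagrams
  agree this leaves, the exponents being strictly increasing, no room for x_i anywhere else, and x_i
  = 0 turns 1 + x_i + x_j into 1 + x_j. The rows above the skew diagram are removed in this way;
  their number is the row part of c. Columns leave as powers of y_j, whose factors 1 + x_j count
  with the opposite sign. The products prod (1 + x_i)^c have unbounded degree and lie outside
  \<open>Sym\<close>. For Schur coefficients they are truncated; where a single monomial is read,
  the full series replaces the truncation. Symmetry, the Schur basis and the rules of
  Murnaghan-Nakayama and Pieri are all read off from coefficients of f times the Vandermonde
  determinant, and conjugation is controlled by its effect on power sums.\<close>

hide_const (open) Conjugate.conjugate_class.conjugate Matrix.scalar_prod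

section \<open>Monomials and endomorphisms of the ring of power series\<close>

definition mon :: "'v multiset \<Rightarrow> 'v pseries" where
  "mon a = Abs_pseries (\<lambda>m. if m = a then 1 else 0)"

definition var :: "'v \<Rightarrow> 'v pseries" where
  "var i = mon {#i#}"

definition cst :: "rat \<Rightarrow> 'v pseries" where
  "cst q = scale q 1"

lemma mcoeff_mon: "mcoeff (mon a) m = (if m = a then 1 else 0)"
  by (simp add: mon_def)

lemma mcoeff_scale: "mcoeff (scale q f) m = q * mcoeff f m"
  by (simp add: scale_def)

lemma mcoeff_sum: "mcoeff (sum f A) m = (\<Sum>x\<in>A. mcoeff (f x) m)"
  by (induction A rule: infinite_finite_induct) (auto simp: mcoeff_basic)

lemma mcoeff_mon_times: "mcoeff (mon a * f) m = (if a \<subseteq># m then mcoeff f (m - a) else 0)"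
proof -
  have "mcoeff (mon a * f) m = (\<Sum>p\<in>splits m. if fst p = a then mcoeff f (snd p) else 0)"
    by (auto simp: mcoeff_times mcoeff_mon intro!: sum.cong)
  also have "\<dots> = (\<Sum>p\<in>splits m \<inter> {p. fst p = a}. mcoeff f (snd p))"
    by (simp add: sum.inter_restrict)
  also have "splits m \<inter> {p. fst p = a} = (if a \<subseteq># m then {(a, m - a)} else {})"
    by (auto simp: splits_def)
  finally show ?thesis by simp
qed

lemma mon_mult: "mon a * mon b = mon (a + b)"
proof (rule pseries_eqI)
  fix m
  have "a \<subseteq># m \<and> m - a = b \<longleftrightarrow> m = a + b"
    by (metis add_diff_cancel_left' mset_subset_eq_add_left subset_mset.add_diff_inverse)
  then show "mcoeff (mon a * mon b) m = mcoeff (mon (a + b)) m"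
    by (auto simp: mcoeff_mon_times mcoeff_mon)
qed

lemma mon_empty: "mon {#} = 1"
  by (rule pseries_eqI) (simp add: mcoeff_mon mcoeff_basic)

lemma mon_add_mset: "mon (add_mset i a) = var i * mon a"
  by (simp add: var_def mon_mult)

lemma var_power: "var i ^ k = mon (replicate_mset k i)"
  by (induction k) (auto simp: mon_empty mon_add_mset)

lemma mcoeff_cst_times:
  fixes m :: "'v multiset"
  shows "mcoeff (cst q * f) m = q * mcoeff f m"
proof -
  have "(cst q :: 'v pseries) = Abs_pseries (\<lambda>m. if m = {#} then q else 0)"
    by (rule pseries_eqI) (simp add: cst_def mcoeff_scale mcoeff_basic)
  then have "mcoeff (cst q) m = (if m = {#} then q else 0)" for m :: "'v multiset"
    by simp
  then have "mcoeff (cst q * f) m = (\<Sum>p\<in>splits m. if fst p = {#} then q * mcoeff f (snd p) else 0)"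
    by (auto simp: mcoeff_times intro!: sum.cong)
  also have "\<dots> = (\<Sum>p\<in>splits m \<inter> {p. fst p = {#}}. q * mcoeff f (snd p))"
    by (simp add: sum.inter_restrict)
  also have "splits m \<inter> {p. fst p = {#}} = {({#}, m)}"
    by (auto simp: splits_def)
  finally show ?thesis by simp
qed

lemma scale_eq: "scale q f = cst q * f"
  by (rule pseries_eqI) (simp add: mcoeff_cst_times mcoeff_scale)

lemma mcoeff_cst: "mcoeff (cst q) m = (if m = {#} then q else 0)"
  by (simp add: cst_def mcoeff_scale mcoeff_basic)

lemma cst_of_int: "cst (of_int k) = (of_int k :: 'v pseries)"
proof -
  have "cst (of_nat n) = (of_nat n :: 'v pseries)" for n
  proof (induction n)
    case (Suc n)
    have "cst (of_nat (Suc n)) = 1 + (cst (of_nat n) :: 'v pseries)"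
      by (rule pseries_eqI) (simp add: mcoeff_cst mcoeff_basic)
    then show ?case using Suc by (metis of_nat_Suc)
  qed (auto intro!: pseries_eqI simp: mcoeff_cst mcoeff_basic)
  note of_nat = this
  have uminus: "cst (- q) = (- cst q :: 'v pseries)" for q
    by (rule pseries_eqI) (simp add: mcoeff_cst mcoeff_basic)
  show ?thesis
  proof (cases k rule: int_cases2)
    case (nonneg n)
    then show ?thesis using of_nat[of n] by simp
  next
    case (nonpos n)
    then show ?thesis using of_nat[of n] uminus[of "of_nat n"] by simp
  qed
qed

lemma mcoeff_of_int_times: "mcoeff (of_int k * f) m = of_int k * mcoeff f m"
  by (metis cst_of_int mcoeff_cst_times)

lemma cst_mult: "cst a * cst b = cst (a * b)"
  by (rule pseries_eqI) (simp add: mcoeff_cst_times mcoeff_cst)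

lemma cst_1: "cst 1 = 1" and cst_0: "cst 0 = 0" and cst_minus: "cst (- a) = - cst a"
  by (auto intro!: pseries_eqI simp: mcoeff_cst mcoeff_basic)

lemma mcoeff_minus_one_power: "mcoeff ((- 1) ^ k * f) m = (- 1) ^ k * mcoeff f m"
  by (cases "even k") (auto simp: mcoeff_basic)

section \<open>Restriction to a set of variables, permutation of the variables, sign change\<close>

definition tr :: "'v set \<Rightarrow> 'v pseries \<Rightarrow> 'v pseries" where
  "tr I f = Abs_pseries (\<lambda>m. if set_mset m \<subseteq> I then mcoeff f m else 0)"

lemma mcoeff_tr: "mcoeff (tr I f) m = (if set_mset m \<subseteq> I then mcoeff f m else 0)"
  by (simp add: tr_def)

interpretation tr: comm_ring_hom "tr I" for I :: "'v set"
proof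
  fix f g :: "'v pseries"
  show "tr I (f * g) = tr I f * tr I g"
  proof (rule pseries_eqI)
    fix m
    have "set_mset m \<subseteq> I \<longleftrightarrow> set_mset a \<subseteq> I \<and> set_mset b \<subseteq> I" if "(a, b) \<in> splits m" for a b
      using that by (auto simp: splits_def)
    then show "mcoeff (tr I (f * g)) m = mcoeff (tr I f * tr I g) m"
      by (cases "set_mset m \<subseteq> I") (auto simp: mcoeff_times mcoeff_tr intro!: sum.cong sum.neutral)
  qed
qed (auto intro!: pseries_eqI simp: mcoeff_tr mcoeff_basic)

lemma tr_mon: "tr I (mon a) = (if set_mset a \<subseteq> I then mon a else 0)"
  by (rule pseries_eqI) (auto simp: mcoeff_tr mcoeff_mon mcoeff_basic)

lemma tr_var: "tr I (var i) = (if i \<in> I then var i else 0)"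
  by (simp add: var_def tr_mon)

lemma tr_tr: "tr I (tr J f) = tr (I \<inter> J) f"
  by (rule pseries_eqI) (auto simp: mcoeff_tr)

text \<open>For a bijection this renames the variable \<open>i\<close> to the preimage of
  \<open>i\<close>. Coefficients are read as in \<open>Sym\<close>, so that symmetry becomes the
  equation \<open>pm \<sigma> f = f\<close>.\<close>

definition pm :: "('v \<Rightarrow> 'v) \<Rightarrow> 'v pseries \<Rightarrow> 'v pseries" where
  "pm \<sigma> f = Abs_pseries (\<lambda>m. mcoeff f (image_mset \<sigma> m))"

lemma mcoeff_pm: "mcoeff (pm \<sigma> f) m = mcoeff f (image_mset \<sigma> m)"
  by (simp add: pm_def)

lemma image_mset_bij_cancel:
  assumes "bij \<sigma>"
  shows "image_mset \<sigma> (image_mset (inv_into UNIV \<sigma>) m) = m" "image_mset (inv_into UNIV \<sigma>) (image_mset \<sigma> m) = m"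
  using assms by (auto simp: multiset.map_comp o_def bij_def surj_f_inv_f)

lemma pm_mult:
  assumes "bij \<sigma>"
  shows "pm \<sigma> (f * g) = pm \<sigma> f * pm \<sigma> g"
proof (rule pseries_eqI)
  fix m
  show "mcoeff (pm \<sigma> (f * g)) m = mcoeff (pm \<sigma> f * pm \<sigma> g) m"
    unfolding mcoeff_pm mcoeff_times
    by (rule sum.reindex_bij_witness[where i = "map_prod (image_mset \<sigma>) (image_mset \<sigma>)"
          and j = "map_prod (image_mset (inv_into UNIV \<sigma>)) (image_mset (inv_into UNIV \<sigma>))"])
       (auto simp: splits_def image_mset_bij_cancel[OF assms] simp flip: image_mset_union)
qed

lemma pm_hom: "bij \<sigma> \<Longrightarrow> comm_ring_hom (pm \<sigma>)"
  by unfold_locales (auto intro!: pseries_eqI simp: pm_mult mcoeff_pm mcoeff_basic)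

lemma pm_mon:
  assumes "bij \<sigma>"
  shows "pm \<sigma> (mon a) = mon (image_mset (inv_into UNIV \<sigma>) a)"
proof (rule pseries_eqI)
  fix m
  have "image_mset \<sigma> m = a \<longleftrightarrow> m = image_mset (inv_into UNIV \<sigma>) a"
    using image_mset_bij_cancel[OF assms] by metis
  then show "mcoeff (pm \<sigma> (mon a)) m = mcoeff (mon (image_mset (inv_into UNIV \<sigma>) a)) m"
    by (simp add: mcoeff_pm mcoeff_mon)
qed

text \<open>The substitution of -x_i for x_i. It supplies the degree sign of the antipode and turns
  prod 1/(1 - x_i) into prod 1/(1 + x_i).\<close>

definition neg :: "'v pseries \<Rightarrow> 'v pseries" where
  "neg f = Abs_pseries (\<lambda>m. (- 1) ^ size m * mcoeff f m)"

lemma mcoeff_neg: "mcoeff (neg f) m = (- 1) ^ size m * mcoeff f m"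
  by (simp add: neg_def)

interpretation neg: comm_ring_hom "neg :: 'v pseries \<Rightarrow> 'v pseries"
proof
  fix f g :: "'v pseries"
  show "neg (f * g) = neg f * neg g"
  proof (rule pseries_eqI)
    fix m :: "'v multiset"
    have "(- 1) ^ size m = (- 1 :: rat) ^ size a * (- 1) ^ size b" if "(a, b) \<in> splits m" for a b
      using that by (auto simp: splits_def power_add)
    then show "mcoeff (neg (f * g)) m = mcoeff (neg f * neg g) m"
      by (auto simp: mcoeff_times mcoeff_neg sum_distrib_left intro!: sum.cong)
  qed
qed (auto intro!: pseries_eqI simp: mcoeff_neg mcoeff_basic algebra_simps)

lemma neg_cst: "neg (cst q) = cst q"
  by (rule pseries_eqI) (auto simp: mcoeff_neg mcoeff_cst)

section \<open>Substitution of x + t x^2 for every variable\<close>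

definition sqgen :: "rat \<Rightarrow> 'v multiset \<Rightarrow> 'v pseries" where
  "sqgen t k = prod_mset (image_mset (\<lambda>i. var i + cst t * (var i * var i)) k)"

lemma sqgen_simps:
  "sqgen t {#} = 1"
  "sqgen t (add_mset i k) = (var i + cst t * (var i * var i)) * sqgen t k"
  "sqgen t (a + b) = sqgen t a * sqgen t b"
  by (auto simp: sqgen_def)

lemma mcoeff_sqgen_add_mset:
  "mcoeff (sqgen t (add_mset i k)) m =
     (if i \<in># m then mcoeff (sqgen t k) (m - {#i#}) else 0) +
     (if {#i, i#} \<subseteq># m then t * mcoeff (sqgen t k) (m - {#i, i#}) else 0)"
proof -
  have "sqgen t (add_mset i k) = mon {#i#} * sqgen t k + cst t * (mon {#i, i#} * sqgen t k)"
    by (simp add: sqgen_simps mon_add_mset mon_empty algebra_simps)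
  then show ?thesis
    by (simp only: mcoeff_basic mcoeff_cst_times mcoeff_mon_times) simp
qed

text \<open>Every factor contributes x_i or x_i^2. The lower bound makes the sums in
  \<open>phi\<close> finite, the upper bound keeps degrees bounded.\<close>

lemma sqgen_support: "mcoeff (sqgen t k) m \<noteq> 0 \<Longrightarrow> k \<subseteq># m \<and> size m \<le> 2 * size k"
proof (induction k arbitrary: m)
  case empty
  then show ?case by (auto simp: sqgen_simps mcoeff_basic split: if_splits)
next
  case (add i k)
  from add.prems consider
    "i \<in># m" "mcoeff (sqgen t k) (m - {#i#}) \<noteq> 0"
    | "{#i, i#} \<subseteq># m" "mcoeff (sqgen t k) (m - {#i, i#}) \<noteq> 0"
    by (force simp: mcoeff_sqgen_add_mset split: if_splits)
  then show ?case
  proof cases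
    case 1
    then obtain m' where "m = add_mset i m'" by (metis insert_DiffM)
    with add.IH[OF 1(2)] show ?thesis by auto
  next
    case 2
    then obtain m' where "m = {#i, i#} + m'" by (metis subset_mset.add_diff_inverse)
    with add.IH[OF 2(2)] show ?thesis
      by (auto simp: subset_mset.add_increasing intro: subset_mset.order_trans)
  qed
qed

lemma add_subseteq_msetD:
  assumes "a + b \<subseteq># m"
  shows "a \<subseteq># m" "b \<subseteq># m"
  using subset_mset.order_trans[OF mset_subset_eq_add_left assms]
    subset_mset.order_trans[OF mset_subset_eq_add_right assms] by simp_all

text \<open>Extends \<open>sqgen\<close> from monomials to all series: by
  \<open>sqgen_support\<close> only divisors of \<open>m\<close> can contribute. Both t = 1 and t =
  -1 occur, since conjugation reverses the sign of t.\<close>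

definition phi :: "rat \<Rightarrow> 'v pseries \<Rightarrow> 'v pseries" where
  "phi t f = Abs_pseries (\<lambda>m. \<Sum>k | k \<subseteq># m. mcoeff f k * mcoeff (sqgen t k) m)"

lemma mcoeff_phi: "mcoeff (phi t f) m = (\<Sum>k | k \<subseteq># m. mcoeff f k * mcoeff (sqgen t k) m)"
  by (simp add: phi_def)

lemma phi_mon: "phi t (mon a) = sqgen t a"
proof (rule pseries_eqI)
  fix m
  have "mcoeff (phi t (mon a)) m = (\<Sum>k | k \<subseteq># m. if k = a then mcoeff (sqgen t k) m else 0)"
    unfolding mcoeff_phi mcoeff_mon by (rule sum.cong) auto
  also have "\<dots> = (if a \<subseteq># m then mcoeff (sqgen t a) m else 0)"
    by (simp add: finite_submultisets)
  also have "\<dots> = mcoeff (sqgen t a) m" using sqgen_support by auto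
  finally show "mcoeff (phi t (mon a)) m = mcoeff (sqgen t a) m" .
qed

text \<open>Both sides become double sums over pairs of divisors of \<open>m\<close>; a pair whose
  product does not divide \<open>m\<close> has coefficient 0 and may be added freely.\<close>

lemma phi_mult: "phi t (f * g) = phi t f * phi t g"
proof (rule pseries_eqI)
  fix m :: "'a multiset"
  define S where "S = {a. a \<subseteq># m}"
  define G where "G = (\<lambda>(a :: 'a multiset) n. mcoeff (sqgen t a) n)"
  have fin: "finite S" by (simp add: S_def finite_submultisets)
  have G0: "G a n = 0" if "\<not> a \<subseteq># n" for a n using sqgen_support that by (auto simp: G_def)
  have ext: "(\<Sum>k | k \<subseteq># n. F k * G k n) = (\<Sum>k\<in>S. F k * G k n)" if "n \<subseteq># m" for n F
    using that fin by (intro sum.mono_neutral_left) (auto simp: S_def G0 intro: subset_mset.order_trans)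
  have "mcoeff (phi t (f * g)) m = (\<Sum>k\<in>S. \<Sum>p\<in>splits k. mcoeff f (fst p) * mcoeff g (snd p) * G k m)"
    by (simp add: mcoeff_phi S_def G_def mcoeff_times sum_distrib_right split_def)
  also have "\<dots> = (\<Sum>(k, p)\<in>(SIGMA k:S. splits k). mcoeff f (fst p) * mcoeff g (snd p) * G k m)"
    using fin by (simp add: sum.Sigma)
  also have "\<dots> = (\<Sum>p\<in>{p \<in> S \<times> S. fst p + snd p \<in> S}. mcoeff f (fst p) * mcoeff g (snd p) * G (fst p + snd p) m)"
    by (rule sum.reindex_bij_witness[where i = "\<lambda>p. (fst p + snd p, p)" and j = snd])
       (use add_subseteq_msetD in \<open>auto simp: splits_def S_def\<close>)
  also have "\<dots> = (\<Sum>p\<in>S \<times> S. mcoeff f (fst p) * mcoeff g (snd p) * G (fst p + snd p) m)"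
    using fin by (intro sum.mono_neutral_left) (auto simp: S_def G0)
  also have "\<dots> = (\<Sum>p\<in>S \<times> S. \<Sum>q\<in>splits m.
      mcoeff f (fst p) * mcoeff g (snd p) * (G (fst p) (fst q) * G (snd p) (snd q)))"
    by (simp add: G_def sqgen_simps mcoeff_times sum_distrib_left split_def)
  also have "\<dots> = (\<Sum>q\<in>splits m. \<Sum>p\<in>S \<times> S.
      mcoeff f (fst p) * mcoeff g (snd p) * (G (fst p) (fst q) * G (snd p) (snd q)))"
    by (rule sum.swap)
  also have "\<dots> = (\<Sum>q\<in>splits m. (\<Sum>a\<in>S. mcoeff f a * G a (fst q)) * (\<Sum>b\<in>S. mcoeff g b * G b (snd q)))"
    by (simp add: sum_product sum.cartesian_product split_def algebra_simps)
  also have "\<dots> = (\<Sum>q\<in>splits m. mcoeff (phi t f) (fst q) * mcoeff (phi t g) (snd q))"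
    by (rule sum.cong) (auto simp: mcoeff_phi splits_def ext[unfolded G_def] G_def)
  also have "\<dots> = mcoeff (phi t f * phi t g) m"
    by (simp add: mcoeff_times split_def)
  finally show "mcoeff (phi t (f * g)) m = mcoeff (phi t f * phi t g) m" .
qed

interpretation phi: comm_ring_hom "phi t :: 'v pseries \<Rightarrow> 'v pseries" for t
proof
  show "phi t 1 = (1 :: 'v pseries)"
    using phi_mon[of t "{#}"] by (simp add: mon_empty sqgen_simps)
qed (auto intro!: pseries_eqI simp: phi_mult mcoeff_phi mcoeff_basic algebra_simps sum.distrib)

lemma phi_cst: "phi t (cst q * f) = cst q * phi t f"
  by (rule pseries_eqI) (simp add: mcoeff_phi mcoeff_cst_times sum_distrib_left mult.assoc)

text \<open>Agreement at all divisors of \<open>m\<close>. The coefficient of a product or of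
  \<open>phi\<close> at \<open>m\<close> depends on nothing else, so at \<open>m\<close> a series
  can be exchanged with a truncation of it or with its restriction to finitely many
  variables.\<close>

definition eqb :: "'v multiset \<Rightarrow> 'v pseries \<Rightarrow> 'v pseries \<Rightarrow> bool" where
  "eqb m f g \<longleftrightarrow> (\<forall>a. a \<subseteq># m \<longrightarrow> mcoeff f a = mcoeff g a)"

lemma eqb_refl: "eqb m f f" and eqb_D: "eqb m f g \<Longrightarrow> mcoeff f m = mcoeff g m"
  by (auto simp: eqb_def)

lemma eqb_mult:
  assumes "eqb m f f'" "eqb m g g'"
  shows "eqb m (f * g) (f' * g')"
  unfolding eqb_def
proof (intro allI impI)
  fix k assume k: "k \<subseteq># m"
  have "mcoeff f a * mcoeff g b = mcoeff f' a * mcoeff g' b" if "(a, b) \<in> splits k" for a b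
  proof -
    have "a + b \<subseteq># m" using that k by (simp add: splits_def)
    then show ?thesis using add_subseteq_msetD assms by (metis eqb_def)
  qed
  then show "mcoeff (f * g) k = mcoeff (f' * g') k"
    by (auto simp: mcoeff_times intro!: sum.cong)
qed

lemma eqb_power: "eqb m f g \<Longrightarrow> eqb m (f ^ k) (g ^ k)"
  by (induction k) (auto simp: eqb_refl eqb_mult)

lemma eqb_phi: "eqb m f g \<Longrightarrow> eqb m (phi t f) (phi t g)"
  by (auto simp: eqb_def mcoeff_phi intro!: sum.cong intro: subset_mset.order_trans)

lemma eqb_tr: "set_mset m \<subseteq> I \<Longrightarrow> eqb m (tr I f) f"
  by (auto simp: eqb_def mcoeff_tr dest: set_mset_mono)

lemma mcoeff_times_order:
  assumes "\<And>m. size m < j \<Longrightarrow> mcoeff f m = 0" "\<And>m. size m < k \<Longrightarrow> mcoeff g m = 0" "size m < j + k"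
  shows "mcoeff (f * g) m = 0"
proof -
  have "mcoeff f a * mcoeff g b = 0" if "(a, b) \<in> splits m" for a b
  proof -
    have "size a + size b = size m" using that by (auto simp: splits_def)
    then have "size a < j \<or> size b < k" using assms(3) by linarith
    then show ?thesis using assms by auto
  qed
  then show ?thesis by (auto simp: mcoeff_times intro!: sum.neutral)
qed

text \<open>The geometric series in u = 1 - f: the k-th power has no terms of degree below k, so at
  each monomial the series may be cut at the degree of that monomial.\<close>

lemma ex_inverse:
  assumes "mcoeff f {#} = 1"
  shows "\<exists>g. f * g = 1"
proof -
  define u where "u = 1 - f"
  have u0: "mcoeff u m = 0" if "size m < 1" for m
    using that assms by (auto simp: u_def mcoeff_basic)
  have uk: "mcoeff (u ^ k) m = 0" if "size m < k" for k m
    using that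
  proof (induction k arbitrary: m)
    case (Suc k)
    have "mcoeff (u * u ^ k) m = 0"
      by (rule mcoeff_times_order[of 1 _ k]) (use u0 Suc in auto)
    then show ?case by simp
  qed simp
  define g where "g = Abs_pseries (\<lambda>m. \<Sum>k\<le>size m. mcoeff (u ^ k) m)"
  have "mcoeff (f * g) m = mcoeff 1 m" for m
  proof -
    have "eqb m g (\<Sum>k\<le>size m. u ^ k)"
      unfolding eqb_def mcoeff_sum g_def mcoeff_Abs
    proof (intro allI impI sum.mono_neutral_left ballI)
      fix a i assume "a \<subseteq># m" "i \<in> {..size m} - {..size a}"
      then show "mcoeff (u ^ i) a = 0" using uk[of a i] by simp
    qed (auto simp: size_mset_mono)
    then have "mcoeff (f * g) m = mcoeff ((1 - u) * (\<Sum>k\<le>size m. u ^ k)) m"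
      using eqb_D[OF eqb_mult[OF eqb_refl, of m g _ f]] by (simp add: u_def)
    also have "(1 - u) * (\<Sum>k\<le>size m. u ^ k) = 1 - u ^ Suc (size m)"
      by (rule sum_gp_basic)
    also have "mcoeff (1 - u ^ Suc (size m)) m = mcoeff 1 m"
      using uk[of m "Suc (size m)"] by (simp add: mcoeff_basic)
    finally show ?thesis .
  qed
  then show ?thesis by (blast intro: pseries_eqI)
qed

definition expo :: "'v set \<Rightarrow> ('v \<Rightarrow> nat) \<Rightarrow> 'v multiset" where
  "expo I e = (\<Sum>i\<in>I. replicate_mset (e i) i)"

lemma count_expo: "finite I \<Longrightarrow> count (expo I e) i = (if i \<in> I then e i else 0)"
  by (simp add: expo_def count_sum)

lemma size_expo: "finite I \<Longrightarrow> size (expo I e) = sum e I"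
  unfolding expo_def by (induction I rule: finite_induct) auto

lemma set_expo: "finite I \<Longrightarrow> set_mset (expo I e) \<subseteq> I"
  by (auto simp: count_expo simp flip: count_greater_zero_iff split: if_splits)

lemma expo_eqI: "finite I \<Longrightarrow> set_mset m \<subseteq> I \<Longrightarrow> expo I (count m) = m"
  by (rule multiset_eqI) (auto simp: count_expo count_eq_zero_iff)

lemma expo_cong: "(\<And>i. i \<in> I \<Longrightarrow> e i = e' i) \<Longrightarrow> expo I e = expo I e'"
  by (auto simp: expo_def intro!: sum.cong)

lemma mon_expo: "finite I \<Longrightarrow> mon (expo I e) = (\<Prod>i\<in>I. var i ^ e i)"
proof (induction I rule: finite_induct)
  case (insert i I)
  have "expo (insert i I) e = replicate_mset (e i) i + expo I e"
    using insert.hyps by (simp add: expo_def)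
  then show ?case using insert by (simp add: mon_mult[symmetric] var_power)
qed (simp add: expo_def mon_empty)

section \<open>Generalised Vandermonde determinants\<close>

text \<open>The determinant of the powers y_j^(e i), with an arbitrary index set, so that deleting
  an index needs no renumbering.\<close>

definition gdet :: "nat set \<Rightarrow> (nat \<Rightarrow> 'a :: comm_ring_1) \<Rightarrow> (nat \<Rightarrow> nat) \<Rightarrow> 'a" where
  "gdet I y e = (\<Sum>w | w permutes I. of_int (sign w) * (\<Prod>j\<in>I. y j ^ e (w j)))"

lemma gdet_hom:
  assumes "comm_ring_hom h"
  shows "h (gdet I y e) = gdet I (\<lambda>i. h (y i)) e"
proof -
  interpret comm_ring_hom h by fact
  show ?thesis by (simp add: gdet_def hom_distribs)
qed

lemma gdet_cong:
  assumes "\<And>i. i \<in> I \<Longrightarrow> y i = y' i" "\<And>i. i \<in> I \<Longrightarrow> e i = e' i"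
  shows "gdet I y e = gdet I y' e'"
  unfolding gdet_def using assms
  by (intro sum.cong prod.cong arg_cong2[where f = "(*)"] refl arg_cong2[where f = "(^)"])
     (auto simp: permutes_in_image)

lemma gdet_permute_vars:
  assumes I: "finite I" and \<sigma>: "\<sigma> permutes I"
  shows "gdet I (y \<circ> \<sigma>) e = of_int (sign \<sigma>) * gdet I y e"
proof -
  have s: "sign (w \<circ> \<sigma>) = sign w * sign \<sigma>" if "w permutes I" for w
    using that assms sign_compose permutation_permutes by blast
  have "of_int (sign \<sigma>) * gdet I y e =
      (\<Sum>w | w permutes I. of_int (sign \<sigma>) * (of_int (sign w) * (\<Prod>j\<in>I. y j ^ e (w j))))"
    by (simp add: gdet_def sum_distrib_left)
  also have "\<dots> = (\<Sum>w | w permutes I. of_int (sign (w \<circ> \<sigma>)) * (\<Prod>j\<in>I. y (\<sigma> j) ^ e ((w \<circ> \<sigma>) j)))"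
  proof (intro sum.cong refl)
    fix w assume "w \<in> {w. w permutes I}"
    then have w: "w permutes I" by simp
    have "(\<Prod>j\<in>I. y j ^ e (w j)) = (\<Prod>j\<in>I. y (\<sigma> j) ^ e (w (\<sigma> j)))"
      by (rule prod.permute[OF \<sigma>, unfolded o_def])
    then show "of_int (sign \<sigma>) * (of_int (sign w) * (\<Prod>j\<in>I. y j ^ e (w j))) =
        of_int (sign (w \<circ> \<sigma>)) * (\<Prod>j\<in>I. y (\<sigma> j) ^ e ((w \<circ> \<sigma>) j))"
      by (simp add: s[OF w])
  qed
  also have "\<dots> = gdet I (y \<circ> \<sigma>) e"
    unfolding gdet_def o_def[of y]
    by (rule sum_permutations_compose_right[OF \<sigma>, symmetric])
  finally show ?thesis by simp
qed

lemma geometric_interval: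
  fixes x z :: "'a :: comm_ring_1"
  assumes "a \<le> b"
  shows "(x - z) * (\<Sum>k\<in>{a..<b}. x ^ k * z ^ (b - Suc k)) = x ^ b - z ^ (b - a) * x ^ a"
  using assms
proof (induction b rule: dec_induct)
  case (step b)
  have "(\<Sum>k\<in>{a..<b}. x ^ k * z ^ (b - k)) = z * (\<Sum>k\<in>{a..<b}. x ^ k * z ^ (b - Suc k))"
    unfolding sum_distrib_left
  proof (rule sum.cong[OF refl])
    fix k assume "k \<in> {a..<b}"
    then have "b - k = Suc (b - Suc k)" by auto
    then show "x ^ k * z ^ (b - k) = z * (x ^ k * z ^ (b - Suc k))" by simp
  qed
  then have "(x - z) * (\<Sum>k\<in>{a..<Suc b}. x ^ k * z ^ (Suc b - Suc k))
      = z * ((x - z) * (\<Sum>k\<in>{a..<b}. x ^ k * z ^ (b - Suc k))) + (x - z) * x ^ b"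
    using step.hyps by (simp add: algebra_simps)
  also have "\<dots> = x ^ Suc b - z ^ (Suc b - a) * x ^ a"
    unfolding step.IH using step.hyps by (simp add: algebra_simps Suc_diff_le)
  finally show ?case .
qed simp

text \<open>
  Column operations clear the row of the last variable \<open>z\<close> up to its first entry; each remaining
  row \<open>i\<close> is then divisible by \<open>y i - z\<close>, and the quotients are geometric sums.
\<close>
lemma gdet_eliminate:
  fixes y :: "nat \<Rightarrow> 'a :: comm_ring_1"
  assumes l: "\<And>r. r < n \<Longrightarrow> l r \<le> l (Suc r)"
  shows "gdet {..<Suc n} y l = (\<Prod>i<n. y n - y i) * (y n ^ l 0 *
    (\<Sum>w | w permutes {..<n}. of_int (sign w) *
      (\<Prod>j<n. \<Sum>k\<in>{l (w j)..<l (Suc (w j))}. y j ^ k * y n ^ (l (Suc (w j)) - Suc k))))"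
proof -
  define g where "g = (\<lambda>j r. \<Sum>k\<in>{l r..<l (Suc r)}. y j ^ k * y n ^ (l (Suc r) - Suc k))"
  define A where "A = mat (Suc n) (Suc n) (\<lambda>(i, c). y i ^ l c)"
  \<comment> \<open>Right multiplication by \<open>U\<close> subtracts y_n^(l_c - l_(c-1)) times
    column c - 1 from column c, always in terms of the original columns; the row of y_n becomes 0
    after its first entry.\<close>
  define U where "U = mat (Suc n) (Suc n) (\<lambda>(i, c). if i = c then 1 else
    if Suc i = c then - (y n ^ (l c - l i)) else 0)"
  define B where "B = A * U"
  have carr: "A \<in> carrier_mat (Suc n) (Suc n)" "U \<in> carrier_mat (Suc n) (Suc n)"
    "B \<in> carrier_mat (Suc n) (Suc n)"
    by (auto simp: A_def U_def B_def)
  have B: "B $$ (i, c) = (if c = 0 then y i ^ l 0 else y i ^ l c - y n ^ (l c - l (c - 1)) * y i ^ l (c - 1))"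
    if "i < Suc n" "c < Suc n" for i c
  proof -
    have "B $$ (i, c) = (\<Sum>k = 0..<Suc n. y i ^ l k * (if k = c then 1 else
        if Suc k = c then - (y n ^ (l c - l k)) else 0))"
      using that by (simp add: B_def A_def U_def scalar_prod_def del: sum.op_ivl_Suc)
    also have "\<dots> = (\<Sum>k \<in> {c} \<union> (if c = 0 then {} else {c - 1}). y i ^ l k * (if k = c then 1 else
        if Suc k = c then - (y n ^ (l c - l k)) else 0))"
      using that by (intro sum.mono_neutral_right) (auto split: if_splits)
    also have "\<dots> = (if c = 0 then y i ^ l 0 else y i ^ l c - y n ^ (l c - l (c - 1)) * y i ^ l (c - 1))"
      by (cases c) auto
    finally show ?thesis .
  qed
  have B_fac: "B $$ (i, Suc r) = (y i - y n) * g i r" if "i < Suc n" "r < n" for i r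
    using that l[of r] by (simp add: B g_def geometric_interval)
  have "det U = 1"
  proof -
    have "upper_triangular U" by (auto simp: U_def upper_triangular_def)
    then have "det U = prod_list (diag_mat U)" using carr(2) by (rule det_upper_triangular)
    also have "diag_mat U = replicate (Suc n) 1"
      by (rule nth_equalityI) (auto simp: diag_mat_def U_def simp del: upt_Suc replicate_Suc)
    finally show ?thesis by simp
  qed
  have "gdet {..<Suc n} y l = det A"
  proof -
    have "det A = (\<Sum>p | p permutes {..<Suc n}. of_int (sign p) * (\<Prod>i<Suc n. A $$ (i, p i)))"
      using det_def'[OF carr(1)] by (simp only: atLeast0LessThan)
    also have "\<dots> = gdet {..<Suc n} y l"
      unfolding gdet_def
    proof (intro sum.cong refl arg_cong2[where f = "(*)"] prod.cong)
      fix p j assume "p \<in> {p. p permutes {..<Suc n}}" "j \<in> {..<Suc n}"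
      then have "j < Suc n" "p j < Suc n" using permutes_in_image[of p "{..<Suc n}" j] by auto
      then show "A $$ (j, p j) = y j ^ l (p j)" by (simp add: A_def)
    qed
    finally show ?thesis by simp
  qed
  also have "\<dots> = det B" using \<open>det U = 1\<close> det_mult[OF carr(1,2)] by (simp add: B_def)
  also have "\<dots> = (\<Sum>j<Suc n. B $$ (n, j) * cofactor B n j)"
    by (rule laplace_expansion_row[OF carr(3)]) simp
  also have "\<dots> = B $$ (n, 0) * cofactor B n 0"
  proof -
    have "B $$ (n, Suc j) = 0" if "j < n" for j using B_fac[of n j] that by simp
    then show ?thesis by (simp add: sum.lessThan_Suc_shift del: sum.lessThan_Suc)
  qed
  also have "B $$ (n, 0) = y n ^ l 0" by (simp add: B)
  also have "cofactor B n 0 = (- 1) ^ n * det (mat_delete B n 0)" by (simp add: cofactor_def)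
  also have "det (mat_delete B n 0) = (\<Sum>p | p permutes {..<n}. of_int (sign p) * (\<Prod>i<n. (y i - y n) * g i (p i)))"
  proof -
    have "mat_delete B n 0 \<in> carrier_mat n n" using carr by (auto simp: mat_delete_def)
    then have "det (mat_delete B n 0) = (\<Sum>p | p permutes {..<n}. of_int (sign p) * (\<Prod>i<n. mat_delete B n 0 $$ (i, p i)))"
      using det_def' by (simp only: atLeast0LessThan)
    also have "\<dots> = (\<Sum>p | p permutes {..<n}. of_int (sign p) * (\<Prod>i<n. (y i - y n) * g i (p i)))"
    proof (intro sum.cong refl arg_cong2[where f = "(*)"] prod.cong)
      fix p j assume "p \<in> {p. p permutes {..<n}}" "j \<in> {..<n}"
      then have "j < n" "p j < n" using permutes_in_image[of p "{..<n}" j] by auto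
      then show "mat_delete B n 0 $$ (j, p j) = (y j - y n) * g j (p j)"
        using carr B_fac by (simp add: mat_delete_def)
    qed
    finally show ?thesis .
  qed
  also have "\<dots> = (\<Prod>i<n. y i - y n) * (\<Sum>p | p permutes {..<n}. of_int (sign p) * (\<Prod>i<n. g i (p i)))"
    by (simp add: prod.distrib sum_distrib_left mult.left_commute)
  finally have 1: "gdet {..<Suc n} y l = y n ^ l 0 * ((- 1) ^ n * ((\<Prod>i<n. y i - y n) *
      (\<Sum>p | p permutes {..<n}. of_int (sign p) * (\<Prod>i<n. g i (p i)))))" .
  \<comment> \<open>The cofactor sign reverses all n differences.\<close>
  have "(- 1) ^ n * (\<Prod>i<n. y i - y n) = (\<Prod>i<n. - 1 * (y i - y n))"
    by (simp only: prod.distrib) simp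
  also have "\<dots> = (\<Prod>i<n. y n - y i)" by (intro prod.cong) auto
  finally have 2: "(- 1) ^ n * (\<Prod>i<n. y i - y n) = (\<Prod>i<n. y n - y i)" .
  show ?thesis unfolding 1 mult.assoc[of "(- 1) ^ n", symmetric] 2 g_def by (simp add: mult_ac)
qed

text \<open>Multiplying out the geometric sums gives smaller determinants, one for each \<kappa>
  interlacing with \<open>l\<close>. This mirrors the removal of the largest entry of a tableau in
  \<open>tr_schur_branching\<close>.\<close>

lemma gdet_branching:
  fixes y :: "nat \<Rightarrow> 'a :: comm_ring_1"
  assumes l: "\<And>r. r < n \<Longrightarrow> l r \<le> l (Suc r)"
  shows "gdet {..<Suc n} y l = (\<Prod>i<n. y n - y i) *
    (\<Sum>\<kappa>\<in>PiE {..<n} (\<lambda>r. {l r..<l (Suc r)}).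
      y n ^ (l 0 + (\<Sum>r<n. l (Suc r) - Suc (\<kappa> r))) * gdet {..<n} y \<kappa>)"
proof -
  define P where "P = PiE {..<n} (\<lambda>r. {l r..<l (Suc r)})"
  have "(\<Prod>j<n. \<Sum>k\<in>{l (w j)..<l (Suc (w j))}. y j ^ k * y n ^ (l (Suc (w j)) - Suc k))
      = (\<Sum>\<kappa>\<in>P. y n ^ (\<Sum>r<n. l (Suc r) - Suc (\<kappa> r)) * (\<Prod>j<n. y j ^ \<kappa> (w j)))"
    if w: "w permutes {..<n}" for w
  proof -
    \<comment> \<open>Reindexing by the inverse of \<open>w\<close> makes the range of the r-th sum
      independent of \<open>w\<close>, as needed for distributing over \<open>PiE\<close>.\<close>
    have w': "inv_into UNIV w permutes {..<n}" using w by (rule permutes_inv)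
    have "(\<Prod>j<n. \<Sum>k\<in>{l (w j)..<l (Suc (w j))}. y j ^ k * y n ^ (l (Suc (w j)) - Suc k))
      = (\<Prod>r<n. \<Sum>k\<in>{l r..<l (Suc r)}. y (inv_into UNIV w r) ^ k * y n ^ (l (Suc r) - Suc k))"
      by (subst prod.permute[OF w]) (simp add: o_def permutes_inverses[OF w])
    also have "\<dots> = (\<Sum>\<kappa>\<in>P. \<Prod>r<n. y (inv_into UNIV w r) ^ \<kappa> r * y n ^ (l (Suc r) - Suc (\<kappa> r)))"
      unfolding P_def by (rule prod_sum_PiE) auto
    also have "\<dots> = (\<Sum>\<kappa>\<in>P. y n ^ (\<Sum>r<n. l (Suc r) - Suc (\<kappa> r)) * (\<Prod>j<n. y j ^ \<kappa> (w j)))"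
    proof (rule sum.cong[OF refl])
      fix \<kappa> assume "\<kappa> \<in> P"
      have "(\<Prod>r<n. y (inv_into UNIV w r) ^ \<kappa> r) = (\<Prod>j<n. y j ^ \<kappa> (w j))"
        by (subst prod.permute[OF w]) (simp add: o_def permutes_inverses[OF w])
      then show "(\<Prod>r<n. y (inv_into UNIV w r) ^ \<kappa> r * y n ^ (l (Suc r) - Suc (\<kappa> r))) =
          y n ^ (\<Sum>r<n. l (Suc r) - Suc (\<kappa> r)) * (\<Prod>j<n. y j ^ \<kappa> (w j))"
        by (simp add: prod.distrib power_sum mult.commute)
    qed
    finally show ?thesis .
  qed
  then have "(\<Sum>w | w permutes {..<n}. of_int (sign w) *
      (\<Prod>j<n. \<Sum>k\<in>{l (w j)..<l (Suc (w j))}. y j ^ k * y n ^ (l (Suc (w j)) - Suc k)))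
    = (\<Sum>w | w permutes {..<n}. \<Sum>\<kappa>\<in>P. y n ^ (\<Sum>r<n. l (Suc r) - Suc (\<kappa> r)) *
        (of_int (sign w) * (\<Prod>j<n. y j ^ \<kappa> (w j))))"
    by (intro sum.cong) (auto simp: sum_distrib_left mult_ac)
  also have "\<dots> = (\<Sum>\<kappa>\<in>P. y n ^ (\<Sum>r<n. l (Suc r) - Suc (\<kappa> r)) * gdet {..<n} y \<kappa>)"
    unfolding gdet_def sum_distrib_left by (rule sum.swap)
  finally show ?thesis
    using gdet_eliminate[of n l y, OF l] unfolding P_def[symmetric]
    by (simp add: sum_distrib_left power_add mult_ac)
qed

text \<open>For consecutive exponents the only interlacing sequence is again the identity.\<close>

lemma gdet_Vandermonde_Suc:
  fixes y :: "nat \<Rightarrow> 'a :: comm_ring_1"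
  shows "gdet {..<Suc n} y id = (\<Prod>i<n. y n - y i) * gdet {..<n} y id"
proof -
  have P: "PiE {..<n} (\<lambda>r. {id r..<id (Suc r)}) = {\<lambda>r\<in>{..<n}. r}"
  proof -
    have "PiE {..<n} (\<lambda>r. {id r..<id (Suc r)}) = PiE {..<n} (\<lambda>r. {(\<lambda>r\<in>{..<n}. r) r})"
      by (rule PiE_cong) simp
    then show ?thesis by (simp only: PiE_singleton[OF restrict_extensional])
  qed
  have "gdet {..<n} y (\<lambda>r\<in>{..<n}. r) = gdet {..<n} y id"
    by (rule gdet_cong) auto
  then show ?thesis using gdet_branching[of n id y] unfolding P by simp
qed

lemma gdet_Vandermonde:
  "gdet {..<n} y id = (\<Prod>j<n. \<Prod>i<j. y j - y i)"
proof (induction n)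
  case (Suc n)
  then show ?case by (simp only: gdet_Vandermonde_Suc prod.lessThan_Suc mult.commute)
qed (simp add: gdet_def)

section \<open>Young diagrams and their beta numbers\<close>

definition rowlen :: "(nat \<times> nat) set \<Rightarrow> nat \<Rightarrow> nat" where
  "rowlen D i = card {j. (i, j) \<in> D}"

definition rows_le :: "(nat \<times> nat) set \<Rightarrow> nat \<Rightarrow> bool" where
  "rows_le D n \<longleftrightarrow> (\<forall>i j. (i, j) \<in> D \<longrightarrow> i < n)"

lemma young_finite: "young D \<Longrightarrow> finite D"
  by (simp add: young_def)

lemma young_down: "young D \<Longrightarrow> (i, j) \<in> D \<Longrightarrow> i' \<le> i \<Longrightarrow> j' \<le> j \<Longrightarrow> (i', j') \<in> D"
  unfolding young_def by blast

lemma down_closed_nat: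
  fixes A :: "nat set"
  assumes "finite A" "\<And>x y. x \<in> A \<Longrightarrow> y \<le> x \<Longrightarrow> y \<in> A"
  shows "A = {..<card A}"
proof (cases "A = {}")
  case False
  have "A = {..Max A}"
    using assms False by (auto intro: assms(2)[OF Max_in])
  then show ?thesis by (metis card_atMost lessThan_Suc_atMost)
qed simp

lemma mem_young_iff:
  assumes "young D"
  shows "(i, j) \<in> D \<longleftrightarrow> j < rowlen D i"
proof -
  have "finite ((\<lambda>p. snd p) ` D)" using assms by (simp add: young_finite)
  then have "finite {j. (i, j) \<in> D}" by (rule finite_subset[rotated]) force
  then have "{j. (i, j) \<in> D} = {..<rowlen D i}"
    unfolding rowlen_def using assms by (intro down_closed_nat) (auto intro: young_down)
  then show ?thesis by auto
qed

lemma rowlen_mono: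
  assumes "young D" "young E" "D \<subseteq> E"
  shows "rowlen D i \<le> rowlen E i"
proof (rule ccontr)
  assume "\<not> rowlen D i \<le> rowlen E i"
  then have "(i, rowlen E i) \<in> D" by (simp add: mem_young_iff[OF assms(1)])
  then show False using assms(3) mem_young_iff[OF assms(2), of i "rowlen E i"] by auto
qed

lemma rowlen_antimono: "young D \<Longrightarrow> i \<le> i' \<Longrightarrow> rowlen D i' \<le> rowlen D i"
  by (metis le_refl mem_young_iff not_le young_down)

lemma young_eqI: "young D \<Longrightarrow> young E \<Longrightarrow> (\<And>i. rowlen D i = rowlen E i) \<Longrightarrow> D = E"
  by (auto simp: mem_young_iff)

lemma young_of_rows:
  assumes "\<And>i. i \<ge> n \<Longrightarrow> f i = 0" "\<And>i. f (Suc i) \<le> f i"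
  shows "young {(i, j). j < f i}" "rowlen {(i, j). j < f i} = f" "rows_le {(i, j). j < f i} n"
proof -
  have anti: "f i' \<le> f i" if "i \<le> i'" for i i' using assms(2) that by (rule lift_Suc_antimono_le)
  have bound: "i < n" "j < f 0" if "j < f i" for i j
    using that assms(1)[of i] anti[of 0 i] by (auto simp: not_le[symmetric])
  then have "{(i, j). j < f i} \<subseteq> {..<n} \<times> {..<f 0}" by auto
  then have "finite {(i, j). j < f i}" by (rule finite_subset) simp
  then show "young {(i, j). j < f i}"
    using anti by (auto simp: young_def) (meson order_le_less_trans order_less_le_trans)
  show "rowlen {(i, j). j < f i} = f" by (auto simp: rowlen_def)
  show "rows_le {(i, j). j < f i} n"
    using bound by (auto simp: rows_le_def)
qed

lemma rows_le_rowlen: "young D \<Longrightarrow> rows_le D n \<Longrightarrow> n \<le> i \<Longrightarrow> rowlen D i = 0"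
  by (metis mem_young_iff not_le not_gr_zero rows_le_def)

lemma rows_le_mono: "rows_le D n \<Longrightarrow> n \<le> m \<Longrightarrow> rows_le D m"
  by (force simp: rows_le_def)

lemma card_young:
  assumes "young D" "rows_le D n"
  shows "card D = (\<Sum>i<n. rowlen D i)"
proof -
  have "D = Sigma {..<n} (\<lambda>i. {..<rowlen D i})"
    using assms by (auto simp: mem_young_iff rows_le_def) blast
  then have "card D = card (Sigma {..<n} (\<lambda>i. {..<rowlen D i}))" by simp
  then show ?thesis by simp
qed

lemma young_box_le:
  assumes "young D" "(i, j) \<in> D"
  shows "Suc i * Suc j \<le> card D"
proof -
  have "{..i} \<times> {..j} \<subseteq> D" using assms by (auto intro: young_down)
  then have "card ({..i} \<times> {..j}) \<le> card D" using assms by (intro card_mono young_finite)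
  then show ?thesis by simp
qed

lemma rows_le_card: "young D \<Longrightarrow> rows_le D (card D)"
  unfolding rows_le_def using young_box_le by fastforce

lemma finite_young_bounded: "finite {D. young D \<and> card D \<le> d}"
proof (rule finite_subset)
  show "{D. young D \<and> card D \<le> d} \<subseteq> Pow ({..<d} \<times> {..<d})"
    using young_box_le by fastforce
qed simp

lemma conjugate_mem [simp]: "(i, j) \<in> conjugate D \<longleftrightarrow> (j, i) \<in> D"
  by (force simp: conjugate_def)

lemma conjugate_conjugate [simp]: "conjugate (conjugate D) = D"
  by auto

lemma card_conjugate [simp]: "card (conjugate D) = card D"
  by (simp add: conjugate_def card_image)

lemma young_conjugate [simp]: "young (conjugate D) \<longleftrightarrow> young D"
proof -
  have "young (conjugate D)" if "young D" for D
  proof -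
    have "finite (conjugate D)" using that by (simp add: conjugate_def young_finite)
    then show ?thesis using that by (auto simp: young_def)
  qed
  then show ?thesis by (metis conjugate_conjugate)
qed

text \<open>
  Rows are counted from the bottom: deleting top rows then leaves the indices of the others unchanged.
\<close>
definition beta :: "nat \<Rightarrow> (nat \<times> nat) set \<Rightarrow> nat \<Rightarrow> nat" where
  "beta n D r = rowlen D (n - Suc r) + r"

lemma beta_less: "young D \<Longrightarrow> r < s \<Longrightarrow> beta n D r < beta n D s"
  unfolding beta_def using rowlen_antimono[of D "n - Suc s" "n - Suc r"] by (simp add: diff_le_mono2)

lemma sum_beta:
  assumes "young D" "rows_le D n"
  shows "(\<Sum>r<n. beta n D r) = card D + (\<Sum>r<n. r)"
proof -
  have "(\<Sum>r<n. rowlen D (n - Suc r)) = card D"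
    unfolding card_young[OF assms] by (rule sum.nat_diff_reindex)
  then show ?thesis by (simp add: beta_def sum.distrib)
qed

lemma beta_inj:
  assumes "young D" "young E" "rows_le D n" "rows_le E n" "\<And>r. r < n \<Longrightarrow> beta n D r = beta n E r"
  shows "D = E"
proof (rule young_eqI)
  fix i
  show "rowlen D i = rowlen E i"
  proof (cases "i < n")
    case True
    then show ?thesis using assms(5)[of "n - Suc i"] by (simp add: beta_def)
  qed (use assms rows_le_rowlen in auto)
qed fact+

lemma strict_ge_id:
  fixes e :: "nat \<Rightarrow> nat"
  assumes "\<And>r s. r < s \<Longrightarrow> s < n \<Longrightarrow> e r < e s" "r < n"
  shows "r \<le> e r"
  using assms(2)
proof (induction r)
  case (Suc r)
  then have "r \<le> e r" "e r < e (Suc r)" using assms(1)[of r "Suc r"] by auto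
  then show ?case by simp
qed simp

text \<open>The row lengths are recovered as e r - r; by \<open>strict_ge_id\<close> this natural
  subtraction is exact, and strictness of \<open>e\<close> makes the lengths monotone.\<close>

lemma ex_beta:
  assumes e: "\<And>r s. r < s \<Longrightarrow> s < n \<Longrightarrow> e r < e s"
  shows "\<exists>D. young D \<and> rows_le D n \<and> (\<forall>r<n. beta n D r = e r)"
proof -
  define f where "f i = (if i < n then e (n - Suc i) - (n - Suc i) else 0)" for i
  have "f (Suc i) \<le> f i" for i
  proof (cases "Suc i < n")
    case True
    then have "n - Suc i = Suc (n - Suc (Suc i))" by simp
    then show ?thesis using True e[of "n - Suc (Suc i)" "n - Suc i"] by (simp add: f_def) linarith
  qed (simp add: f_def)
  note Y = young_of_rows[of n f, OF _ this]
  have "beta n {(i, j). j < f i} r = e r" if "r < n" for r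
    using that strict_ge_id[of n e r, OF e] Y(2) by (simp add: beta_def f_def)
  then show ?thesis using Y by (force simp: f_def)
qed

section \<open>Tableaux\<close>

text \<open>\<open>D - K\<close> is a horizontal strip, with at most one box in each column. In
  terms of row lengths this is interlacing (\<open>hstrip_rowlen\<close>).\<close>

definition hstrip :: "(nat \<times> nat) set \<Rightarrow> (nat \<times> nat) set \<Rightarrow> bool" where
  "hstrip K D \<longleftrightarrow> young K \<and> K \<subseteq> D \<and> (\<forall>i j. (Suc i, j) \<in> D \<longrightarrow> (i, j) \<in> K)"

lemma hstrip_rowlen:
  assumes "young D" "young K"
  shows "hstrip K D \<longleftrightarrow> (\<forall>i. rowlen K i \<le> rowlen D i \<and> rowlen D (Suc i) \<le> rowlen K i)"
  unfolding hstrip_def using assms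
  by (auto simp: mem_young_iff subset_iff) (meson not_le le_less_linear less_irrefl order_less_le_trans)+

lemma finite_hstrip: "young D \<Longrightarrow> finite {K. hstrip K D}"
  by (rule finite_subset[of _ "Pow D"]) (auto simp: hstrip_def young_finite)

lemma ssyt_mono:
  assumes "young D" "T \<in> ssyt D" "(i, j) \<in> D" "i' \<le> i" "j' \<le> j"
  shows "T (i', j') \<le> T (i, j)"
proof -
  have row: "T (i', j') \<le> T (i', k)" if "(i', k) \<in> D" "j' \<le> k" for k
    using that(2,1)
  proof (induction k rule: dec_induct)
    case (step k)
    have "(i', k) \<in> D" using young_down[OF assms(1) step.prems] by simp
    moreover have "T (i', k) \<le> T (i', Suc k)" using assms(2) step.prems calculation by (auto simp: ssyt_def)
    ultimately show ?case using step.IH by simp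
  qed simp
  have col: "T (i', j) \<le> T (k, j)" if "(k, j) \<in> D" "i' \<le> k" for k
    using that(2,1)
  proof (induction k rule: dec_induct)
    case (step k)
    have "(k, j) \<in> D" using young_down[OF assms(1) step.prems] by simp
    moreover have "T (k, j) < T (Suc k, j)" using assms(2) step.prems calculation by (auto simp: ssyt_def)
    ultimately show ?case using step.IH by simp
  qed simp
  have "(i', j) \<in> D" using assms by (auto intro: young_down)
  then show ?thesis using row col assms by (meson order_trans)
qed

definition tableaux :: "(nat \<times> nat) set \<Rightarrow> nat multiset \<Rightarrow> (nat \<times> nat \<Rightarrow> nat) set" where
  "tableaux D m = {T \<in> ssyt D. image_mset T (mset_set D) = m}"

lemma mcoeff_schur: "mcoeff (schur D) m = of_nat (card (tableaux D m))"
  by (simp add: schur_def tableaux_def)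

lemma tableaux_entry: "T \<in> tableaux D m \<Longrightarrow> finite D \<Longrightarrow> b \<in> D \<Longrightarrow> T b \<in># m"
  by (auto simp: tableaux_def)

lemma finite_tableaux: "finite D \<Longrightarrow> finite (tableaux D m)"
  by (rule finite_subset[of _ "PiE D (\<lambda>_. set_mset m)"])
     (auto simp: tableaux_def ssyt_def PiE_iff extensional_def intro!: finite_PiE)

lemma size_tableaux: "T \<in> tableaux D m \<Longrightarrow> size m = card D"
  by (auto simp: tableaux_def)

lemma mcoeff_schur_size: "size m \<noteq> card D \<Longrightarrow> mcoeff (schur D) m = 0"
proof -
  assume "size m \<noteq> card D"
  then have "tableaux D m = {}" using size_tableaux by blast
  then show ?thesis by (simp add: mcoeff_schur)
qed

lemma content_restrict_split:
  assumes "finite D" "K \<subseteq> D" "\<And>b. b \<in> D - K \<Longrightarrow> T b = n"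
  shows "image_mset T (mset_set D) = image_mset (restrict T K) (mset_set K) + replicate_mset (card (D - K)) n"
proof -
  have "mset_set D = mset_set K + mset_set (D - K)"
    using assms by (metis Un_Diff_cancel Diff_disjoint finite_Diff finite_subset mset_set_Union sup.absorb2)
  moreover have "image_mset (restrict T K) (mset_set K) = image_mset T (mset_set K)"
    using finite_subset[OF assms(2,1)] by (intro image_mset_cong) auto
  moreover have "image_mset T (mset_set (D - K)) = image_mset (\<lambda>_. n) (mset_set (D - K))"
    using assms by (intro image_mset_cong) auto
  ultimately show ?thesis by (simp add: image_mset_const_eq)
qed

text \<open>Removing the largest entry \<open>n\<close> from a tableau leaves a tableau whose shape differs by a horizontal strip.\<close>
lemma card_tableaux_branching:
  assumes D: "young D" and m: "set_mset m \<subseteq> {..<n}"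
  shows "card (tableaux D (m + replicate_mset c n)) =
    (\<Sum>K | hstrip K D \<and> card (D - K) = c. card (tableaux K m))"
proof -
  define L where "L = {K. hstrip K D \<and> card (D - K) = c}"
  have fin: "finite D" using D by (rule young_finite)
  have finL: "finite L" using finite_hstrip[OF D] by (simp add: L_def)
  have finK: "finite K" if "K \<in> L" for K using that fin finite_subset by (auto simp: L_def hstrip_def)
  define F where "F T = ({b \<in> D. T b < n}, restrict T {b \<in> D. T b < n})" for T :: "nat \<times> nat \<Rightarrow> nat"
  \<comment> \<open>The inverse of \<open>F\<close> fills the strip with n and is
    \<open>undefined\<close> outside \<open>D\<close>, as membership in \<open>extensional\<close>
    demands.\<close>
  define G where "G = (\<lambda>(K, S) b. if b \<in> K then S b else if b \<in> D then n else undefined :: nat)"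
  have "bij_betw F (tableaux D (m + replicate_mset c n)) (Sigma L (\<lambda>K. tableaux K m))"
  proof (rule bij_betw_byWitness[where f' = G])
    have le: "T b \<le> n" if "T \<in> tableaux D (m + replicate_mset c n)" "b \<in> D" for T b
      using tableaux_entry[OF that(1) fin that(2)] m by (auto split: if_splits)
    show "\<forall>T\<in>tableaux D (m + replicate_mset c n). G (F T) = T"
    proof
      fix T assume T: "T \<in> tableaux D (m + replicate_mset c n)"
      then have "T \<in> extensional D" by (simp add: tableaux_def ssyt_def)
      then show "G (F T) = T"
        using le[OF T] by (auto simp: G_def F_def fun_eq_iff extensional_def intro: antisym)
    qed
    show "\<forall>p\<in>Sigma L (\<lambda>K. tableaux K m). F (G p) = p"
    proof
      fix p assume "p \<in> Sigma L (\<lambda>K. tableaux K m)"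
      then obtain K S where p: "p = (K, S)" "K \<in> L" "S \<in> tableaux K m" by auto
      have "S b < n" if "b \<in> K" for b using tableaux_entry[OF p(3) finK[OF p(2)] that] m by auto
      moreover have "K \<subseteq> D" using p(2) by (simp add: L_def hstrip_def)
      ultimately have K: "{b \<in> D. G p b < n} = K" by (auto simp: G_def p(1))
      have "S \<in> extensional K" using p(3) by (simp add: tableaux_def ssyt_def)
      then have "restrict (G p) K = S" by (auto simp: G_def p(1) fun_eq_iff extensional_def)
      with K show "F (G p) = p" by (simp add: F_def p(1))
    qed
    show "F ` tableaux D (m + replicate_mset c n) \<subseteq> Sigma L (\<lambda>K. tableaux K m)"
    proof (rule image_subsetI)
      fix T assume T: "T \<in> tableaux D (m + replicate_mset c n)"
      define K where "K = {b \<in> D. T b < n}"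
      have ssyt: "T \<in> ssyt D" using T by (simp add: tableaux_def)
      have KD: "K \<subseteq> D" by (auto simp: K_def)
      have "young K"
        unfolding young_def
      proof (intro conjI allI impI)
        show "finite K" using fin by (simp add: K_def)
        fix i j i' j' assume *: "(i, j) \<in> K \<and> i' \<le> i \<and> j' \<le> j"
        then show "(i', j') \<in> K"
          using ssyt_mono[OF D ssyt, of i j i' j'] young_down[OF D, of i j i' j'] by (auto simp: K_def)
      qed
      moreover have "(i, j) \<in> K" if "(Suc i, j) \<in> D" for i j
      proof -
        have "(i, j) \<in> D" using that D by (auto intro: young_down)
        moreover have "T (i, j) < T (Suc i, j)" using ssyt that calculation by (simp add: ssyt_def)
        ultimately show ?thesis using le[OF T that] by (simp add: K_def)
      qed
      ultimately have strip: "hstrip K D" by (simp add: hstrip_def KD)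
      have "T b = n" if "b \<in> D - K" for b using le[OF T, of b] that by (auto simp: K_def intro: antisym)
      then have "image_mset (restrict T K) (mset_set K) + replicate_mset (card (D - K)) n = m + replicate_mset c n"
        using content_restrict_split[OF fin KD, of T n] T by (simp add: tableaux_def)
      moreover have "count (image_mset (restrict T K) (mset_set K)) n = 0"
        using fin by (auto simp: count_eq_zero_iff K_def)
      moreover have "count m n = 0" using m by (auto simp: count_eq_zero_iff)
      ultimately have c: "card (D - K) = c" and "image_mset (restrict T K) (mset_set K) = m"
        by (metis add_cancel_left_left count_replicate_mset count_union, 
            metis add_cancel_left_left count_replicate_mset count_union add_right_cancel)
      moreover have "restrict T K \<in> ssyt K"
        using ssyt KD by (auto simp: ssyt_def subset_iff)
      ultimately have "restrict T K \<in> tableaux K m" by (simp add: tableaux_def)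
      then show "F T \<in> Sigma L (\<lambda>K. tableaux K m)"
        using strip c by (simp add: F_def L_def flip: K_def)
    qed
    show "G ` Sigma L (\<lambda>K. tableaux K m) \<subseteq> tableaux D (m + replicate_mset c n)"
    proof (rule image_subsetI)
      fix p assume "p \<in> Sigma L (\<lambda>K. tableaux K m)"
      then obtain K S where p: "p = (K, S)" and K: "K \<in> L" and S: "S \<in> tableaux K m" by auto
      have strip: "hstrip K D" "card (D - K) = c" using K by (auto simp: L_def)
      then have KD: "K \<subseteq> D" and yK: "young K" by (auto simp: hstrip_def)
      have less: "S b < n" if "b \<in> K" for b using tableaux_entry[OF S finK[OF K] that] m by auto
      have S': "S \<in> ssyt K" "image_mset S (mset_set K) = m" using S by (auto simp: tableaux_def)
      have GD: "G (K, S) b = (if b \<in> K then S b else n)" if "b \<in> D" for b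
        using that by (simp add: G_def)
      have "G (K, S) \<in> ssyt D"
        unfolding ssyt_def
      proof (intro CollectI conjI allI impI)
        show "G (K, S) \<in> extensional D" using KD by (auto simp: G_def extensional_def)
        fix i j assume *: "(i, j) \<in> D \<and> (i, Suc j) \<in> D"
        show "G (K, S) (i, j) \<le> G (K, S) (i, Suc j)"
        proof (cases "(i, Suc j) \<in> K")
          case True
          then have "(i, j) \<in> K" using yK by (auto intro: young_down)
          then show ?thesis using True S'(1) KD by (auto simp: G_def ssyt_def)
        next
          case False
          then show ?thesis using less[of "(i, j)"] * by (auto simp: GD)
        qed
      next
        fix i j assume *: "(i, j) \<in> D \<and> (Suc i, j) \<in> D"
        then have "(i, j) \<in> K" using strip by (simp add: hstrip_def)
        then show "G (K, S) (i, j) < G (K, S) (Suc i, j)"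
          using less * S'(1) by (auto simp: GD ssyt_def)
      qed
      moreover have "restrict (G (K, S)) K = S"
        using S'(1) by (auto simp: G_def ssyt_def fun_eq_iff extensional_def)
      then have "image_mset (G (K, S)) (mset_set D) = m + replicate_mset c n"
        using content_restrict_split[OF fin KD, of "G (K, S)" n] S'(2) strip(2) by (simp add: GD)
      ultimately show "G p \<in> tableaux D (m + replicate_mset c n)" by (simp add: tableaux_def p)
    qed
  qed
  then have "card (tableaux D (m + replicate_mset c n)) = card (Sigma L (\<lambda>K. tableaux K m))"
    by (rule bij_betw_same_card)
  also have "\<dots> = (\<Sum>K\<in>L. card (tableaux K m))"
    using finL finite_tableaux finK by (intro card_SigmaI) auto
  finally show ?thesis by (simp add: L_def)
qed

text \<open>The number of entries n in a tableau is the size of the strip they occupy, and it is the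
  exponent of the last variable.\<close>

lemma tr_schur_branching:
  assumes D: "young D"
  shows "tr {..<Suc n} (schur D) = (\<Sum>K | hstrip K D. var n ^ card (D - K) * tr {..<n} (schur K))"
proof (rule pseries_eqI)
  fix m
  define c where "c = count m n"
  define m' where "m' = m - replicate_mset c n"
  have m: "m = m' + replicate_mset c n"
    by (rule multiset_eqI) (simp add: m'_def c_def)
  have nm': "n \<notin># m'" by (simp add: m'_def c_def not_in_iff)
  \<comment> \<open>\<open>tr\<close> removes the variable n from the second factor, so only strips
    with exactly \<open>c\<close> boxes reach \<open>m\<close>.\<close>
  have summand: "mcoeff (var n ^ k * tr {..<n} (schur K)) m =
      (if k = c \<and> set_mset m' \<subseteq> {..<n} then mcoeff (schur K) m' else 0)" for k K
  proof (cases "k \<le> c")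
    case True
    then have "m - replicate_mset k n = m' + replicate_mset (c - k) n"
      by (intro multiset_eqI) (auto simp: m)
    moreover have "replicate_mset k n \<subseteq># m"
      using True by (simp add: c_def count_le_replicate_mset_subset_eq[symmetric])
    ultimately show ?thesis using True
      by (cases "k = c") (auto simp: var_power mcoeff_mon_times mcoeff_tr)
  next
    case False
    then show ?thesis
      by (simp add: c_def var_power mcoeff_mon_times count_le_replicate_mset_subset_eq[symmetric])
  qed
  have "mcoeff (\<Sum>K | hstrip K D. var n ^ card (D - K) * tr {..<n} (schur K)) m =
      (\<Sum>K | hstrip K D. if card (D - K) = c \<and> set_mset m' \<subseteq> {..<n} then mcoeff (schur K) m' else 0)"
    by (simp add: mcoeff_sum summand)
  also have "\<dots> = (if set_mset m' \<subseteq> {..<n} then \<Sum>K | hstrip K D \<and> card (D - K) = c. mcoeff (schur K) m' else 0)"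
    using finite_hstrip[OF D] by (simp add: sum.inter_filter[symmetric] Collect_conj_eq[symmetric])
  also have "\<dots> = (if set_mset m' \<subseteq> {..<n} then mcoeff (schur D) m else 0)"
    using card_tableaux_branching[OF D, of m' n c] by (simp add: mcoeff_schur m)
  also have "set_mset m' \<subseteq> {..<n} \<longleftrightarrow> set_mset m \<subseteq> {..<Suc n}"
    using nm' by (auto simp: m less_Suc_eq split: if_splits)
  finally show "mcoeff (tr {..<Suc n} (schur D)) m =
      mcoeff (\<Sum>K | hstrip K D. var n ^ card (D - K) * tr {..<n} (schur K)) m"
    by (simp add: mcoeff_tr)
qed

text \<open>Induction on the number of variables. Passing to beta numbers is a bijection from the
  \<open>K\<close> left by horizontal strips, with at most n rows, to the sequences interlacing with
  the beta numbers of \<open>D\<close>, so \<open>tr_schur_branching\<close> and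
  \<open>gdet_branching\<close> match term by term.\<close>

theorem bialternant:
  assumes "young D"
  shows "tr {..<n} (schur D) * gdet {..<n} var id = (if rows_le D n then gdet {..<n} var (beta n D) else 0)"
  using assms
proof (induction n arbitrary: D)
  case 0
  have "tr {} (schur D) = (if D = {} then 1 else 0)"
  proof (rule pseries_eqI)
    fix m
    have "finite D" using 0 by (rule young_finite)
    have "mcoeff (schur D) {#} = 0" if "D \<noteq> {}"
      using that \<open>finite D\<close> by (intro mcoeff_schur_size) auto
    moreover have "tableaux {} {#} = {\<lambda>_. undefined}" by (auto simp: tableaux_def ssyt_def extensional_def)
    ultimately show "mcoeff (tr {} (schur D)) m = mcoeff (if D = {} then 1 else 0) m"
      by (auto simp: mcoeff_tr mcoeff_basic mcoeff_schur)
  qed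
  moreover have "rows_le D 0 \<longleftrightarrow> D = {}" by (auto simp: rows_le_def)
  ultimately show ?case by (simp add: gdet_def)
next
  case (Suc n)
  note D = \<open>young D\<close>
  define V where "V = (\<Prod>i<n. var n - var i :: nat pseries)"
  have "tr {..<Suc n} (schur D) * gdet {..<Suc n} var id =
      V * (\<Sum>K | hstrip K D. var n ^ card (D - K) * (tr {..<n} (schur K) * gdet {..<n} var id))"
    by (simp add: tr_schur_branching[OF D] gdet_Vandermonde_Suc V_def sum_distrib_left sum_distrib_right mult_ac)
  also have "\<dots> = V * (\<Sum>K | hstrip K D. if rows_le K n then var n ^ card (D - K) * gdet {..<n} var (beta n K) else 0)"
    by (intro arg_cong[where f = "(*) V"] sum.cong) (auto simp: hstrip_def Suc.IH)
  also have "\<dots> = V * (\<Sum>K | hstrip K D \<and> rows_le K n. var n ^ card (D - K) * gdet {..<n} var (beta n K))"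
    using finite_hstrip[OF D] by (simp add: sum.inter_filter[symmetric] Collect_conj_eq[symmetric])
  finally have 1: "tr {..<Suc n} (schur D) * gdet {..<Suc n} var id =
    V * (\<Sum>K | hstrip K D \<and> rows_le K n. var n ^ card (D - K) * gdet {..<n} var (beta n K))" .
  show ?case
  proof (cases "rows_le D (Suc n)")
    case False
    \<comment> \<open>A horizontal strip contains no two boxes of one column, so too many rows in
      \<open>D\<close> leave too many rows in \<open>K\<close>.\<close>
    have "\<not> rows_le K n" if "hstrip K D" for K
    proof -
      obtain i j where ij: "(i, j) \<in> D" "\<not> i < Suc n" using False by (auto simp: rows_le_def)
      then obtain i' where "i = Suc i'" by (cases i) auto
      then have "(i', j) \<in> K" "\<not> i' < n" using ij that by (auto simp: hstrip_def)
      then show ?thesis by (auto simp: rows_le_def)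
    qed
    then have empty: "{K. hstrip K D \<and> rows_le K n} = {}" by auto
    show ?thesis unfolding 1 empty using False by simp
  next
    case True
    define l where "l = beta (Suc n) D"
    have l: "l r < l (Suc r)" for r unfolding l_def using D by (rule beta_less) simp
    have l_Suc: "l (Suc r) = rowlen D (n - Suc r) + Suc r" and l_r: "l r = rowlen D (n - r) + r" for r
      by (simp_all add: l_def beta_def)
    define B where "B K = restrict (beta n K) {..<n}" for K
    have bij: "bij_betw B {K. hstrip K D \<and> rows_le K n} (PiE {..<n} (\<lambda>r. {l r..<l (Suc r)}))"
      unfolding bij_betw_def
    proof
      show "inj_on B {K. hstrip K D \<and> rows_le K n}"
      proof (rule inj_onI)
        fix K K' assume *: "K \<in> {K. hstrip K D \<and> rows_le K n}" "K' \<in> {K. hstrip K D \<and> rows_le K n}" "B K = B K'"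
        show "K = K'"
        proof (rule beta_inj)
          fix r assume "r < n"
          then show "beta n K r = beta n K' r" using fun_cong[OF *(3), of r] by (simp add: B_def)
        qed (use * in \<open>auto simp: hstrip_def\<close>)
      qed
      show "B ` {K. hstrip K D \<and> rows_le K n} = PiE {..<n} (\<lambda>r. {l r..<l (Suc r)})"
      proof (intro subset_antisym image_subsetI subsetI)
        fix K assume "K \<in> {K. hstrip K D \<and> rows_le K n}"
        then have K: "hstrip K D" "rows_le K n" by auto
        have yK: "young K" using K by (simp add: hstrip_def)
        show "B K \<in> PiE {..<n} (\<lambda>r. {l r..<l (Suc r)})"
        proof (rule PiE_I)
          fix r assume r: "r \<in> {..<n}"
          then have "Suc (n - Suc r) = n - r" by auto
          moreover have "rowlen K (n - Suc r) \<le> rowlen D (n - Suc r)"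
              "rowlen D (Suc (n - Suc r)) \<le> rowlen K (n - Suc r)"
            using K(1) hstrip_rowlen[OF D yK] by blast+
          ultimately show "B K r \<in> {l r..<l (Suc r)}"
            using r by (simp add: B_def beta_def l_Suc l_r)
        qed (simp add: B_def)
      next
        fix k assume k: "k \<in> PiE {..<n} (\<lambda>r. {l r..<l (Suc r)})"
        have kr: "l r \<le> k r" "k r < l (Suc r)" if "r < n" for r using PiE_mem[OF k, of r] that by auto
        have "k r < k s" if "r < s" "s < n" for r s
        proof -
          have "l (Suc r) \<le> l s" 
            unfolding l_def using beta_less[OF D] that by (cases "Suc r = s") (auto intro!: less_imp_le)
          then show ?thesis using kr[of r] kr[of s] that by linarith
        qed
        from ex_beta[of n k, OF this] obtain K where K: "young K" "rows_le K n" "\<And>r. r < n \<Longrightarrow> beta n K r = k r" by auto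
        have "rowlen K i \<le> rowlen D i \<and> rowlen D (Suc i) \<le> rowlen K i" for i
        proof (cases "i < n")
          case i: True
          then have "Suc (n - Suc i) = n - i" "n - Suc (n - Suc i) = i" "n - (n - Suc i) = Suc i" by auto
          then show ?thesis
            using kr[of "n - Suc i"] K(3)[of "n - Suc i"] i by (simp add: beta_def l_Suc l_r) linarith
        next
          case False
          then show ?thesis
            using rows_le_rowlen[OF K(1,2), of i] rows_le_rowlen[OF D True, of "Suc i"] by simp
        qed
        then have "hstrip K D" using hstrip_rowlen[OF D K(1)] by simp
        moreover have "B K = k" using k K(3) by (auto simp: B_def fun_eq_iff PiE_def extensional_def)
        ultimately show "k \<in> B ` {K. hstrip K D \<and> rows_le K n}" using K(2) by auto
      qed
    qed
    \<comment> \<open>Both sides count the removed boxes: beta numbers add up to the weight plus a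
      triangular number, and the extra n for the additional row of \<open>D\<close> cancels against
      the successors.\<close>
    have exponent: "l 0 + (\<Sum>r<n. l (Suc r) - Suc (B K r)) = card (D - K)"
      if K: "K \<in> {K. hstrip K D \<and> rows_le K n}" for K
    proof -
      have yK: "young K" "K \<subseteq> D" "rows_le K n" using K by (auto simp: hstrip_def)
      have BK: "B K \<in> PiE {..<n} (\<lambda>r. {l r..<l (Suc r)})" using bij_betwE[OF bij] K by blast
      have le: "Suc (B K r) \<le> l (Suc r)" if "r < n" for r using PiE_mem[OF BK, of r] that by auto
      have "(\<Sum>r<n. l (Suc r) - Suc (B K r)) + (\<Sum>r<n. Suc (B K r)) = (\<Sum>r<n. l (Suc r))"
        unfolding sum.distrib[symmetric]
      proof (rule sum.cong[OF refl])
        fix r assume "r \<in> {..<n}"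
        then have "Suc (B K r) \<le> l (Suc r)" by (simp add: le)
        then show "l (Suc r) - Suc (B K r) + Suc (B K r) = l (Suc r)" by linarith
      qed
      moreover have "(\<Sum>r<n. Suc (B K r)) = n + (card K + (\<Sum>r<n. r))"
        using sum_beta[OF yK(1,3)] by (simp add: B_def sum_Suc)
      moreover have "l 0 + (\<Sum>r<n. l (Suc r)) = card D + (\<Sum>r<n. r) + n"
        using sum_beta[OF D True] by (simp add: l_def sum.lessThan_Suc_shift[of "beta _ _"] del: sum.lessThan_Suc) simp
      ultimately have "l 0 + (\<Sum>r<n. l (Suc r) - Suc (B K r)) + card K = card D" by linarith
      moreover have "card (D - K) = card D - card K"
        using yK young_finite by (intro card_Diff_subset) auto
      ultimately show ?thesis by simp
    qed
    have "gdet {..<Suc n} var l = V * (\<Sum>k\<in>PiE {..<n} (\<lambda>r. {l r..<l (Suc r)}).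
        var n ^ (l 0 + (\<Sum>r<n. l (Suc r) - Suc (k r))) * gdet {..<n} var k)"
      unfolding V_def by (rule gdet_branching) (use l less_imp_le in blast)
    also have "\<dots> = V * (\<Sum>K | hstrip K D \<and> rows_le K n.
        var n ^ (l 0 + (\<Sum>r<n. l (Suc r) - Suc (B K r))) * gdet {..<n} var (B K))"
      by (subst sum.reindex_bij_betw[OF bij, symmetric]) simp
    also have "\<dots> = V * (\<Sum>K | hstrip K D \<and> rows_le K n. var n ^ card (D - K) * gdet {..<n} var (beta n K))"
    proof (intro arg_cong[where f = "(*) V"] sum.cong refl arg_cong2[where f = "(*)"])
      fix K assume "K \<in> {K. hstrip K D \<and> rows_le K n}"
      then show "var n ^ (l 0 + (\<Sum>r<n. l (Suc r) - Suc (B K r))) = var n ^ card (D - K)"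
        by (simp only: exponent)
      show "gdet {..<n} var (B K) = gdet {..<n} var (beta n K)"
        by (rule gdet_cong) (auto simp: B_def)
    qed
    finally show ?thesis unfolding 1 l_def using True by simp
  qed
qed

section \<open>Symmetric functions and Schur coefficients\<close>

definition deg_le :: "nat \<Rightarrow> 'v pseries \<Rightarrow> bool" where
  "deg_le d f \<longleftrightarrow> (\<forall>m. d < size m \<longrightarrow> mcoeff f m = 0)"

lemma Sym_iff: "f \<in> Sym \<longleftrightarrow> (\<exists>d. deg_le d f) \<and> (\<forall>\<sigma>. bij \<sigma> \<longrightarrow> pm \<sigma> f = f)"
proof -
  have "pm \<sigma> f = f \<longleftrightarrow> (\<forall>m. mcoeff f (image_mset \<sigma> m) = mcoeff f m)" for \<sigma>
    by (metis mcoeff_pm pseries_eqI)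
  then show ?thesis by (simp add: Sym_def deg_le_def)
qed

lemma Sym_pm: "f \<in> Sym \<Longrightarrow> bij \<sigma> \<Longrightarrow> pm \<sigma> f = f"
  by (simp add: Sym_iff)

lemma Sym_deg: "f \<in> Sym \<Longrightarrow> \<exists>d. deg_le d f"
  by (simp add: Sym_iff)

lemma deg_le_mono: "deg_le d f \<Longrightarrow> d \<le> d' \<Longrightarrow> deg_le d' f"
  by (simp add: deg_le_def)

lemma deg_le_add: "deg_le d f \<Longrightarrow> deg_le d g \<Longrightarrow> deg_le d (f + g)"
  and deg_le_diff: "deg_le d f \<Longrightarrow> deg_le d g \<Longrightarrow> deg_le d (f - g)"
  and deg_le_cst: "deg_le d f \<Longrightarrow> deg_le d (cst q * f)"
  and deg_le_pm: "deg_le d f \<Longrightarrow> deg_le d (pm \<sigma> f)"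
  by (simp_all add: deg_le_def mcoeff_basic mcoeff_cst_times mcoeff_pm)

lemma deg_le_sum: "(\<And>x. x \<in> A \<Longrightarrow> deg_le d (f x)) \<Longrightarrow> deg_le d (sum f A)"
  by (simp add: deg_le_def mcoeff_sum)

lemma deg_le_tr: "deg_le d f \<Longrightarrow> deg_le d (tr I f)"
  by (simp add: deg_le_def mcoeff_tr)

lemma deg_le_mult:
  fixes f :: "'v pseries"
  assumes "deg_le c f" "deg_le d g"
  shows "deg_le (c + d) (f * g)"
  unfolding deg_le_def
proof (intro allI impI)
  fix m :: "'v multiset" assume m: "c + d < size m"
  have "mcoeff f a * mcoeff g b = 0" if "(a, b) \<in> splits m" for a b
  proof -
    have "size a + size b = size m" using that by (auto simp: splits_def)
    then have "c < size a \<or> d < size b" using m by linarith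
    then show ?thesis using assms by (auto simp: deg_le_def)
  qed
  then show "mcoeff (f * g) m = 0" by (auto simp: mcoeff_times intro!: sum.neutral)
qed

lemma Sym_cst_times: "f \<in> Sym \<Longrightarrow> cst q * f \<in> Sym"
  unfolding Sym_def by (auto simp: mcoeff_cst_times)

lemma Sym_1: "1 \<in> Sym"
  unfolding Sym_iff deg_le_def
  by (auto simp: mcoeff_basic mcoeff_pm intro!: exI[of _ 0] pseries_eqI)

lemma Sym_add: "f \<in> Sym \<Longrightarrow> g \<in> Sym \<Longrightarrow> f + g \<in> Sym"
  and Sym_diff: "f \<in> Sym \<Longrightarrow> g \<in> Sym \<Longrightarrow> f - g \<in> Sym"
  and Sym_mult: "f \<in> Sym \<Longrightarrow> g \<in> Sym \<Longrightarrow> f * g \<in> Sym"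
proof -
  assume fg: "f \<in> Sym" "g \<in> Sym"
  then obtain c d where cd: "deg_le c f" "deg_le d g" using Sym_deg by blast
  have d: "deg_le (max c d) (f + g)" "deg_le (max c d) (f - g)" "deg_le (c + d) (f * g)"
    using cd deg_le_mono[OF cd(1), of "max c d"] deg_le_mono[OF cd(2), of "max c d"]
    by (auto intro: deg_le_add deg_le_diff deg_le_mult)
  have "pm \<sigma> (f + g) = f + g \<and> pm \<sigma> (f - g) = f - g \<and> pm \<sigma> (f * g) = f * g" if "bij \<sigma>" for \<sigma>
  proof -
    interpret comm_ring_hom "pm \<sigma> :: nat pseries \<Rightarrow> _" using that by (rule pm_hom)
    show ?thesis using fg that by (simp add: hom_distribs Sym_pm)
  qed
  with d show "f + g \<in> Sym" "f - g \<in> Sym" "f * g \<in> Sym" unfolding Sym_iff by blast+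
qed

lemma Sym_0: "0 \<in> Sym"
  using Sym_diff[OF Sym_1 Sym_1] by simp

lemma Sym_sum: "(\<And>x. x \<in> A \<Longrightarrow> f x \<in> Sym) \<Longrightarrow> sum f A \<in> Sym"
  by (induction A rule: infinite_finite_induct) (auto intro: Sym_0 Sym_add)

lemma Sym_power: "f \<in> Sym \<Longrightarrow> f ^ k \<in> Sym"
  by (induction k) (auto intro: Sym_1 Sym_mult)

text \<open>\<open>Sym\<close> refers to all bijections of the indices, while determinants transform
  under permutations of an initial segment. On the finitely many variables of one monomial this
  lemma passes between the two.\<close>

lemma extend_to_permutes:
  fixes h :: "nat \<Rightarrow> nat"
  assumes "inj_on h A" "A \<subseteq> {..<n}" "h ` A \<subseteq> {..<n}"
  shows "\<exists>\<tau>. \<tau> permutes {..<n} \<and> (\<forall>x\<in>A. \<tau> x = h x)"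
proof -
  have "card ({..<n} - A) = card ({..<n} - h ` A)"
    using assms by (simp add: card_Diff_subset finite_subset card_image)
  then obtain g where g: "bij_betw g ({..<n} - A) ({..<n} - h ` A)"
    using finite_same_card_bij by blast
  define \<tau> where "\<tau> x = (if x \<in> A then h x else if x < n then g x else x)" for x
  have "bij_betw \<tau> (A \<union> ({..<n} - A)) (h ` A \<union> ({..<n} - h ` A))"
  proof (rule bij_betw_combine)
    show "bij_betw \<tau> A (h ` A)"
      using assms(1) by (auto simp: bij_betw_def \<tau>_def inj_on_def)
    show "bij_betw \<tau> ({..<n} - A) ({..<n} - h ` A)"
      using g by (rule bij_betw_cong[THEN iffD1, rotated]) (auto simp: \<tau>_def)
  qed auto
  moreover have "A \<union> ({..<n} - A) = {..<n}" "h ` A \<union> ({..<n} - h ` A) = {..<n}" using assms by auto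
  ultimately have "\<tau> permutes {..<n}"
    using assms(2) by (intro bij_imp_permutes) (auto simp: \<tau>_def)
  then show ?thesis by (auto simp: \<tau>_def)
qed

section \<open>Coefficients of a product with the Vandermonde determinant\<close>

definition alt :: "nat \<Rightarrow> nat pseries" where
  "alt n = gdet {..<n} var id"

text \<open>At the beta numbers of \<open>D\<close> this is the coefficient of s_D in
  \<open>f\<close> (\<open>schur_coeff_altc\<close>). It is linear in \<open>f\<close> and, for
  symmetric \<open>f\<close>, alternating in \<open>e\<close>, so Schur coefficients can be computed
  without knowing the expansion.\<close>

definition altc :: "nat \<Rightarrow> nat pseries \<Rightarrow> (nat \<Rightarrow> nat) \<Rightarrow> rat" where
  "altc n f e = mcoeff (f * alt n) (expo {..<n} e)"

lemma gdet_var: "finite I \<Longrightarrow> gdet I var e = (\<Sum>w | w permutes I. of_int (sign w) * mon (expo I (e \<circ> w)))"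
  by (simp add: gdet_def mon_expo)

lemma mcoeff_gdet_times:
  assumes "finite I"
  shows "mcoeff (f * gdet I var e) m = (\<Sum>w | w permutes I. of_int (sign w) *
    (if expo I (e \<circ> w) \<subseteq># m then mcoeff f (m - expo I (e \<circ> w)) else 0))"
proof -
  have "f * gdet I var e = (\<Sum>w | w permutes I. of_int (sign w) * (mon (expo I (e \<circ> w)) * f))"
    by (simp add: gdet_var[OF assms] sum_distrib_left mult_ac)
  then show ?thesis by (simp add: mcoeff_sum mcoeff_of_int_times mcoeff_mon_times)
qed

lemma size_expo_permute: "w permutes {..<n :: nat} \<Longrightarrow> size (expo {..<n} (e \<circ> w)) = (\<Sum>j<n. e j)"
  using sum.permute[of w "{..<n}" e] by (simp add: size_expo)

lemma tr_gdet: "tr {..<n} (gdet {..<n} var e) = gdet {..<n} var e"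
  by (simp add: gdet_hom[OF tr.comm_ring_hom_axioms]) (rule gdet_cong, auto simp: tr_var)

lemma pm_gdet:
  assumes "\<sigma> permutes {..<n}"
  shows "pm \<sigma> (gdet {..<n} var e) = of_int (sign \<sigma>) * gdet {..<n} var e"
proof -
  have bij: "bij \<sigma>" using assms by (rule permutes_bij)
  have "(\<lambda>i. pm \<sigma> (var i)) = var \<circ> inv_into UNIV \<sigma>"
    by (simp add: var_def pm_mon[OF bij] fun_eq_iff)
  moreover have "sign (inv_into UNIV \<sigma>) = sign \<sigma>"
    using assms permutation_permutes by (intro sign_inverse) blast
  ultimately show ?thesis
    using gdet_permute_vars[OF _ permutes_inv[OF assms], of var e] by (simp add: gdet_hom[OF pm_hom[OF bij]])
qed

text \<open>Rearrangement inequality, from the positive sum of the squares of j - w j.\<close>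

lemma sum_mult_permutes_less:
  fixes w :: "nat \<Rightarrow> nat"
  assumes w: "w permutes {..<n}" "w \<noteq> id"
  shows "(\<Sum>j<n. j * w j) < (\<Sum>j<n. j * j)"
proof -
  obtain i where i: "w i \<noteq> i" using w by (auto simp: fun_eq_iff)
  then have "i < n" using w by (auto simp: permutes_def)
  have "0 < (\<Sum>j<n. (int j - int (w j))\<^sup>2)"
    using i \<open>i < n\<close> by (intro sum_pos2[of _ i]) auto
  also have "\<dots> = (\<Sum>j<n. int j * int j) + (\<Sum>j<n. int (w j) * int (w j)) - 2 * (\<Sum>j<n. int j * int (w j))"
    by (simp add: power2_eq_square algebra_simps sum.distrib sum_subtractf sum_distrib_left)
  also have "(\<Sum>j<n. int (w j) * int (w j)) = (\<Sum>j<n. int j * int j)"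
    using sum.permute[OF w(1), of "\<lambda>j. int j * int j"] by (simp add: o_def)
  finally have "(\<Sum>j<n. int j * int (w j)) < (\<Sum>j<n. int j * int j)" by simp
  then show ?thesis by (simp flip: of_nat_mult of_nat_sum)
qed

text \<open>
  Give the variable \<open>j\<close> the weight \<open>j\<close>. The diagonal monomial of \<^term>\<open>alt n\<close> is the only one of largest
  weight, so a monomial of largest weight of \<open>g\<close> survives in the product.
\<close>
lemma alt_cancel:
  assumes g: "tr {..<n} g = g" "deg_le d g" and zero: "g * alt n = 0"
  shows "g = 0"
proof (rule ccontr)
  assume "g \<noteq> 0"
  define W where "W m = (\<Sum>j<n. j * count m j)" for m :: "nat multiset"
  obtain m1 where m1: "mcoeff g m1 \<noteq> 0" using \<open>g \<noteq> 0\<close> by (metis mcoeff_basic(1) pseries_eqI)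
  have "W m \<le> n * d" if "mcoeff g m \<noteq> 0" for m
  proof -
    have "set_mset m \<subseteq> {..<n}" using that g(1) by (metis mcoeff_tr)
    then have "size m = (\<Sum>j<n. count m j)" using size_expo[of "{..<n}" "count m"] expo_eqI[of "{..<n}" m] by simp
    moreover have "size m \<le> d" using that g(2) by (auto simp: deg_le_def not_le[symmetric])
    moreover have "W m \<le> (\<Sum>j<n. n * count m j)" unfolding W_def by (intro sum_mono mult_right_mono) auto
    ultimately show ?thesis by (metis mult_le_mono2 order_trans sum_distrib_left)
  qed
  then obtain m0 where m0: "mcoeff g m0 \<noteq> 0" "\<And>m. mcoeff g m \<noteq> 0 \<Longrightarrow> W m \<le> W m0"
    using ex_has_greatest_nat[of "\<lambda>m. mcoeff g m \<noteq> 0" m1 W "Suc (n * d)"] m1 by (auto simp: less_Suc_eq_le)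
  let ?m = "m0 + expo {..<n} id"
  have "mcoeff (g * alt n) ?m = (\<Sum>w | w permutes {..<n}. if w = id then mcoeff g m0 else 0)"
    unfolding alt_def mcoeff_gdet_times[OF finite_lessThan]
  proof (intro sum.cong refl)
    fix w assume "w \<in> {w. w permutes {..<n}}"
    then have w: "w permutes {..<n}" by simp
    show "of_int (sign w) * (if expo {..<n} (id \<circ> w) \<subseteq># ?m then mcoeff g (?m - expo {..<n} (id \<circ> w)) else 0) =
        (if w = id then mcoeff g m0 else 0)"
    proof (cases "w = id \<or> \<not> expo {..<n} w \<subseteq># ?m")
      case False
      let ?k = "?m - expo {..<n} w"
      have "?k + expo {..<n} w = ?m" using False by (simp add: subset_mset.diff_add)
      then have "count ?k j + w j = count m0 j + j" if "j < n" for j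
        using that by (metis count_expo count_union finite_lessThan id_apply lessThan_iff)
      then have "W ?k + (\<Sum>j<n. j * w j) = W m0 + (\<Sum>j<n. j * j)"
        unfolding W_def sum.distrib[symmetric] by (intro sum.cong) (auto simp flip: distrib_left)
      then have "W m0 < W ?k" using sum_mult_permutes_less[OF w] False by linarith
      then have "mcoeff g ?k = 0" using m0(2) not_le by blast
      then show ?thesis using False by simp
    qed auto
  qed
  also have "\<dots> = mcoeff g m0" by (simp add: permutes_id finite_permutations)
  finally show False using m0(1) zero by (simp add: mcoeff_basic)
qed

lemma tr_pm:
  assumes "\<sigma> permutes I"
  shows "tr I (pm \<sigma> f) = pm \<sigma> (tr I f)"
proof (rule pseries_eqI)
  fix m
  have "\<sigma> ` set_mset m \<subseteq> I \<longleftrightarrow> set_mset m \<subseteq> I" using permutes_in_image[OF assms] by blast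
  then show "mcoeff (tr I (pm \<sigma> f)) m = mcoeff (pm \<sigma> (tr I f)) m"
    by (simp add: mcoeff_tr mcoeff_pm)
qed

lemma deg_le_schur: "deg_le (card D) (schur D)"
  by (simp add: deg_le_def mcoeff_schur_size)

text \<open>In finitely many variables a Schur function is a quotient of alternating determinants: a
  permutation changes both by the same sign, and \<open>alt_cancel\<close> removes the
  denominator.\<close>

theorem schur_in_Sym:
  assumes D: "young D"
  shows "schur D \<in> Sym"
  unfolding Sym_iff
proof (intro conjI allI impI)
  show "\<exists>d. deg_le d (schur D)" using deg_le_schur by blast
  fix \<sigma> :: "nat \<Rightarrow> nat" assume \<sigma>: "bij \<sigma>"
  show "pm \<sigma> (schur D) = schur D"
  proof (rule pseries_eqI)
    fix m
    \<comment> \<open>Large enough for the variables of \<open>m\<close> and their images, so that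
      \<open>\<sigma>\<close> can be replaced by a permutation of the first n indices.\<close>
    define n where "n = Suc (Max (insert 0 (set_mset m \<union> \<sigma> ` set_mset m)))"
    have n: "set_mset m \<subseteq> {..<n}" "\<sigma> ` set_mset m \<subseteq> {..<n}"
      by (auto simp: n_def less_Suc_eq_le intro!: Max_ge)
    then obtain \<tau> where \<tau>: "\<tau> permutes {..<n}" "\<And>x. x \<in># m \<Longrightarrow> \<tau> x = \<sigma> x"
      using extend_to_permutes[of \<sigma> "set_mset m" n] \<sigma> by (meson bij_is_inj inj_on_subset subset_UNIV)
    have bij: "bij \<tau>" using \<tau>(1) by (rule permutes_bij)
    define t where "t = tr {..<n} (schur D)"
    have "pm \<tau> (t * alt n) = of_int (sign \<tau>) * (t * alt n)"
    proof (cases "rows_le D n")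
      case True
      then show ?thesis unfolding t_def alt_def bialternant[OF D] by (simp add: pm_gdet[OF \<tau>(1)])
    next
      case False
      then show ?thesis unfolding t_def alt_def bialternant[OF D]
        by (auto intro!: pseries_eqI simp: mcoeff_pm mcoeff_basic)
    qed
    then have eq: "of_int (sign \<tau>) * (pm \<tau> t * alt n) = of_int (sign \<tau>) * (t * alt n)"
      by (simp add: pm_mult[OF bij] alt_def pm_gdet[OF \<tau>(1)] mult_ac)
    have "of_int (sign \<tau>) * (of_int (sign \<tau>) * x) = x" for x :: "nat pseries"
      by (metis mult.assoc mult_1 of_int_1 of_int_mult sign_idempotent)
    then have "pm \<tau> t * alt n = t * alt n" by (metis eq)
    then have "(pm \<tau> t - t) * alt n = 0" by (simp add: algebra_simps)
    moreover have "tr {..<n} (pm \<tau> t - t) = pm \<tau> t - t"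
      by (simp add: tr.hom_minus tr_pm[OF \<tau>(1)] t_def tr_tr)
    moreover have "deg_le (card D) (pm \<tau> t - t)"
      unfolding t_def by (intro deg_le_diff deg_le_pm deg_le_tr deg_le_schur)
    ultimately have "pm \<tau> t = t" using alt_cancel by fastforce
    then have "mcoeff t (image_mset \<tau> m) = mcoeff t m" by (metis mcoeff_pm)
    moreover have "image_mset \<tau> m = image_mset \<sigma> m" using \<tau>(2) by (rule image_mset_cong)
    ultimately have "mcoeff t (image_mset \<sigma> m) = mcoeff t m" by simp
    then show "mcoeff (pm \<sigma> (schur D)) m = mcoeff (schur D) m"
      using n by (simp add: t_def mcoeff_tr mcoeff_pm)
  qed
qed

lemma altc_linear:
  "altc n (f + g) e = altc n f e + altc n g e"
  "altc n (f - g) e = altc n f e - altc n g e"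
  "altc n (cst q * f) e = q * altc n f e"
  "altc n (sum h A) e = (\<Sum>x\<in>A. altc n (h x) e)"
  by (simp_all add: altc_def distrib_right left_diff_distrib mult.assoc sum_distrib_right
      mcoeff_basic mcoeff_cst_times mcoeff_sum)

lemma altc_cong: "(\<And>r. r < n \<Longrightarrow> e r = e' r) \<Longrightarrow> altc n f e = altc n f e'"
  unfolding altc_def by (metis expo_cong lessThan_iff)

lemma altc_tr: "altc n (tr {..<n} f) e = altc n f e"
  unfolding altc_def by (rule eqb_D[OF eqb_mult[OF eqb_tr eqb_refl]]) (simp add: set_expo)

lemma altc_permute:
  assumes f: "f \<in> Sym" and \<sigma>: "\<sigma> permutes {..<n}"
  shows "altc n f (e \<circ> \<sigma>) = of_int (sign \<sigma>) * altc n f e"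
proof -
  let ?\<tau> = "inv_into UNIV \<sigma>"
  have \<tau>: "?\<tau> permutes {..<n}" using \<sigma> by (rule permutes_inv)
  have bij: "bij ?\<tau>" using \<tau> by (rule permutes_bij)
  have "image_mset ?\<tau> (expo {..<n} e) = expo {..<n} (e \<circ> \<sigma>)"
  proof (rule multiset_eqI)
    fix x
    have "?\<tau> -` {x} \<inter> set_mset (expo {..<n} e) = {\<sigma> x} \<inter> set_mset (expo {..<n} e)"
      using permutes_inverses[OF \<sigma>] by auto
    then have "count (image_mset ?\<tau> (expo {..<n} e)) x = count (expo {..<n} e) (\<sigma> x)"
      by (cases "\<sigma> x \<in># expo {..<n} e") (auto simp: count_image_mset not_in_iff)
    then show "count (image_mset ?\<tau> (expo {..<n} e)) x = count (expo {..<n} (e \<circ> \<sigma>)) x"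
      using permutes_in_image[OF \<sigma>, of x] by (simp add: count_expo)
  qed
  then have "altc n f (e \<circ> \<sigma>) = mcoeff (pm ?\<tau> (f * alt n)) (expo {..<n} e)"
    by (simp add: altc_def mcoeff_pm)
  also have "pm ?\<tau> (f * alt n) = of_int (sign ?\<tau>) * (f * alt n)"
    by (simp add: pm_mult[OF bij] Sym_pm[OF f bij] alt_def pm_gdet[OF \<tau>] mult_ac)
  also have "sign ?\<tau> = sign \<sigma>"
    using \<sigma> permutation_permutes by (intro sign_inverse) blast
  finally show ?thesis by (simp add: mcoeff_of_int_times altc_def o_def)
qed

lemma altc_repeated:
  assumes f: "f \<in> Sym" and ij: "i < n" "j < n" "i \<noteq> j" "e i = e j"
  shows "altc n f e = 0"
proof -
  have t: "transpose i j permutes {..<n}" using ij by (intro permutes_swap_id) auto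
  have "e \<circ> transpose i j = e" using ij by (auto simp: fun_eq_iff transpose_def)
  then have "altc n f e = - altc n f e"
    using altc_permute[OF f t, of e] ij by (simp add: sign_swap_id)
  then show ?thesis by simp
qed

lemma strict_mono_permutes:
  assumes w: "w permutes {..<n}" and mono: "\<And>r s. r < s \<Longrightarrow> s < n \<Longrightarrow> w r < (w s :: nat)"
  shows "w = id"
  using w
proof (rule permutes_natset_ge)
  show "\<forall>i\<in>{..<n}. i \<le> w i" using strict_ge_id[of n w, OF mono] by auto
qed

text \<open>Among the permuted sequences \<open>l \<circ> w\<close> only the one for the identity is
  increasing.\<close>

lemma mcoeff_gdet_strict:
  assumes e: "\<And>r s. r < s \<Longrightarrow> s < n \<Longrightarrow> e r < e s" and l: "\<And>r s. r < s \<Longrightarrow> s < n \<Longrightarrow> l r < l s"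
  shows "mcoeff (gdet {..<n} var l) (expo {..<n} e) = (if \<forall>r<n. e r = l r then 1 else 0)"
proof -
  have 1: "expo {..<n} e = expo {..<n} (l \<circ> w) \<longleftrightarrow> w = id \<and> (\<forall>r<n. e r = l r)" if w: "w permutes {..<n}" for w
  proof
    assume eq: "expo {..<n} e = expo {..<n} (l \<circ> w)"
    have el: "e r = l (w r)" if "r < n" for r
      using arg_cong[OF eq, of "\<lambda>m. count m r"] that by (simp add: count_expo)
    have "w r < w s" if "r < s" "s < n" for r s
    proof (rule ccontr)
      assume "\<not> w r < w s"
      then consider "w s < w r" | "w s = w r" by linarith
      then have "l (w s) \<le> l (w r)"
      proof cases
        case 1
        have "w r < n" using permutes_in_image[OF w, of r] that by auto
        then show ?thesis using l[OF 1] by simp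
      qed simp
      then show False using e[OF that] el[of r] el[of s] that by simp
    qed
    then have "w = id" by (rule strict_mono_permutes[OF w])
    then show "w = id \<and> (\<forall>r<n. e r = l r)" using el by simp
  next
    assume "w = id \<and> (\<forall>r<n. e r = l r)"
    then show "expo {..<n} e = expo {..<n} (l \<circ> w)" by (intro expo_cong) auto
  qed
  have "mcoeff (gdet {..<n} var l) (expo {..<n} e) =
      (\<Sum>w | w permutes {..<n}. of_int (sign w) * (if expo {..<n} e = expo {..<n} (l \<circ> w) then 1 else 0))"
    by (simp add: gdet_var mcoeff_sum mcoeff_of_int_times mcoeff_mon)
  also have "\<dots> = (\<Sum>w | w permutes {..<n}. if w = id then if \<forall>r<n. e r = l r then 1 else 0 else 0)"
    by (rule sum.cong) (auto simp: 1)
  also have "\<dots> = (if \<forall>r<n. e r = l r then 1 else 0)"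
    by (simp add: finite_permutations permutes_id)
  finally show ?thesis .
qed

lemma altc_schur:
  assumes "young D" "young E" "rows_le E n"
  shows "altc n (schur D) (beta n E) = (if D = E then 1 else 0)"
proof -
  have "altc n (schur D) (beta n E) = mcoeff (tr {..<n} (schur D) * alt n) (expo {..<n} (beta n E))"
    unfolding altc_tr[symmetric, of n "schur D"] by (simp add: altc_def)
  also have "\<dots> = (if rows_le D n \<and> (\<forall>r<n. beta n E r = beta n D r) then 1 else 0)"
    unfolding alt_def bialternant[OF assms(1)]
    using beta_less[OF assms(1)] beta_less[OF assms(2)] by (simp add: mcoeff_gdet_strict mcoeff_basic)
  also have "\<dots> = (if D = E then 1 else 0)"
    using beta_inj[of E D n] assms by auto
  finally show ?thesis .
qed

lemma ex_sorting:
  fixes e :: "nat \<Rightarrow> nat"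
  assumes inj: "inj_on e {..<n}"
  shows "\<exists>\<sigma>. \<sigma> permutes {..<n} \<and> (\<forall>r s. r < s \<longrightarrow> s < n \<longrightarrow> e (\<sigma> r) < e (\<sigma> s))"
proof -
  define L where "L = sorted_list_of_set (e ` {..<n})"
  have L: "length L = n" "set L = e ` {..<n}" "sorted_wrt (<) L"
    using inj by (auto simp: L_def card_image)
  define h where "h r = inv_into {..<n} e (L ! r)" for r
  have h: "h r < n" "e (h r) = L ! r" if "r < n" for r
  proof -
    have "L ! r \<in> e ` {..<n}" using that L(1,2) nth_mem by blast
    then show "h r < n" "e (h r) = L ! r"
      using inv_into_into[of "L ! r" e "{..<n}"] f_inv_into_f[of "L ! r" e "{..<n}"] by (auto simp: h_def)
  qed
  have less: "e (h r) < e (h s)" if "r < s" "s < n" for r s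
    using that L h sorted_wrt_nth_less[of "(<)" L r s] by simp
  have "inj_on h {..<n}"
    by (rule linorder_inj_onI) (use less in \<open>fastforce+\<close>)
  then obtain \<sigma> where "\<sigma> permutes {..<n}" "\<forall>x\<in>{..<n}. \<sigma> x = h x"
    using extend_to_permutes[of h "{..<n}" n] h by auto
  then show ?thesis using less by (intro exI[of _ \<sigma>]) auto
qed

text \<open>Alternation reduces every exponent sequence to a sorted one, that is, to beta numbers,
  so \<open>f\<close> vanishes in the first n variables. A monomial of degree at most n has at most
  n variables and can be moved there by symmetry.\<close>

lemma Sym_eq_0I:
  assumes f: "f \<in> Sym" "deg_le n f"
    and zero: "\<And>D. young D \<Longrightarrow> rows_le D n \<Longrightarrow> altc n f (beta n D) = 0"
  shows "f = 0"
proof -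
  define g where "g = tr {..<n} f"
  have z: "altc n f e = 0" for e
  proof (cases "inj_on e {..<n}")
    case True
    from ex_sorting[OF this] obtain \<sigma> where \<sigma>: "\<sigma> permutes {..<n}"
      "\<And>r s. r < s \<Longrightarrow> s < n \<Longrightarrow> (e \<circ> \<sigma>) r < (e \<circ> \<sigma>) s" by auto
    from ex_beta[of n "e \<circ> \<sigma>", OF \<sigma>(2)] obtain D where D: "young D" "rows_le D n"
      "\<And>r. r < n \<Longrightarrow> beta n D r = (e \<circ> \<sigma>) r" by auto
    have "altc n f (e \<circ> \<sigma>) = 0" using zero[OF D(1,2)] altc_cong[of n _ "e \<circ> \<sigma>" f, OF D(3)] by simp
    then show ?thesis using altc_permute[OF f(1) \<sigma>(1), of e] by simp
  next
    case False
    then show ?thesis using altc_repeated[OF f(1)] by (force simp: inj_on_def)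
  qed
  have "g * alt n = 0"
  proof (rule pseries_eqI)
    fix m
    have trga: "tr {..<n} (g * alt n) = g * alt n"
      by (simp add: tr.hom_mult g_def tr_tr alt_def tr_gdet)
    show "mcoeff (g * alt n) m = mcoeff 0 m"
    proof (cases "set_mset m \<subseteq> {..<n}")
      case True
      then have "mcoeff (g * alt n) m = altc n g (count m)" by (simp add: altc_def expo_eqI)
      then show ?thesis using z by (simp add: g_def altc_tr mcoeff_basic)
    next
      case False
      then show ?thesis using trga by (metis mcoeff_basic(1) mcoeff_tr)
    qed
  qed
  then have g0: "g = 0"
    using alt_cancel[of n g n] f(2) by (simp add: g_def tr_tr deg_le_tr)
  show ?thesis
  proof (rule pseries_eqI)
    fix m
    show "mcoeff f m = mcoeff 0 m"
    proof (cases "size m \<le> n")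
      case True
      obtain h where h: "bij_betw h (set_mset m) {0..<card (set_mset m)}"
        using ex_bij_betw_finite_nat by blast
      have "card (set_mset m) \<le> size m"
        unfolding size_multiset_overloaded_eq using sum_mono[of "set_mset m" "\<lambda>_. 1" "count m"]
        by (simp add: Suc_le_eq)
      then have hn: "h ` set_mset m \<subseteq> {..<n}" using h True by (auto simp: bij_betw_def)
      define k where "k = Suc (Max (insert n (set_mset m)))"
      have "n \<le> k" "set_mset m \<subseteq> {..<k}" by (auto simp: k_def less_Suc_eq_le intro: le_SucI)
      then obtain \<tau> where \<tau>: "\<tau> permutes {..<k}" "\<And>x. x \<in># m \<Longrightarrow> \<tau> x = h x"
        using extend_to_permutes[of h "set_mset m" k] h hn
        by (metis bij_betw_def lessThan_subset_iff order_trans)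
      have "mcoeff f m = mcoeff f (image_mset \<tau> m)"
        using Sym_pm[OF f(1) permutes_bij[OF \<tau>(1)]] by (metis mcoeff_pm)
      also have "\<dots> = mcoeff g (image_mset \<tau> m)"
        using \<tau>(2) hn by (auto simp: g_def mcoeff_tr)
      finally show ?thesis by (simp add: g0 mcoeff_basic)
    qed (use f(2) in \<open>simp add: deg_le_def mcoeff_basic\<close>)
  qed
qed

lemma altc_eq_sum: "altc n f e = (\<Sum>w | w permutes {..<n}. of_int (sign w) *
    (if expo {..<n} w \<subseteq># expo {..<n} e then mcoeff f (expo {..<n} e - expo {..<n} w) else 0))"
  unfolding altc_def alt_def mcoeff_gdet_times[OF finite_lessThan] id_comp ..

text \<open>The Vandermonde determinant is homogeneous, and the sum of the beta numbers of
  \<open>D\<close> exceeds its degree by exactly the weight of \<open>D\<close>.\<close>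

lemma altc_beta_cong:
  assumes "young D" "rows_le D n" "\<And>m. size m = card D \<Longrightarrow> mcoeff f m = mcoeff g m"
  shows "altc n f (beta n D) = altc n g (beta n D)"
  unfolding altc_eq_sum
proof (intro sum.cong refl arg_cong2[where f = "(*)"] if_cong)
  fix w assume "w \<in> {w. w permutes {..<n}}" and sub: "expo {..<n} w \<subseteq># expo {..<n} (beta n D)"
  then have "size (expo {..<n} w) = (\<Sum>j<n. j)" using size_expo_permute[of w n id] by simp
  then have "size (expo {..<n} (beta n D) - expo {..<n} w) = card D"
    using sum_beta[OF assms(1,2)] sub by (simp add: size_Diff_submset size_expo)
  then show "mcoeff f (expo {..<n} (beta n D) - expo {..<n} w) = mcoeff g (expo {..<n} (beta n D) - expo {..<n} w)"
    by (rule assms(3))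
qed

lemma sum_kronecker:
  fixes c :: "'a \<Rightarrow> rat"
  assumes "finite A"
  shows "(\<Sum>D\<in>A. c D * (if D = E then 1 else 0)) = (if E \<in> A then c E else 0)"
proof -
  have "(\<Sum>D\<in>A. c D * (if D = E then 1 else 0)) = (\<Sum>D\<in>A. if D = E then c D else 0)"
    by (rule sum.cong) auto
  then show ?thesis using assms by simp
qed

section \<open>Existence and uniqueness of the Schur expansion\<close>

definition is_schur_expansion :: "nat pseries \<Rightarrow> ((nat \<times> nat) set \<Rightarrow> rat) \<Rightarrow> bool" where
  "is_schur_expansion f c \<longleftrightarrow> finite {D. c D \<noteq> 0} \<and> (\<forall>D. c D \<noteq> 0 \<longrightarrow> young D) \<and>
     f = (\<Sum>D | c D \<noteq> 0. scale (c D) (schur D))"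

lemma schur_expansion_altc:
  assumes "is_schur_expansion f c" "young E" "rows_le E n"
  shows "c E = altc n f (beta n E)"
proof -
  have "altc n f (beta n E) = (\<Sum>D | c D \<noteq> 0. c D * (if D = E then 1 else 0))"
    using assms by (subst (1) conjunct2[OF conjunct2[OF assms(1)[unfolded is_schur_expansion_def]]])
       (auto simp: is_schur_expansion_def scale_eq altc_linear altc_schur intro!: sum.cong)
  also have "\<dots> = c E" using assms(1) by (simp add: is_schur_expansion_def sum_kronecker)
  finally show ?thesis by simp
qed

lemma ex_schur_expansion:
  assumes f: "f \<in> Sym"
  shows "\<exists>c. is_schur_expansion f c"
proof -
  obtain n where n: "deg_le n f" using Sym_deg[OF f] by blast
  \<comment> \<open>By \<open>schur_expansion_altc\<close> no other coefficients are possible;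
    \<open>Sym_eq_0I\<close> then shows that nothing of \<open>f\<close> remains.\<close>
  define c where "c D = (if young D \<and> rows_le D n then altc n f (beta n D) else 0)" for D
  have young: "young D" if "c D \<noteq> 0" for D using that by (auto simp: c_def split: if_splits)
  have card: "card D \<le> n" if "c D \<noteq> 0" for D
  proof (rule ccontr)
    assume "\<not> card D \<le> n"
    then have "altc n f (beta n D) = altc n 0 (beta n D)"
      using that n by (intro altc_beta_cong) (auto simp: c_def deg_le_def mcoeff_basic split: if_splits)
    then show False using that by (auto simp: c_def altc_def mcoeff_basic split: if_splits)
  qed
  have fin: "finite {D. c D \<noteq> 0}"
    by (rule finite_subset[OF _ finite_young_bounded[of n]]) (use young card in auto)
  define g where "g = f - (\<Sum>D | c D \<noteq> 0. cst (c D) * schur D)"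
  have "g = 0"
  proof (rule Sym_eq_0I)
    show "g \<in> Sym" unfolding g_def using young
      by (intro Sym_diff f Sym_sum Sym_cst_times schur_in_Sym) auto
    show "deg_le n g" unfolding g_def using card
      by (intro deg_le_diff n deg_le_sum deg_le_cst deg_le_mono[OF deg_le_schur]) auto
    fix E assume E: "young E" "rows_le E n"
    have "altc n (\<Sum>D | c D \<noteq> 0. cst (c D) * schur D) (beta n E) = (\<Sum>D | c D \<noteq> 0. c D * (if D = E then 1 else 0))"
      using young E by (auto simp: altc_linear altc_schur intro!: sum.cong)
    also have "\<dots> = c E" using fin by (simp add: sum_kronecker)
    finally show "altc n g (beta n E) = 0" using E by (simp add: g_def altc_linear c_def)
  qed
  then have "is_schur_expansion f c"
    using fin young by (simp add: is_schur_expansion_def g_def scale_eq)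
  then show ?thesis by blast
qed

lemma schur_coeff_expansion:
  assumes f: "f \<in> Sym"
  shows "is_schur_expansion f (schur_coeff f)"
proof -
  obtain c where c: "is_schur_expansion f c" using ex_schur_expansion[OF f] by blast
  have "c' = c" if c': "is_schur_expansion f c'" for c'
  proof
    fix D
    show "c' D = c D"
    proof (cases "young D")
      case True
      then show ?thesis
        using schur_expansion_altc[OF c, of D "card D"] schur_expansion_altc[OF c', of D "card D"] rows_le_card by simp
    next
      case False
      then have "c D = 0" "c' D = 0" using c c' by (auto simp: is_schur_expansion_def)
      then show ?thesis by simp
    qed
  qed
  note unique = this
  have "(THE c. is_schur_expansion f c) = c"
    by (rule the_equality[where P = "is_schur_expansion f", OF c unique])
  moreover have "schur_coeff f = (THE c. is_schur_expansion f c)"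
    by (simp add: schur_coeff_def is_schur_expansion_def)
  ultimately show ?thesis using c by simp
qed

lemma schur_coeff_altc:
  assumes "f \<in> Sym" "young D" "rows_le D n"
  shows "schur_coeff f D = altc n f (beta n D)"
  using schur_expansion_altc[OF schur_coeff_expansion[OF assms(1)] assms(2,3)] .

lemma schur_coeff_not_young: "f \<in> Sym \<Longrightarrow> \<not> young D \<Longrightarrow> schur_coeff f D = 0"
  using schur_coeff_expansion by (auto simp: is_schur_expansion_def)

lemma finite_schur_coeff: "f \<in> Sym \<Longrightarrow> finite {D. schur_coeff f D \<noteq> 0}"
  using schur_coeff_expansion by (auto simp: is_schur_expansion_def)

lemma schur_expansion: "f \<in> Sym \<Longrightarrow> f = (\<Sum>D | schur_coeff f D \<noteq> 0. cst (schur_coeff f D) * schur D)"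
  using schur_coeff_expansion[of f] by (simp add: is_schur_expansion_def scale_eq)

lemma schur_coeff_linear:
  assumes "f \<in> Sym"
  shows "g \<in> Sym \<Longrightarrow> schur_coeff (f + g) D = schur_coeff f D + schur_coeff g D"
    and "schur_coeff (cst q * f) D = q * schur_coeff f D"
proof -
  show "schur_coeff (f + g) D = schur_coeff f D + schur_coeff g D" if "g \<in> Sym"
  proof (cases "young D")
    case True
    then show ?thesis using assms that rows_le_card[OF True]
      by (simp add: schur_coeff_altc[of _ D "card D"] Sym_add altc_linear)
  qed (use assms that in \<open>simp add: schur_coeff_not_young Sym_add\<close>)
  show "schur_coeff (cst q * f) D = q * schur_coeff f D"
  proof (cases "young D")
    case True
    then show ?thesis using assms rows_le_card[OF True]
      by (simp add: schur_coeff_altc[of _ D "card D"] Sym_cst_times altc_linear)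
  qed (use assms in \<open>simp add: schur_coeff_not_young Sym_cst_times\<close>)
qed

lemma schur_coeff_0: "schur_coeff 0 D = 0"
  using schur_coeff_linear(2)[OF Sym_0, of 0 D] by simp

lemma schur_coeff_sum:
  "(\<And>x. x \<in> A \<Longrightarrow> h x \<in> Sym) \<Longrightarrow> schur_coeff (sum h A) D = (\<Sum>x\<in>A. schur_coeff (h x) D)"
  by (induction A rule: infinite_finite_induct) (auto simp: schur_coeff_0 schur_coeff_linear Sym_sum)

lemma schur_coeff_schur:
  assumes "young D"
  shows "schur_coeff (schur D) E = (if D = E then 1 else 0)"
proof (cases "young E")
  case True
  then show ?thesis
    using assms rows_le_card[OF True] by (simp add: schur_coeff_altc[of _ E "card E"] schur_in_Sym altc_schur)
qed (use assms schur_coeff_not_young schur_in_Sym in auto)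

lemma Sym_eqI:
  assumes "f \<in> Sym" "g \<in> Sym" "\<And>D. young D \<Longrightarrow> schur_coeff f D = schur_coeff g D"
  shows "f = g"
proof -
  have "schur_coeff f D = schur_coeff g D" for D
    using assms schur_coeff_not_young by (cases "young D") auto
  then have "schur_coeff f = schur_coeff g" by (rule ext)
  then show ?thesis using schur_expansion[OF assms(1)] schur_expansion[OF assms(2)] by simp
qed

lemma schur_coeff_cong_size:
  assumes "f \<in> Sym" "g \<in> Sym" "\<And>m. size m = card D \<Longrightarrow> mcoeff f m = mcoeff g m"
  shows "schur_coeff f D = schur_coeff g D"
proof (cases "young D")
  case True
  then show ?thesis
    using assms rows_le_card[OF True] altc_beta_cong[OF True, of "card D" f g] by (simp add: schur_coeff_altc)
qed (use assms schur_coeff_not_young in simp)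

lemma schur_coeff_eq_0:
  assumes "f \<in> Sym" "\<And>m. size m = card D \<Longrightarrow> mcoeff f m = 0"
  shows "schur_coeff f D = 0"
  using schur_coeff_cong_size[OF assms(1) Sym_0, of D] assms(2) by (simp add: mcoeff_basic schur_coeff_0)

section \<open>Conjugation and the Murnaghan--Nakayama rule\<close>

definition betas :: "nat \<Rightarrow> (nat \<times> nat) set \<Rightarrow> nat set" where
  "betas n D = beta n D ` {..<n}"

text \<open>An increasing sequence is determined by its set of values. Sets suit both the
  Murnaghan-Nakayama rule, which replaces one beta number, and conjugation, which complements the
  set.\<close>

definition altset :: "nat pseries \<Rightarrow> nat set \<Rightarrow> rat" where
  "altset f B = altc (card B) f (\<lambda>r. sorted_list_of_set B ! r)"

lemma sorted_list_eqI: "sorted_wrt (<) xs \<Longrightarrow> sorted_list_of_set (set xs) = (xs :: nat list)"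
  by (metis sorted_list_of_set.idem_if_sorted_distinct strict_sorted_iff)

lemma altc_eq_altset:
  fixes e :: "nat \<Rightarrow> nat"
  assumes e: "\<And>r s. r < s \<Longrightarrow> s < n \<Longrightarrow> e r < e s"
  shows "altc n f e = altset f (e ` {..<n})"
proof -
  have "sorted_wrt (<) (map e [0..<n])" using e by (auto simp: sorted_wrt_iff_nth_less)
  then have L: "sorted_list_of_set (e ` {..<n}) = map e [0..<n]"
    using sorted_list_eqI[of "map e [0..<n]"] by (simp add: atLeast0LessThan)
  then have "card (e ` {..<n}) = n"
    by (metis diff_zero length_map length_sorted_list_of_set length_upt)
  then show ?thesis unfolding altset_def L by (auto intro: altc_cong)
qed

lemma schur_coeff_altset:
  assumes "f \<in> Sym" "young D" "rows_le D n"
  shows "schur_coeff f D = altset f (betas n D)"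
  unfolding betas_def schur_coeff_altc[OF assms] by (rule altc_eq_altset) (rule beta_less[OF assms(2)])

lemma card_betas: "young D \<Longrightarrow> card (betas n D) = n"
  unfolding betas_def by (subst card_image) (auto intro: linorder_inj_onI' simp: less_imp_neq beta_less)

lemma ex_betas:
  assumes "finite B" "card B = n"
  shows "\<exists>D. young D \<and> rows_le D n \<and> betas n D = B"
proof -
  let ?L = "sorted_list_of_set B"
  have L: "length ?L = n" "set ?L = B" using assms by auto
  have "?L ! r < ?L ! s" if "r < s" "s < n" for r s
    using that L by (intro sorted_wrt_nth_less[of "(<)"]) (auto simp: strict_sorted_iff)
  then obtain D where D: "young D" "rows_le D n" "\<And>r. r < n \<Longrightarrow> beta n D r = ?L ! r"
    using ex_beta[of n "\<lambda>r. ?L ! r"] by blast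
  have "betas n D = (\<lambda>r. ?L ! r) ` {..<n}" unfolding betas_def using D(3) by (intro image_cong) auto
  also have "\<dots> = B" using L nth_image[of n ?L] by (simp add: lessThan_atLeast0)
  finally show ?thesis using D by blast
qed

lemma altc_list_swap:
  assumes "f \<in> Sym"
  shows "altc (length us + (2 + length vs)) f (\<lambda>r. (us @ [x, y] @ vs) ! r) =
    - altc (length us + (2 + length vs)) f (\<lambda>r. (us @ [y, x] @ vs) ! r)"
proof -
  let ?i = "length us" and ?n = "length us + (2 + length vs)"
  have "transpose ?i (Suc ?i) permutes {..<?n}" by (intro permutes_swap_id) auto
  note perm = altc_permute[OF assms this, of "\<lambda>r. (us @ [y, x] @ vs) ! r"]
  have "(\<lambda>r. (us @ [x, y] @ vs) ! r) = (\<lambda>r. (us @ [y, x] @ vs) ! r) \<circ> transpose ?i (Suc ?i)"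
    by (auto simp: fun_eq_iff transpose_def nth_append nth_Cons split: nat.split)
  then show ?thesis using perm by (simp only: sign_swap_id) simp
qed

lemma altc_list_move:
  assumes "f \<in> Sym"
  shows "altc (length us + (Suc (length ys) + length vs)) f (\<lambda>r. (us @ ys @ [a] @ vs) ! r) =
    (- 1) ^ length ys * altc (length us + (Suc (length ys) + length vs)) f (\<lambda>r. (us @ [a] @ ys @ vs) ! r)"
proof (induction ys arbitrary: us)
  case (Cons y ys)
  have "altc (length us + (2 + length (ys @ vs))) f (\<lambda>r. (us @ [y, a] @ ys @ vs) ! r) =
    - altc (length us + (2 + length (ys @ vs))) f (\<lambda>r. (us @ [a, y] @ ys @ vs) ! r)"
    by (rule altc_list_swap[OF assms])
  then show ?case using Cons.IH[of "us @ [y]"] by (simp add: add.assoc)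
qed simp

text \<open>Lowering b to a leaves the sequence unsorted; sorting moves a past the elements of
  \<open>B\<close> strictly between a and b, at one sign each.\<close>

lemma altc_replace:
  assumes f: "f \<in> Sym" and B: "finite B" "b \<in> B" "a \<notin> B" "a < b" and e: "\<And>r s. r < s \<Longrightarrow> s < n \<Longrightarrow> e r < e s"
    "e ` {..<n} = B" "r < n" "e r = b"
  shows "altc n f (e(r := a)) = (- 1) ^ card (B \<inter> {a<..<b}) * altset f (insert a (B - {b}))"
proof -
  define us where "us = sorted_list_of_set (B \<inter> {..<a})"
  define ys where "ys = sorted_list_of_set (B \<inter> {a<..<b})"
  define vs where "vs = sorted_list_of_set (B \<inter> {b<..})"
  have sets: "set us = B \<inter> {..<a}" "set ys = B \<inter> {a<..<b}" "set vs = B \<inter> {b<..}"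
    using B(1) by (simp_all add: us_def ys_def vs_def)
  have sorted: "sorted_wrt (<) us" "sorted_wrt (<) ys" "sorted_wrt (<) vs"
    by (auto simp: us_def ys_def vs_def strict_sorted_iff)
  have "sorted_wrt (<) (us @ ys @ [b] @ vs)"
    using sorted sets B(4) by (auto simp: sorted_wrt_append)
  moreover have "set (us @ ys @ [b] @ vs) = B"
    using sets B by (auto simp: not_less_iff_gr_or_eq)
  ultimately have L: "sorted_list_of_set B = us @ ys @ [b] @ vs" using sorted_list_eqI by metis
  have "sorted_wrt (<) (us @ [a] @ ys @ vs)"
    using sorted sets B(4) by (auto simp: sorted_wrt_append)
  moreover have "set (us @ [a] @ ys @ vs) = insert a (B - {b})"
    using sets B by (auto simp: not_less_iff_gr_or_eq)
  ultimately have L': "sorted_list_of_set (insert a (B - {b})) = us @ [a] @ ys @ vs" using sorted_list_eqI by metis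
  have "sorted_wrt (<) (map e [0..<n])" using e(1) by (auto simp: sorted_wrt_iff_nth_less)
  then have eL: "map e [0..<n] = us @ ys @ [b] @ vs"
    using sorted_list_eqI[of "map e [0..<n]"] e(2) L by (simp add: atLeast0LessThan)
  then have n: "n = length us + (Suc (length ys) + length vs)"
    by (metis (no_types) add_Suc add_Suc_right append_Cons append_Nil diff_zero length_Cons length_append length_map length_upt add.assoc)
  have enth: "e s = (us @ ys @ [b] @ vs) ! s" if "s < n" for s
    using that by (metis add_0 diff_zero eL length_upt nth_map nth_upt)
  have "e (length us + length ys) = b" using enth[of "length us + length ys"] n by (simp add: nth_append)
  then have r: "r = length us + length ys"
    using e(1)[of r "length us + length ys"] e(1)[of "length us + length ys" r] e(3,4) n
    by (cases r "length us + length ys" rule: linorder_cases) auto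
  have "altc n f (e(r := a)) = altc n f (\<lambda>s. (us @ ys @ [a] @ vs) ! s)"
  proof (rule altc_cong)
    fix s assume "s < n"
    then show "(e(r := a)) s = (us @ ys @ [a] @ vs) ! s"
      using enth[of s] by (auto simp: r nth_append nth_Cons split: nat.split)
  qed
  also have "\<dots> = (- 1) ^ length ys * altc n f (\<lambda>r. (us @ [a] @ ys @ vs) ! r)"
    unfolding n by (rule altc_list_move[OF f])
  also have "altc n f (\<lambda>r. (us @ [a] @ ys @ vs) ! r) = altset f (insert a (B - {b}))"
  proof -
    have "card (insert a (B - {b})) = length (us @ [a] @ ys @ vs)"
      using L' by (metis length_sorted_list_of_set)
    then show ?thesis unfolding altset_def L' n by simp
  qed
  also have "length ys = card (B \<inter> {a<..<b})" by (simp add: ys_def)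
  finally show ?thesis .
qed

lemma mcoeff_power_sum_times:
  assumes "k \<ge> 1"
  shows "mcoeff (power_sum k * f) m = (\<Sum>i | k \<le> count m i. mcoeff f (m - replicate_mset k i))"
proof -
  have "{i. k \<le> count m i} \<subseteq> set_mset m" using assms by (auto simp flip: count_greater_zero_iff)
  then have fin: "finite {i. k \<le> count m i}" by (rule finite_subset) simp
  have "mcoeff (power_sum k * f) m =
      (\<Sum>p\<in>{p \<in> splits m. \<exists>i. fst p = replicate_mset k i}. mcoeff f (snd p))"
    unfolding mcoeff_times by (subst sum.inter_filter) (auto simp: power_sum_def intro!: sum.cong)
  also have "\<dots> = (\<Sum>p\<in>(\<lambda>i. (replicate_mset k i, m - replicate_mset k i)) ` {i. k \<le> count m i}. mcoeff f (snd p))"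
    by (rule arg_cong[of _ _ "sum _"])
       (auto simp: splits_def count_le_replicate_mset_subset_eq image_iff intro: subset_mset.add_diff_inverse)
  also have "\<dots> = (\<Sum>i | k \<le> count m i. mcoeff f (m - replicate_mset k i))"
    using assms by (subst sum.reindex) (auto simp: inj_on_def replicate_mset_eq_iff)
  finally show ?thesis .
qed

lemma power_sum_in_Sym: "power_sum k \<in> Sym"
  unfolding Sym_def
proof (intro CollectI conjI exI[of _ k] allI impI)
  fix m :: "nat multiset" assume "k < size m"
  then show "mcoeff (power_sum k) m = 0" by (auto simp: power_sum_def)
next
  fix \<sigma> :: "nat \<Rightarrow> nat" and m assume \<sigma>: "bij \<sigma>"
  have "(\<exists>i. image_mset \<sigma> m = replicate_mset k i) \<longleftrightarrow> (\<exists>i. m = replicate_mset k i)"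
    using image_mset_bij_cancel[OF \<sigma>] by (metis image_replicate_mset)
  then show "mcoeff (power_sum k) (image_mset \<sigma> m) = mcoeff (power_sum k) m"
    by (simp add: power_sum_def)
qed

lemma altc_power_sum:
  assumes "k \<ge> 1"
  shows "altc n (power_sum k * f) e = (\<Sum>r | r < n \<and> k \<le> e r. altc n f (e(r := e r - k)))"
proof -
  have "{i. k \<le> count (expo {..<n} e) i} = {r. r < n \<and> k \<le> e r}"
    using assms by (auto simp: count_expo split: if_splits)
  moreover have "expo {..<n} e - replicate_mset k r = expo {..<n} (e(r := e r - k))" if "r < n" for r
    using that by (intro multiset_eqI) (auto simp: count_expo)
  ultimately show ?thesis
    by (simp add: altc_def mult.assoc mcoeff_power_sum_times[OF assms])
qed

text \<open>Multiplication by a power sum subtracts k from a single exponent. If the new value is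
  already present, the term vanishes by alternation; otherwise sorting gives the sign.\<close>

theorem Murnaghan_Nakayama:
  assumes f: "f \<in> Sym" and k: "k \<ge> 1" and B: "finite B"
  shows "altset (power_sum k * f) B = (\<Sum>b | b \<in> B \<and> k \<le> b \<and> b - k \<notin> B.
    (- 1) ^ card (B \<inter> {b - k<..<b}) * altset f (insert (b - k) (B - {b})))"
proof -
  define n where "n = card B"
  define e where "e r = sorted_list_of_set B ! r" for r
  have L: "length (sorted_list_of_set B) = n" "set (sorted_list_of_set B) = B" using B by (auto simp: n_def)
  have less: "e r < e s" if "r < s" "s < n" for r s
    unfolding e_def using that L by (intro sorted_wrt_nth_less[of "(<)"]) (auto simp: strict_sorted_iff)
  have img: "e ` {..<n} = B" using L nth_image[of n "sorted_list_of_set B"] by (simp add: e_def lessThan_atLeast0)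
  have inj: "inj_on e {..<n}" by (rule linorder_inj_onI) (use less in \<open>fastforce+\<close>)
  have "altset (power_sum k * f) B = (\<Sum>r | r < n \<and> k \<le> e r. altc n f (e(r := e r - k)))"
  proof -
    have "(\<lambda>r. sorted_list_of_set B ! r) = e" by (rule ext) (simp add: e_def)
    then show ?thesis using altc_power_sum[OF k, of n f e] by (simp add: altset_def n_def)
  qed
  also have "\<dots> = (\<Sum>r | r < n \<and> k \<le> e r \<and> e r - k \<notin> B. altc n f (e(r := e r - k)))"
  proof (intro sum.mono_neutral_right ballI)
    fix r assume "r \<in> {r. r < n \<and> k \<le> e r} - {r. r < n \<and> k \<le> e r \<and> e r - k \<notin> B}"
    then have r: "r < n" "k \<le> e r" "e r - k \<in> B" by auto
    then obtain s where s: "s < n" "e s = e r - k" using img by fastforce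
    then have "s \<noteq> r" using r k by auto
    then show "altc n f (e(r := e r - k)) = 0" using altc_repeated[OF f, of s n r] s r by auto
  qed auto
  also have "\<dots> = (\<Sum>r | r < n \<and> k \<le> e r \<and> e r - k \<notin> B.
      (- 1) ^ card (B \<inter> {e r - k<..<e r}) * altset f (insert (e r - k) (B - {e r})))"
    using k img by (intro sum.cong refl altc_replace[OF f B _ _ _ less img]) auto
  also have "\<dots> = (\<Sum>b\<in>e ` {r. r < n \<and> k \<le> e r \<and> e r - k \<notin> B}.
      (- 1) ^ card (B \<inter> {b - k<..<b}) * altset f (insert (b - k) (B - {b})))"
    by (subst sum.reindex) (auto intro: inj_on_subset[OF inj])
  also have "e ` {r. r < n \<and> k \<le> e r \<and> e r - k \<notin> B} = {b. b \<in> B \<and> k \<le> b \<and> b - k \<notin> B}"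
    using img by auto
  finally show ?thesis .
qed

section \<open>Conjugation as the reflected complement of the beta numbers\<close>

definition costar :: "nat \<Rightarrow> nat set \<Rightarrow> nat set" where
  "costar M B = (\<lambda>x. M - Suc x) ` ({..<M} - B)"

lemma costar_mem: "x < M \<Longrightarrow> x \<in> costar M B \<longleftrightarrow> M - Suc x \<notin> B"
proof
  assume x: "x < M" "M - Suc x \<notin> B"
  then have "x = M - Suc (M - Suc x)" "M - Suc x \<in> {..<M} - B" by auto
  then show "x \<in> costar M B" unfolding costar_def by blast
qed (auto simp: costar_def)

lemma costar_subset: "costar M B \<subseteq> {..<M}"
  by (auto simp: costar_def)

lemma card_costar: "B \<subseteq> {..<M} \<Longrightarrow> card (costar M B) = M - card B"
  unfolding costar_def by (subst card_image) (auto simp: inj_on_def card_Diff_subset finite_subset)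

text \<open>
  Read along the boundary path of the diagram, the beta numbers mark the vertical steps; conjugation
  reverses the path and exchanges vertical and horizontal steps.
\<close>
lemma betas_conjugate:
  assumes D: "young D" "rows_le D n" "rows_le (conjugate D) m"
  shows "betas m (conjugate D) = costar (n + m) (betas n D)"
proof (rule card_subset_eq)
  have cD: "young (conjugate D)" using D by simp
  have le: "rowlen D i \<le> m" "rowlen (conjugate D) j \<le> n" for i j
  proof -
    show "rowlen D i \<le> m"
      by (rule ccontr) (use D mem_young_iff[OF D(1), of i m] in \<open>auto simp: rows_le_def not_le\<close>)
    show "rowlen (conjugate D) j \<le> n"
      by (rule ccontr) (use D mem_young_iff[OF cD, of j n] in \<open>auto simp: rows_le_def not_le\<close>)
  qed
  show "finite (costar (n + m) (betas n D))" by (rule finite_subset[OF costar_subset]) simp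
  have sub: "betas n D \<subseteq> {..<n + m}"
    unfolding betas_def beta_def using le(1) by (auto intro: add_le_less_mono simp: add.commute[of n])
  show "card (betas m (conjugate D)) = card (costar (n + m) (betas n D))"
    using card_costar[OF sub] by (simp add: card_betas cD D)
  show "betas m (conjugate D) \<subseteq> costar (n + m) (betas n D)"
  proof
    fix y assume "y \<in> betas m (conjugate D)"
    then obtain s where s: "s < m" "y = rowlen (conjugate D) (m - Suc s) + s" by (auto simp: betas_def beta_def)
    have y: "y < n + m" using le(2) s by (simp add: add_le_less_mono)
    moreover have "n + m - Suc y \<notin> betas n D"
    proof
      assume "n + m - Suc y \<in> betas n D"
      then obtain r where r: "r < n" "n + m - Suc y = rowlen D (n - Suc r) + r" by (auto simp: betas_def beta_def)
      define i j where "i = n - Suc r" and "j = m - Suc s"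
      \<comment> \<open>This is what a common value would mean. But if the box (i, j) lies in
        \<open>D\<close>, the right-hand side is at least i + j + 2, and otherwise it is at most i +
        j.\<close>
      have "i + j + 1 = rowlen (conjugate D) j + rowlen D i"
        using r s y unfolding i_def j_def by linarith
      moreover have "j < rowlen D i \<longleftrightarrow> i < rowlen (conjugate D) j"
        using mem_young_iff[OF D(1), of i j] mem_young_iff[OF cD, of j i] by simp
      ultimately show False by linarith
    qed
    ultimately show "y \<in> costar (n + m) (betas n D)" by (simp add: costar_mem)
  qed
qed

text \<open>The involution omega, given linearly on the Schur basis. Its multiplicativity is
  obtained only in \<open>conj_op_mult\<close>, by way of power sums.\<close>

definition conj_op :: "nat pseries \<Rightarrow> nat pseries" where
  "conj_op f = (\<Sum>D | schur_coeff f D \<noteq> 0. cst (schur_coeff f D) * schur (conjugate D))"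

lemma schur_coeff_support_young: "f \<in> Sym \<Longrightarrow> schur_coeff f D \<noteq> 0 \<Longrightarrow> young D"
  using schur_coeff_not_young by blast

lemma conj_op_in_Sym: "f \<in> Sym \<Longrightarrow> conj_op f \<in> Sym"
  unfolding conj_op_def
  by (intro Sym_sum Sym_cst_times schur_in_Sym) (auto dest: schur_coeff_support_young)

lemma schur_coeff_conj_op:
  assumes f: "f \<in> Sym"
  shows "schur_coeff (conj_op f) E = schur_coeff f (conjugate E)"
proof -
  have "schur_coeff (conj_op f) E =
      (\<Sum>D | schur_coeff f D \<noteq> 0. schur_coeff (cst (schur_coeff f D) * schur (conjugate D)) E)"
    unfolding conj_op_def using schur_coeff_support_young[OF f]
    by (intro schur_coeff_sum Sym_cst_times schur_in_Sym) auto
  also have "\<dots> = (\<Sum>D | schur_coeff f D \<noteq> 0. schur_coeff f D * (if D = conjugate E then 1 else 0))"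
  proof (rule sum.cong[OF refl])
    fix D assume "D \<in> {D. schur_coeff f D \<noteq> 0}"
    then have D: "young D" using schur_coeff_support_young[OF f] by simp
    have "conjugate D = E \<longleftrightarrow> D = conjugate E" by auto
    then show "schur_coeff (cst (schur_coeff f D) * schur (conjugate D)) E =
        schur_coeff f D * (if D = conjugate E then 1 else 0)"
      using D by (simp add: schur_coeff_linear schur_in_Sym schur_coeff_schur)
  qed
  also have "\<dots> = schur_coeff f (conjugate E)"
    using finite_schur_coeff[OF f] by (simp add: sum_kronecker)
  finally show ?thesis .
qed

lemma conj_op_conj_op: "f \<in> Sym \<Longrightarrow> conj_op (conj_op f) = f"
  by (rule Sym_eqI) (auto simp: conj_op_in_Sym schur_coeff_conj_op)

lemma conj_op_schur: "young D \<Longrightarrow> conj_op (schur D) = schur (conjugate D)"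
proof (rule Sym_eqI)
  fix E assume "young D" "young E"
  moreover have "D = conjugate E \<longleftrightarrow> conjugate D = E" by auto
  ultimately show "schur_coeff (conj_op (schur D)) E = schur_coeff (schur (conjugate D)) E"
    by (simp add: schur_coeff_conj_op schur_in_Sym schur_coeff_schur)
qed (auto intro: conj_op_in_Sym schur_in_Sym)

lemma conj_op_linear:
  assumes "f \<in> Sym"
  shows "g \<in> Sym \<Longrightarrow> conj_op (f + g) = conj_op f + conj_op g"
    and "conj_op (cst q * f) = cst q * conj_op f"
  using assms by (auto intro!: Sym_eqI conj_op_in_Sym Sym_add Sym_cst_times
      simp: schur_coeff_conj_op schur_coeff_linear conj_op_in_Sym Sym_add Sym_cst_times)

lemma altset_conj_op:
  assumes f: "f \<in> Sym" and B: "B \<subseteq> {..<n + n}" "card B = n"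
  shows "altset (conj_op f) B = altset f (costar (n + n) B)"
proof -
  have "finite B" using B(1) finite_subset by blast
  then obtain D where D: "young D" "rows_le D n" "betas n D = B" using ex_betas B by metis
  \<comment> \<open>The largest beta number is the first row length plus n - 1 and lies below 2n, so
    there are at most n columns.\<close>
  have "rows_le (conjugate D) n"
    unfolding rows_le_def conjugate_mem
  proof (intro allI impI)
    fix j i assume "(i, j) \<in> D"
    then have "(0, j) \<in> D" "0 < n" using D by (auto simp: rows_le_def intro: young_down)
    then have "j < rowlen D 0" "beta n D (n - 1) \<in> B" using D(1,3) by (auto simp: mem_young_iff betas_def)
    then show "j < n" using B(1) by (auto simp: beta_def)
  qed
  then show ?thesis
    using betas_conjugate[of D n n] schur_coeff_altset[OF conj_op_in_Sym[OF f] D(1,2)]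
      schur_coeff_altset[OF f, of "conjugate D" n] D by (simp add: schur_coeff_conj_op[OF f])
qed

text \<open>Lowering b by k in \<open>B\<close> lowers c by k in the reflected complement. Of the k
  - 1 places strictly between, those in \<open>B\<close> count for one sign and those outside for
  the other, so the two signs multiply to (-1)^(k-1).\<close>

lemma costar_exchange:
  assumes B: "B \<subseteq> {..<M}" and b: "b \<in> B" "k \<le> b" "b - k \<notin> B" "1 \<le> k"
  defines "c \<equiv> M - Suc (b - k)"
  shows "c \<in> costar M B" "k \<le> c" "c - k \<notin> costar M B" "M - Suc (c - k) = b"
    and "costar M (insert (b - k) (B - {b})) = insert (c - k) (costar M B - {c})"
    and "card (B \<inter> {b - k<..<b}) + card (costar M B \<inter> {c - k<..<c}) = k - 1"
proof -
  have bM: "b < M" using B b by auto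
  show c: "c \<in> costar M B" "k \<le> c" "c - k \<notin> costar M B" "M - Suc (c - k) = b"
    using b bM by (auto simp: c_def costar_mem)
  show "costar M (insert (b - k) (B - {b})) = insert (c - k) (costar M B - {c})"
  proof (rule Set.set_eqI)
    fix x
    show "x \<in> costar M (insert (b - k) (B - {b})) \<longleftrightarrow> x \<in> insert (c - k) (costar M B - {c})"
    proof (cases "x < M")
      case True
      then have "M - Suc x = b \<longleftrightarrow> x = c - k" "M - Suc x = b - k \<longleftrightarrow> x = c"
        using bM b(2) by (auto simp: c_def)
      moreover have "x = c - k \<Longrightarrow> x \<noteq> c" using c(2) b(4) by linarith
      ultimately show ?thesis using True by (auto simp: costar_mem)
    next
      case False
      then show ?thesis using costar_subset[of M] bM by (auto simp: c_def)
    qed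
  qed
  have "costar M B \<inter> {c - k<..<c} = (\<lambda>x. M - Suc x) ` ({b - k<..<b} - B)"
  proof (rule Set.set_eqI, rule iffI)
    fix y assume y: "y \<in> costar M B \<inter> {c - k<..<c}"
    then have "y < M" using costar_subset[of M B] by auto
    then have "M - Suc y \<in> {b - k<..<b} - B" "y = M - Suc (M - Suc y)"
      using y bM b(2) by (auto simp: costar_mem c_def)
    then show "y \<in> (\<lambda>x. M - Suc x) ` ({b - k<..<b} - B)" by blast
  next
    fix y assume "y \<in> (\<lambda>x. M - Suc x) ` ({b - k<..<b} - B)"
    then obtain x where x: "y = M - Suc x" "b - k < x" "x < b" "x \<notin> B" by auto
    then show "y \<in> costar M B \<inter> {c - k<..<c}" using bM b(2) by (auto simp: costar_def c_def)
  qed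
  moreover have "inj_on (\<lambda>x. M - Suc x) ({b - k<..<b} - B)" using bM by (auto simp: inj_on_def)
  ultimately have "card (costar M B \<inter> {c - k<..<c}) = card ({b - k<..<b} - B)" by (simp add: card_image)
  moreover have "card (B \<inter> {b - k<..<b}) + card ({b - k<..<b} - B) = card {b - k<..<b}"
    by (metis Int_commute card_Int_Diff finite_greaterThanLessThan)
  ultimately show "card (B \<inter> {b - k<..<b}) + card (costar M B \<inter> {c - k<..<c}) = k - 1"
    using b by simp
qed

text \<open>The Murnaghan-Nakayama terms at a diagram and at its conjugate are matched by
  \<open>w\<close>, and in each pair the two sign exponents add up to k - 1.\<close>

theorem conj_op_power_sum_times:
  assumes f: "f \<in> Sym" and k: "k \<ge> 1"
  shows "conj_op (power_sum k * f) = cst ((- 1) ^ (k - 1)) * (power_sum k * conj_op f)"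
proof (rule Sym_eqI)
  have pf: "power_sum k * f \<in> Sym" "power_sum k * conj_op f \<in> Sym"
    using f by (auto intro: Sym_mult power_sum_in_Sym conj_op_in_Sym)
  then show "conj_op (power_sum k * f) \<in> Sym" "cst ((- 1) ^ (k - 1)) * (power_sum k * conj_op f) \<in> Sym"
    by (auto intro: conj_op_in_Sym Sym_cst_times)
  fix E assume E: "young E"
  define n where "n = card E"
  \<comment> \<open>With n the weight, the diagram and its conjugate both have at most n rows, so
    one window of length 2n serves both.\<close>
  define M where "M = n + n"
  have rE: "rows_le E n" "rows_le (conjugate E) n"
    using rows_le_card[OF E] rows_le_card[of "conjugate E"] E by (auto simp: n_def)
  define B where "B = betas n E"
  define C where "C = costar M B"
  have cB: "card B = n" using E by (simp add: B_def card_betas)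
  have C: "betas n (conjugate E) = C" using betas_conjugate[OF E rE] by (simp add: B_def C_def M_def)
  have "B = costar M C"
    using betas_conjugate[of "conjugate E" n n] E rE by (simp add: B_def C M_def)
  then have BM: "B \<subseteq> {..<M}" and CM: "C \<subseteq> {..<M}" using costar_subset C_def by auto
  have fin: "finite B" "finite C" using BM CM finite_subset by auto
  define R where "R = (\<lambda>B. {b. b \<in> B \<and> k \<le> b \<and> b - k \<notin> (B :: nat set)})"
  define w where "w b = M - Suc (b - k)" for b
  have wB: "w b \<in> R C \<and> w (w b) = b" if "b \<in> R B" for b
    using costar_exchange(1-4)[OF BM, of b k] that k by (simp add: R_def w_def C_def)
  have wC: "w c \<in> R B \<and> w (w c) = c" if "c \<in> R C" for c
    using costar_exchange(1-4)[OF CM, of c k] that k \<open>B = costar M C\<close> by (simp add: R_def w_def)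
  have "schur_coeff (power_sum k * conj_op f) E = altset (power_sum k * conj_op f) B"
    using schur_coeff_altset[OF pf(2) E rE(1)] by (simp add: B_def)
  also have "\<dots> = (\<Sum>b\<in>R B. (- 1) ^ card (B \<inter> {b - k<..<b}) * altset (conj_op f) (insert (b - k) (B - {b})))"
    using Murnaghan_Nakayama[OF conj_op_in_Sym[OF f] k fin(1)] by (simp add: R_def)
  also have "\<dots> = (\<Sum>b\<in>R B. (- 1) ^ (k - 1) * ((- 1) ^ card (C \<inter> {w b - k<..<w b}) *
      altset f (insert (w b - k) (C - {w b}))))"
  proof (rule sum.cong[OF refl])
    fix b assume "b \<in> R B"
    then have b: "b \<in> B" "k \<le> b" "b - k \<notin> B" by (auto simp: R_def)
    note ex = costar_exchange[OF BM b k]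
    have "insert (b - k) (B - {b}) \<subseteq> {..<M}" using b BM by auto
    moreover have "card (insert (b - k) (B - {b})) = n"
      using b fin cB by (simp add: card_gt_0_iff card_insert_if) (metis Suc_pred card_gt_0_iff empty_iff)
    ultimately have "altset (conj_op f) (insert (b - k) (B - {b})) = altset f (insert (w b - k) (C - {w b}))"
      using altset_conj_op[OF f, of _ n] ex(5) by (simp add: M_def w_def C_def)
    moreover have "(- 1 :: rat) ^ card (B \<inter> {b - k<..<b}) = (- 1) ^ (k - 1) * (- 1) ^ card (C \<inter> {w b - k<..<w b})"
      using ex(6) unfolding C_def w_def
      by (metis (no_types) add.commute left_minus_one_mult_self mult.commute power_add)
    ultimately show "(- 1) ^ card (B \<inter> {b - k<..<b}) * altset (conj_op f) (insert (b - k) (B - {b})) =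
        (- 1) ^ (k - 1) * ((- 1) ^ card (C \<inter> {w b - k<..<w b}) * altset f (insert (w b - k) (C - {w b})))"
      by simp
  qed
  also have "\<dots> = (- 1) ^ (k - 1) * (\<Sum>b\<in>R B. (- 1) ^ card (C \<inter> {w b - k<..<w b}) *
      altset f (insert (w b - k) (C - {w b})))"
    by (simp add: sum_distrib_left)
  also have "(\<Sum>b\<in>R B. (- 1) ^ card (C \<inter> {w b - k<..<w b}) * altset f (insert (w b - k) (C - {w b})))
      = (\<Sum>c\<in>R C. (- 1) ^ card (C \<inter> {c - k<..<c}) * altset f (insert (c - k) (C - {c})))"
    by (rule sum.reindex_bij_witness[where i = w and j = w]) (use wB wC in auto)
  also have "\<dots> = altset (power_sum k * f) C"
    using Murnaghan_Nakayama[OF f k fin(2)] by (simp add: R_def)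
  also have "\<dots> = schur_coeff (conj_op (power_sum k * f)) E"
    using schur_coeff_altset[OF pf(1), of "conjugate E" n] E rE(2)
    by (simp add: schur_coeff_conj_op[OF pf(1)] C)
  finally show "schur_coeff (conj_op (power_sum k * f)) E =
      schur_coeff (cst ((- 1) ^ (k - 1)) * (power_sum k * conj_op f)) E"
    unfolding schur_coeff_linear(2)[OF pf(2)] by (metis left_minus_one_mult_self)
qed

section \<open>Elementary and complete symmetric functions, Pieri rules\<close>

definition squarefree_mset :: "'a multiset \<Rightarrow> bool" where
  "squarefree_mset m \<longleftrightarrow> (\<forall>i. count m i \<le> 1)"

definition esym :: "nat \<Rightarrow> nat pseries" where
  "esym k = Abs_pseries (\<lambda>m. if size m = k \<and> squarefree_mset m then 1 else 0)"

definition hsym :: "nat \<Rightarrow> nat pseries" where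
  "hsym k = Abs_pseries (\<lambda>m. if size m = k then 1 else 0)"

lemma mcoeff_esym: "mcoeff (esym k) m = (if size m = k \<and> squarefree_mset m then 1 else 0)"
  and mcoeff_hsym: "mcoeff (hsym k) m = (if size m = k then 1 else 0)"
  by (simp_all add: esym_def hsym_def)

lemma squarefree_mset_iff: "squarefree_mset m \<longleftrightarrow> m = mset_set (set_mset m)"
proof
  assume "squarefree_mset m"
  then show "m = mset_set (set_mset m)"
    by (intro multiset_eqI) (auto simp: squarefree_mset_def count_mset_set' not_in_iff
        intro: antisym simp flip: count_greater_zero_iff)
next
  assume "m = mset_set (set_mset m)"
  then show "squarefree_mset m" unfolding squarefree_mset_def
    by (metis count_mset_set' le_refl zero_le_one)
qed

lemma hsym_in_Sym: "hsym k \<in> Sym"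
  unfolding Sym_def by (auto simp: mcoeff_hsym intro!: exI[of _ k])

lemma esym_in_Sym: "esym k \<in> Sym"
  unfolding Sym_def
proof (intro CollectI conjI exI[of _ k] allI impI)
  fix \<sigma> :: "nat \<Rightarrow> nat" and m assume \<sigma>: "bij \<sigma>"
  have count: "count (image_mset \<sigma> m) (\<sigma> i) = count m i" for i
  proof -
    have "\<sigma> -` {\<sigma> i} \<inter> set_mset m = {i} \<inter> set_mset m" using \<sigma> by (auto dest: bij_is_inj injD)
    then show ?thesis by (cases "i \<in># m") (auto simp: count_image_mset not_in_iff)
  qed
  have "squarefree_mset (image_mset \<sigma> m) \<longleftrightarrow> squarefree_mset m"
    unfolding squarefree_mset_def using \<sigma> count by (metis bij_pointE)
  then show "mcoeff (esym k) (image_mset \<sigma> m) = mcoeff (esym k) m"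
    by (simp add: mcoeff_esym)
qed (simp add: mcoeff_esym)

lemma esym_0: "esym 0 = 1" and hsym_0: "hsym 0 = 1"
  by (auto intro!: pseries_eqI simp: mcoeff_esym mcoeff_hsym mcoeff_basic squarefree_mset_def)

lemma mcoeff_esym_times:
  "mcoeff (esym k * f) m = (\<Sum>S | S \<subseteq> set_mset m \<and> card S = k. mcoeff f (m - mset_set S))"
proof -
  have fin: "finite S" if "S \<subseteq> set_mset m" for S using that finite_subset by auto
  have "mcoeff (esym k * f) m =
      (\<Sum>p\<in>{p \<in> splits m. size (fst p) = k \<and> squarefree_mset (fst p)}. mcoeff f (snd p))"
    unfolding mcoeff_times by (subst sum.inter_filter) (auto simp: mcoeff_esym intro!: sum.cong)
  also have "\<dots> = (\<Sum>S | S \<subseteq> set_mset m \<and> card S = k. mcoeff f (m - mset_set S))"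
  proof (rule sum.reindex_bij_witness[where i = "\<lambda>S. (mset_set S, m - mset_set S)" and j = "\<lambda>p. set_mset (fst p)"])
    fix p assume p: "p \<in> {p \<in> splits m. size (fst p) = k \<and> squarefree_mset (fst p)}"
    then have eq: "mset_set (set_mset (fst p)) = fst p" by (simp add: squarefree_mset_iff)
    with p show "(mset_set (set_mset (fst p)), m - mset_set (set_mset (fst p))) = p"
      by (auto simp: splits_def)
    show "set_mset (fst p) \<in> {S. S \<subseteq> set_mset m \<and> card S = k}"
      using p eq size_mset_set[of "set_mset (fst p)"] by (auto simp: splits_def)
    show "mcoeff f (m - mset_set (set_mset (fst p))) = mcoeff f (snd p)"
      using p eq by (auto simp: splits_def)
  next
    fix S assume S: "S \<in> {S. S \<subseteq> set_mset m \<and> card S = k}"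
    then have f: "finite S" using fin by simp
    then have "mset_set S \<subseteq># m"
      using S by (auto simp: subseteq_mset_def count_mset_set' Suc_le_eq)
    then show "(mset_set S, m - mset_set S) \<in> {p \<in> splits m. size (fst p) = k \<and> squarefree_mset (fst p)}"
      using S f by (simp add: splits_def squarefree_mset_iff)
    show "set_mset (fst (mset_set S, m - mset_set S)) = S" using f by simp
  qed
  finally show ?thesis .
qed

lemma altc_esym:
  "altc n (esym k * f) e = (\<Sum>S | S \<subseteq> {r. r < n \<and> 1 \<le> e r} \<and> card S = k. altc n f (\<lambda>r. e r - of_bool (r \<in> S)))"
proof -
  have set: "set_mset (expo {..<n} e) = {r. r < n \<and> 1 \<le> e r}"
    by (auto simp: count_expo simp flip: count_greater_zero_iff split: if_splits)
  have "expo {..<n} e - mset_set S = expo {..<n} (\<lambda>r. e r - of_bool (r \<in> S))" if "S \<subseteq> {r. r < n \<and> 1 \<le> e r}" for S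
  proof (rule multiset_eqI)
    fix x
    have "finite S" by (rule finite_subset[OF that]) simp
    then show "count (expo {..<n} e - mset_set S) x = count (expo {..<n} (\<lambda>r. e r - of_bool (r \<in> S))) x"
      using that by (auto simp: count_expo count_mset_set')
  qed
  then show ?thesis by (simp add: altc_def mult.assoc mcoeff_esym_times set)
qed

definition vstrip :: "(nat \<times> nat) set \<Rightarrow> (nat \<times> nat) set \<Rightarrow> bool" where
  "vstrip K D \<longleftrightarrow> young K \<and> K \<subseteq> D \<and> (\<forall>i j. (i, Suc j) \<in> D \<longrightarrow> (i, j) \<in> K)"

lemma vstrip_conjugate: "vstrip (conjugate K) (conjugate D) \<longleftrightarrow> hstrip K D"
proof -
  have "conjugate K \<subseteq> conjugate D \<longleftrightarrow> K \<subseteq> D"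
    by (metis conjugate_conjugate conjugate_def image_mono)
  then show ?thesis by (auto simp: vstrip_def hstrip_def)
qed

lemma vstrip_rowlen:
  assumes "young D" "young K"
  shows "vstrip K D \<longleftrightarrow> (\<forall>i. rowlen K i \<le> rowlen D i \<and> rowlen D i \<le> Suc (rowlen K i))"
  unfolding vstrip_def using assms
  by (auto simp: mem_young_iff subset_iff) (metis Suc_less_eq le_less_linear less_irrefl_nat not_less_eq order_less_le_trans)+

lemma card_vstrip:
  assumes "vstrip K D" "young D" "rows_le D n"
  shows "rows_le K n" "card (D - K) = card {r. r < n \<and> beta n K r \<noteq> beta n D r}"
    "\<And>r. beta n K r = beta n D r - of_bool (beta n K r \<noteq> beta n D r) \<and> beta n K r \<le> beta n D r"
proof -
  have K: "young K" "K \<subseteq> D" using assms(1) by (auto simp: vstrip_def)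
  show rK: "rows_le K n" using K assms(3) by (auto simp: rows_le_def)
  have le: "beta n K r \<le> beta n D r" "beta n D r \<le> Suc (beta n K r)" for r
    using assms(1) vstrip_rowlen[OF assms(2) K(1)] by (auto simp: beta_def)
  show "beta n K r = beta n D r - of_bool (beta n K r \<noteq> beta n D r) \<and> beta n K r \<le> beta n D r" for r
    using le[of r] by auto
  have "(\<Sum>r<n. beta n D r) = (\<Sum>r<n. beta n K r + of_bool (beta n K r \<noteq> beta n D r))"
  proof (rule sum.cong[OF refl])
    fix r
    show "beta n D r = beta n K r + of_bool (beta n K r \<noteq> beta n D r)"
      using le[of r] by auto
  qed
  also have "\<dots> = (\<Sum>r<n. beta n K r) + card {r. r < n \<and> beta n K r \<noteq> beta n D r}"
    by (simp add: sum.distrib of_bool_def sum.inter_filter[symmetric] lessThan_def Collect_conj_eq[symmetric])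
  finally have "card D = card K + card {r. r < n \<and> beta n K r \<noteq> beta n D r}"
    using sum_beta[OF assms(2,3)] sum_beta[OF K(1) rK] by simp
  moreover have "card (D - K) = card D - card K"
    using K young_finite by (intro card_Diff_subset) auto
  ultimately show "card (D - K) = card {r. r < n \<and> beta n K r \<noteq> beta n D r}" by simp
qed

text \<open>An elementary function lowers k of the beta numbers by 1, which leaves them weakly
  increasing. The strict sequences are the beta numbers left by vertical strips; those with a
  repetition vanish by alternation.\<close>

theorem Pieri_esym:
  assumes f: "f \<in> Sym" and D: "young D"
  shows "schur_coeff (esym k * f) D = (\<Sum>K | vstrip K D \<and> card (D - K) = k. schur_coeff f K)"
proof -
  define n where "n = card D"
  define b where "b = beta n D"
  have rD: "rows_le D n" using rows_le_card[OF D] by (simp add: n_def)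
  have b: "b r < b s" if "r < s" for r s using beta_less[OF D that] by (simp add: b_def)
  define e where "e S r = b r - of_bool (r \<in> S)" for S r
  define A where "A = {S. S \<subseteq> {r. r < n \<and> 1 \<le> b r} \<and> card S = k}"
  define A' where "A' = {S \<in> A. \<forall>r s. r < s \<longrightarrow> s < n \<longrightarrow> e S r < e S s}"
  define L where "L = {K. vstrip K D \<and> card (D - K) = k}"
  define g where "g K = {r. r < n \<and> beta n K r \<noteq> b r}" for K
  have finA: "finite A" unfolding A_def by (rule finite_subset[of _ "Pow {..<n}"]) auto
  have L: "young K" "vstrip K D" "rows_le K n" "card (g K) = k"
      "\<And>r. r < n \<Longrightarrow> e (g K) r = beta n K r" "\<And>r. beta n K r \<le> b r" if "K \<in> L" for K
  proof -
    have v: "vstrip K D" "card (D - K) = k" using that by (auto simp: L_def)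
    then show "young K" "vstrip K D" by (auto simp: vstrip_def)
    note c = card_vstrip[OF v(1) D rD]
    show "rows_le K n" "card (g K) = k" using c(1,2) v(2) by (auto simp: g_def b_def)
    show "e (g K) r = beta n K r" if "r < n" for r
      using c(3)[of r] that by (simp add: e_def g_def b_def)
    show "beta n K r \<le> b r" for r using c(3)[of r] by (simp add: b_def)
  qed
  have bij: "bij_betw g L A'"
    unfolding bij_betw_def
  proof
    show "inj_on g L"
    proof (rule inj_onI)
      fix K K' assume *: "K \<in> L" "K' \<in> L" "g K = g K'"
      show "K = K'"
        by (rule beta_inj[OF L(1)[OF *(1)] L(1)[OF *(2)] L(3)[OF *(1)] L(3)[OF *(2)]])
           (metis L(5) *)
    qed
    show "g ` L = A'"
    proof (intro subset_antisym image_subsetI subsetI)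
      fix K assume K: "K \<in> L"
      have "1 \<le> b r" if "r \<in> g K" for r using L(6)[OF K, of r] that by (auto simp: g_def)
      moreover have "e (g K) r < e (g K) s" if "r < s" "s < n" for r s
        using beta_less[OF L(1)[OF K] that(1)] that by (simp add: L(5)[OF K])
      ultimately show "g K \<in> A'" using L(4)[OF K] by (auto simp: A'_def A_def g_def)
    next
      fix S assume S: "S \<in> A'"
      then have S1: "S \<subseteq> {r. r < n \<and> 1 \<le> b r}" "card S = k" by (auto simp: A'_def A_def)
      have "e S r < e S s" if "r < s" "s < n" for r s using S that by (auto simp: A'_def)
      from ex_beta[of n "e S", OF this] obtain K where K: "young K" "rows_le K n" "\<And>r. r < n \<Longrightarrow> beta n K r = e S r"
        by auto
      have "rowlen K i \<le> rowlen D i \<and> rowlen D i \<le> Suc (rowlen K i)" for i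
      proof (cases "i < n")
        case True
        then show ?thesis using K(3)[of "n - Suc i"] by (auto simp: e_def b_def beta_def of_bool_def split: if_splits)
      qed (use K D rD rows_le_rowlen in auto)
      then have v: "vstrip K D" using vstrip_rowlen[OF D K(1)] by simp
      have gK: "g K = S"
      proof (rule Set.set_eqI)
        fix r
        show "r \<in> g K \<longleftrightarrow> r \<in> S"
          using K(3)[of r] S1(1) by (cases "r \<in> S") (auto simp: g_def e_def)
      qed
      moreover have "K \<in> L" using card_vstrip(2)[OF v D rD] v gK S1(2) by (simp add: L_def g_def b_def)
      ultimately show "S \<in> g ` L" by blast
    qed
  qed
  have "schur_coeff (esym k * f) D = (\<Sum>S\<in>A. altc n f (e S))"
    unfolding schur_coeff_altc[OF Sym_mult[OF esym_in_Sym f] D rD] altc_esym A_def e_def b_def by simp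
  also have "\<dots> = (\<Sum>S\<in>A'. altc n f (e S))"
  proof (intro sum.mono_neutral_right finA ballI)
    fix S assume "S \<in> A - A'"
    then obtain r s where rs: "r < s" "s < n" "\<not> e S r < e S s" by (auto simp: A'_def)
    then have "e S r = e S s" using b[of r s] by (auto simp: e_def of_bool_def split: if_splits)
    then show "altc n f (e S) = 0" using altc_repeated[OF f, of r n s] rs by auto
  qed (auto simp: A'_def)
  also have "\<dots> = (\<Sum>K\<in>L. altc n f (e (g K)))"
    by (rule sum.reindex_bij_betw[OF bij, symmetric])
  also have "\<dots> = (\<Sum>K\<in>L. schur_coeff f K)"
    using L by (intro sum.cong) (auto simp: schur_coeff_altc[OF f, of _ n] intro!: altc_cong)
  finally show ?thesis by (simp add: L_def)
qed

section \<open>Power sums generate the symmetric functions\<close>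

lemma sum_swap_count:
  assumes "size m = k"
  shows "(\<Sum>i = 1..k. \<Sum>v | i \<le> count m v. F i v) = (\<Sum>v\<in>set_mset m. \<Sum>i = 1..count m v. F i v)"
proof -
  have "(\<Sum>i = 1..k. \<Sum>v | i \<le> count m v. F i v) = (\<Sum>i = 1..k. \<Sum>v | v \<in> set_mset m \<and> i \<le> count m v. F i v)"
    by (intro sum.cong arg_cong[where f = "sum _"]) (auto simp flip: count_greater_zero_iff)
  also have "\<dots> = (\<Sum>v\<in>set_mset m. \<Sum>i | i \<in> {1..k} \<and> i \<le> count m v. F i v)"
    by (rule sum.swap_restrict) auto
  also have "\<dots> = (\<Sum>v\<in>set_mset m. \<Sum>i = 1..count m v. F i v)"
    using assms count_le_size[of m]
    by (intro sum.cong arg_cong[where f = "sum _"]) (auto intro: order_trans)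
  finally show ?thesis .
qed

lemma size_minus_replicate: "i \<le> count m v \<Longrightarrow> size (m - replicate_mset i v) = size m - i \<and> i \<le> size m"
  by (metis count_le_replicate_mset_subset_eq count_le_size order_trans size_Diff_submset size_replicate_mset)

text \<open>At a monomial of degree k the right-hand side counts the pairs of a variable and a
  number from 1 to its exponent.\<close>

lemma Newton_hsym: "cst (of_nat k) * hsym k = (\<Sum>i = 1..k. power_sum i * hsym (k - i))"
proof (rule pseries_eqI)
  fix m
  show "mcoeff (cst (of_nat k) * hsym k) m = mcoeff (\<Sum>i = 1..k. power_sum i * hsym (k - i)) m"
  proof (cases "size m = k")
    case True
    have "mcoeff (\<Sum>i = 1..k. power_sum i * hsym (k - i)) m = (\<Sum>i = 1..k. \<Sum>v | i \<le> count m v. 1)"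
      unfolding mcoeff_sum using True
      by (intro sum.cong refl) (auto simp: mcoeff_power_sum_times mcoeff_hsym size_minus_replicate)
    also have "\<dots> = (\<Sum>v\<in>set_mset m. of_nat (count m v))"
      unfolding sum_swap_count[OF True] by simp
    also have "\<dots> = of_nat k" using True by (simp add: size_multiset_overloaded_eq flip: of_nat_sum)
    finally show ?thesis using True by (simp add: mcoeff_cst_times mcoeff_hsym)
  next
    case False
    have "mcoeff (power_sum i * hsym (k - i)) m = 0" if "i \<in> {1..k}" for i
      using that False by (auto simp: mcoeff_power_sum_times mcoeff_hsym intro!: sum.neutral dest!: size_minus_replicate)
    then show ?thesis using False by (simp add: mcoeff_cst_times mcoeff_hsym mcoeff_sum)
  qed
qed

text \<open>Fix a variable v of exponent c. The quotient must be squarefree, which leaves no term if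
  another variable is repeated, and otherwise at most i = c - 1 and i = c. These two cancel for c >=
  2; for c = 1 a single 1 remains.\<close>

lemma Newton_esym: "cst (of_nat k) * esym k = (\<Sum>i = 1..k. cst ((- 1) ^ (i - 1)) * (power_sum i * esym (k - i)))"
proof (rule pseries_eqI)
  fix m
  show "mcoeff (cst (of_nat k) * esym k) m =
      mcoeff (\<Sum>i = 1..k. cst ((- 1) ^ (i - 1)) * (power_sum i * esym (k - i))) m"
  proof (cases "size m = k")
    case True
    define Q where "Q v \<longleftrightarrow> (\<forall>u. u \<noteq> v \<longrightarrow> count m u \<le> 1)" for v
    define F where "F i v = (if Q v \<and> count m v - i \<le> 1 then (- 1) ^ (i - 1) else 0 :: rat)" for i v
    have sq: "squarefree_mset (m - replicate_mset i v) \<longleftrightarrow> Q v \<and> count m v - i \<le> 1" for i v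
      by (auto simp: squarefree_mset_def Q_def)
    have inner: "(\<Sum>i = 1..count m v. F i v) = (if squarefree_mset m then 1 else 0)" if v: "v \<in># m" for v
    proof (cases "Q v \<and> count m v \<noteq> 1")
      case True
      then have ns: "\<not> squarefree_mset m"
        using v by (auto simp: squarefree_mset_def intro!: exI[of _ v] simp flip: count_greater_zero_iff)
      obtain c where c: "count m v = Suc (Suc c)"
        using True v by (metis One_nat_def Suc_pred count_greater_zero_iff nat_neq_iff not0_implies_Suc not_gr_zero)
      have "(\<Sum>i = 1..count m v. F i v) = (\<Sum>i\<in>{Suc c, Suc (Suc c)}. F i v)"
        unfolding c by (rule sum.mono_neutral_right) (auto simp: F_def c)
      also have "\<dots> = 0" using True by (simp add: F_def c)
      finally show ?thesis using ns by simp
    next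
      case False
      then consider "\<not> Q v" | "Q v" "count m v = 1" by blast
      then show ?thesis
      proof cases
        case 1
        then have "\<not> squarefree_mset m" by (auto simp: Q_def squarefree_mset_def)
        then show ?thesis using 1 by (simp add: F_def)
      next
        case 2
        then have "squarefree_mset m" unfolding Q_def squarefree_mset_def by (metis le_refl)
        then show ?thesis using 2 by (simp add: F_def)
      qed
    qed
    have "mcoeff (\<Sum>i = 1..k. cst ((- 1) ^ (i - 1)) * (power_sum i * esym (k - i))) m
        = (\<Sum>i = 1..k. \<Sum>v | i \<le> count m v. F i v)"
      unfolding mcoeff_sum mcoeff_cst_times using True
      by (intro sum.cong refl)
         (auto simp: mcoeff_power_sum_times mcoeff_esym size_minus_replicate sum_distrib_left F_def sq intro!: sum.cong)
    also have "\<dots> = (\<Sum>v\<in>set_mset m. if squarefree_mset m then 1 else 0)"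
      unfolding sum_swap_count[OF True] by (rule sum.cong[OF refl inner])
    also have "\<dots> = (if squarefree_mset m then of_nat k else 0)"
      using True by (auto simp: squarefree_mset_iff) (metis size_mset_set)
    finally show ?thesis using True by (simp add: mcoeff_cst_times mcoeff_esym)
  next
    case False
    have "mcoeff (power_sum i * esym (k - i)) m = 0" if "i \<in> {1..k}" for i
      using that False by (auto simp: mcoeff_power_sum_times mcoeff_esym intro!: sum.neutral dest!: size_minus_replicate)
    then show ?thesis using False by (simp add: mcoeff_cst_times mcoeff_esym mcoeff_sum)
  qed
qed

text \<open>The algebra generated by the power sums. Since it contains \<open>Sym\<close>
  (\<open>Sym_power_gen\<close>), identities between homomorphisms need checking on power sums
  only.\<close>

inductive_set power_gen :: "nat pseries set" where
  cst: "cst q \<in> power_gen"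
| power_sum: "1 \<le> k \<Longrightarrow> power_sum k \<in> power_gen"
| add: "f \<in> power_gen \<Longrightarrow> g \<in> power_gen \<Longrightarrow> f + g \<in> power_gen"
| mult: "f \<in> power_gen \<Longrightarrow> g \<in> power_gen \<Longrightarrow> f * g \<in> power_gen"

lemma power_gen_sum: "(\<And>x. x \<in> A \<Longrightarrow> h x \<in> power_gen) \<Longrightarrow> sum h A \<in> power_gen"
  using power_gen.cst[of 0] by (induction A rule: infinite_finite_induct) (auto simp: cst_0 intro: power_gen.add)

lemma cst_in_Sym: "cst q \<in> Sym"
  using Sym_cst_times[OF Sym_1, of q] by simp

lemma cst_cancel: "q \<noteq> 0 \<Longrightarrow> cst q * f = cst q * g \<Longrightarrow> f = g"
  by (metis cst_1 cst_mult left_inverse mult.assoc mult_1)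

lemma esym_power_gen: "esym k \<in> power_gen"
proof (induction k rule: less_induct)
  case (less k)
  show ?case
  proof (cases "k = 0")
    case True
    then show ?thesis using power_gen.cst[of 1] by (simp add: esym_0 cst_1)
  next
    case False
    have "(\<Sum>i = 1..k. cst ((- 1) ^ (i - 1)) * (power_sum i * esym (k - i))) \<in> power_gen"
      using less False by (intro power_gen_sum power_gen.mult power_gen.cst power_gen.power_sum) auto
    then have "cst (inverse (of_nat k)) * (cst (of_nat k) * esym k) \<in> power_gen"
      unfolding Newton_esym by (intro power_gen.mult power_gen.cst)
    also have "cst (inverse (of_nat k)) * (cst (of_nat k) * esym k) = esym k"
      using False by (simp add: cst_mult cst_1 flip: mult.assoc)
    finally show ?thesis .
  qed
qed

lemma schur_empty: "schur {} = 1"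
proof (rule pseries_eqI)
  fix m
  have "tableaux {} {#} = {\<lambda>_. undefined}" by (auto simp: tableaux_def ssyt_def extensional_def)
  then show "mcoeff (schur {}) m = mcoeff 1 m"
    using mcoeff_schur_size[of m "{}"] by (cases "m = {#}") (auto simp: mcoeff_basic mcoeff_schur)
qed

lemma young_empty: "young {}"
  by (simp add: young_def)

definition height :: "(nat \<times> nat) set \<Rightarrow> nat" where
  "height D = rowlen (conjugate D) 0"

lemma rows_le_height: "young D \<Longrightarrow> rows_le D n \<longleftrightarrow> height D \<le> n"
proof -
  assume D: "young D"
  have "(i, 0) \<in> D \<longleftrightarrow> i < height D" for i
    using mem_young_iff[of "conjugate D" 0 i] D by (simp add: height_def)
  moreover have "rows_le D n \<longleftrightarrow> (\<forall>i. (i, 0) \<in> D \<longrightarrow> i < n)"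
    using D by (auto simp: rows_le_def intro: young_down)
  ultimately have "rows_le D n \<longleftrightarrow> {..<height D} \<subseteq> {..<n}"
    by (simp only: subset_eq lessThan_iff Ball_def)
  then show ?thesis by simp
qed

text \<open>
  If \<open>K\<close> is \<open>D\<close> without its first column, then \<^term>\<open>esym (height D) * schur K\<close> is \<^term>\<open>schur D\<close> plus Schur
  functions of diagrams of the same weight with more rows.
\<close>
lemma schur_power_gen: "young D \<Longrightarrow> schur D \<in> power_gen"
\<comment> \<open>A lexicographic order packed into one number: the square of the weight dominates,
  and at equal weight more rows count as smaller.\<close>
proof (induction D rule: measure_induct_rule[of "\<lambda>D. card D * card D + (card D - height D)"])
  case (less D)
  note D = \<open>young D\<close>
  have hc: "height E \<le> card E" if "young E" for E using rows_le_height[OF that] rows_le_card[OF that] by simp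
  show ?case
  proof (cases "D = {}")
    case True
    then show ?thesis using power_gen.cst[of 1] by (simp add: schur_empty cst_1)
  next
    case False
    define h where "h = height D"
    define f where "f i = rowlen D i - 1" for i
    define K where "K = {(i, j). j < f i}"
    have rD: "rows_le D h" using rows_le_height[OF D] by (simp add: h_def)
    have pos: "0 < rowlen D i \<longleftrightarrow> i < h" for i
      using mem_young_iff[OF D, of i 0] mem_young_iff[of "conjugate D" 0 i] D by (simp add: h_def height_def)
    have f0: "f i = 0" if "h \<le> i" for i using pos[of i] that by (simp add: f_def)
    have fSuc: "f (Suc i) \<le> f i" for i using rowlen_antimono[OF D, of i "Suc i"] by (simp add: f_def)
    note Y = young_of_rows[of h f, OF f0 fSuc]
    have K: "young K" "rowlen K = f" "rows_le K h" using Y by (simp_all add: K_def)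
    have Drow: "rowlen D i = rowlen K i + (if i < h then 1 else 0)" for i
      using pos[of i] by (cases "i < h") (auto simp: K(2) f_def)
    have h0: "0 < h"
    proof -
      obtain i j where "(i, j) \<in> D" using False by auto
      then have "0 < rowlen D i" using D by (simp add: mem_young_iff)
      then show ?thesis using pos[of i] by simp
    qed
    have cD: "card D = card K + h"
      unfolding card_young[OF D rD] card_young[OF K(1,3)] Drow by (simp add: sum_Suc)
    define A where "A = {E. young E \<and> vstrip K E \<and> card (E - K) = h}"
    have cE: "card E = card D" if "E \<in> A" for E
    proof -
      have "finite E" "K \<subseteq> E" "finite K" using that young_finite K(1) by (auto simp: A_def vstrip_def)
      then have "card (E - K) = card E - card K" "card K \<le> card E" by (auto simp: card_Diff_subset card_mono)
      moreover have "card (E - K) = h" using that by (simp add: A_def)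
      ultimately show ?thesis using cD by linarith
    qed
    have finA: "finite A"
    proof (rule finite_subset[OF _ finite_young_bounded[of "card D"]], rule subsetI)
      fix E assume "E \<in> A"
      then show "E \<in> {E. young E \<and> card E \<le> card D}" using cE[of E] by (simp add: A_def)
    qed
    have DA: "D \<in> A"
    proof -
      have v: "vstrip K D" using vstrip_rowlen[OF D K(1)] Drow by simp
      then have "card (D - K) = card D - card K"
        using K(1) young_finite by (intro card_Diff_subset) (auto simp: vstrip_def)
      then show ?thesis using v D cD by (simp add: A_def)
    qed
    \<comment> \<open>A vertical strip adds at most one box per row, so with at most h rows every
      row of \<open>E\<close> is at most that of \<open>D\<close>; equal weights then force
      equality.\<close>
    have higher: "h < height E" if E: "E \<in> A" "E \<noteq> D" for E
    proof (rule ccontr)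
      assume "\<not> h < height E"
      then have rE: "rows_le E h" using E by (simp add: rows_le_height A_def)
      have yE: "young E" and le: "rowlen E i \<le> Suc (rowlen K i)" for i
        using E vstrip_rowlen[of E K] K(1) by (auto simp: A_def)
      have le': "rowlen E i \<le> rowlen D i" if "i < h" for i using le[of i] Drow[of i] that by simp
      have "(\<Sum>i<h. rowlen E i) = (\<Sum>i<h. rowlen D i)"
        using cE[OF E(1)] by (simp add: card_young[OF yE rE] card_young[OF D rD])
      then have "rowlen E i = rowlen D i" if "i < h" for i
        using sum_mono_inv[of "rowlen E" "{..<h}" "rowlen D" i] le' that by simp
      then have "rowlen E i = rowlen D i" for i
        using rows_le_rowlen[OF yE rE, of i] rows_le_rowlen[OF D rD, of i] by (cases "i < h") auto
      then show False using young_eqI[OF yE D] E(2) by simp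
    qed
    have S: "esym h * schur K \<in> Sym" using K by (intro Sym_mult esym_in_Sym schur_in_Sym)
    have coeff: "schur_coeff (esym h * schur K) E = (if E \<in> A then 1 else 0)" if E: "young E" for E
    proof -
      have "{K'. vstrip K' E \<and> card (E - K') = h} \<subseteq> Pow E" by (auto simp: vstrip_def)
      then have fin: "finite {K'. vstrip K' E \<and> card (E - K') = h}" using E young_finite finite_subset by blast
      have "schur_coeff (esym h * schur K) E = (\<Sum>K' | vstrip K' E \<and> card (E - K') = h. if K = K' then 1 else 0)"
        unfolding Pieri_esym[OF schur_in_Sym[OF K(1)] E] by (simp add: schur_coeff_schur[OF K(1)])
      also have "\<dots> = (if E \<in> A then 1 else 0)" using fin E by (simp add: A_def)
      finally show ?thesis .
    qed
    have "esym h * schur K = (\<Sum>E\<in>A. schur E)"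
    proof (rule Sym_eqI[OF S])
      show "(\<Sum>E\<in>A. schur E) \<in> Sym" by (intro Sym_sum schur_in_Sym) (simp add: A_def)
      fix E assume E: "young E"
      have "schur_coeff (\<Sum>E\<in>A. schur E) E = (\<Sum>E'\<in>A. schur_coeff (schur E') E)"
        by (rule schur_coeff_sum) (simp add: A_def schur_in_Sym)
      also have "\<dots> = (\<Sum>E'\<in>A. if E' = E then 1 else 0)"
        by (rule sum.cong) (auto simp: A_def schur_coeff_schur)
      also have "\<dots> = (if E \<in> A then 1 else 0)" using finA by simp
      finally show "schur_coeff (esym h * schur K) E = schur_coeff (\<Sum>E\<in>A. schur E) E"
        using coeff[OF E] by simp
    qed
    then have "schur D = esym h * schur K + cst (- 1) * (\<Sum>E\<in>A - {D}. schur E)"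
      using DA finA by (simp add: sum.remove cst_minus cst_1)
    moreover have "schur K \<in> power_gen"
    proof (rule less.IH[OF _ K(1)])
      have "card K * card K + card K < (card K + 1) * (card K + 1)" by simp
      also have "\<dots> \<le> card D * card D" using h0 cD by (intro mult_le_mono) auto
      finally show "card K * card K + (card K - height K) < card D * card D + (card D - height D)" by linarith
    qed
    moreover have "schur E \<in> power_gen" if E: "E \<in> A - {D}" for E
    proof (rule less.IH)
      show "young E" using E by (simp add: A_def)
      then show "card E * card E + (card E - height E) < card D * card D + (card D - height D)"
        using higher[of E] cE[of E] hc[of E] E unfolding h_def by auto
    qed
    ultimately show ?thesis
      by (auto intro!: power_gen.add power_gen.mult power_gen.cst esym_power_gen power_gen_sum)
  qed
qed

theorem Sym_power_gen: "f \<in> Sym \<Longrightarrow> f \<in> power_gen"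
  by (subst schur_expansion)
     (auto intro!: power_gen_sum power_gen.mult power_gen.cst schur_power_gen dest: schur_coeff_support_young)

lemma Sym_power_induct [consumes 1, case_names cst power_sum add mult]:
  assumes "f \<in> Sym"
    and "\<And>q. P (cst q)" and "\<And>k. 1 \<le> k \<Longrightarrow> P (power_sum k)"
    and "\<And>f g. f \<in> Sym \<Longrightarrow> g \<in> Sym \<Longrightarrow> P f \<Longrightarrow> P g \<Longrightarrow> P (f + g)"
    and "\<And>f g. f \<in> Sym \<Longrightarrow> g \<in> Sym \<Longrightarrow> P f \<Longrightarrow> P g \<Longrightarrow> P (f * g)"
  shows "P f"
proof -
  have "f \<in> Sym \<and> P f"
    using Sym_power_gen[OF assms(1)]
    by (induction rule: power_gen.induct) (auto intro: assms cst_in_Sym power_sum_in_Sym Sym_add Sym_mult)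
  then show ?thesis by simp
qed

section \<open>The conjugation involution and the antipode\<close>

lemma conj_op_1: "conj_op 1 = 1"
  using conj_op_schur[OF young_empty] by (simp add: schur_empty conjugate_def)

lemma conj_op_cst: "conj_op (cst q) = cst q"
  using conj_op_linear(2)[OF Sym_1, of q] by (simp add: conj_op_1)

lemma conj_op_power_sum: "1 \<le> k \<Longrightarrow> conj_op (power_sum k) = cst ((- 1) ^ (k - 1)) * power_sum k"
  using conj_op_power_sum_times[OF Sym_1, of k] by (simp add: conj_op_1)

text \<open>For a power sum as first factor this comes from the Murnaghan-Nakayama rule. Keeping the
  second factor arbitrary lets the induction pass through products.\<close>

theorem conj_op_mult:
  assumes "f \<in> Sym" "g \<in> Sym"
  shows "conj_op (f * g) = conj_op f * conj_op g"
  using assms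
proof (induction f arbitrary: g rule: Sym_power_induct)
  case (cst q)
  then show ?case by (simp add: conj_op_linear conj_op_cst)
next
  case (power_sum k)
  then show ?case by (simp add: conj_op_power_sum_times conj_op_power_sum mult.assoc)
next
  case (add f1 f2)
  then show ?case by (simp add: distrib_right conj_op_linear Sym_mult)
next
  case (mult f1 f2)
  then show ?case by (simp add: mult.assoc Sym_mult)
qed

lemma conj_op_power: "f \<in> Sym \<Longrightarrow> conj_op (f ^ k) = conj_op f ^ k"
  by (induction k) (auto simp: conj_op_1 conj_op_mult Sym_power)

lemma conj_op_0: "conj_op 0 = 0"
  using conj_op_cst[of 0] by (simp add: cst_0)

lemma conj_op_sum: "(\<And>x. x \<in> A \<Longrightarrow> h x \<in> Sym) \<Longrightarrow> conj_op (sum h A) = (\<Sum>x\<in>A. conj_op (h x))"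
  by (induction A rule: infinite_finite_induct) (auto simp: conj_op_0 conj_op_linear Sym_sum)

text \<open>Newton's identities for \<open>esym\<close> and \<open>hsym\<close> differ exactly by
  the signs with which omega acts on power sums.\<close>

lemma conj_op_esym: "conj_op (esym k) = hsym k"
proof (induction k rule: less_induct)
  case (less k)
  show ?case
  proof (cases "k = 0")
    case True
    then show ?thesis by (simp add: esym_0 hsym_0 conj_op_1)
  next
    case False
    have "cst (of_nat k) * conj_op (esym k) = conj_op (cst (of_nat k) * esym k)"
      by (simp add: conj_op_linear esym_in_Sym)
    also have "\<dots> = (\<Sum>i = 1..k. conj_op (cst ((- 1) ^ (i - 1)) * (power_sum i * esym (k - i))))"
      unfolding Newton_esym by (intro conj_op_sum Sym_cst_times Sym_mult power_sum_in_Sym esym_in_Sym)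
    also have "\<dots> = (\<Sum>i = 1..k. power_sum i * hsym (k - i))"
    proof (rule sum.cong[OF refl])
      fix i assume i: "i \<in> {1..k}"
      have "conj_op (cst ((- 1) ^ (i - 1)) * (power_sum i * esym (k - i))) =
          cst ((- 1) ^ (i - 1)) * (cst ((- 1) ^ (i - 1)) * (power_sum i * hsym (k - i)))"
        using i less[of "k - i"]
        by (simp add: conj_op_linear Sym_mult power_sum_in_Sym esym_in_Sym conj_op_mult conj_op_power_sum mult.assoc)
      also have "\<dots> = cst ((- 1) ^ (i - 1) * (- 1) ^ (i - 1)) * (power_sum i * hsym (k - i))"
        by (simp only: mult.assoc[symmetric] cst_mult)
      also have "(- 1 :: rat) ^ (i - 1) * (- 1) ^ (i - 1) = 1"
        by (simp flip: power_mult_distrib)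
      finally show "conj_op (cst ((- 1) ^ (i - 1)) * (power_sum i * esym (k - i))) = power_sum i * hsym (k - i)"
        by (simp add: cst_1)
    qed
    also have "\<dots> = cst (of_nat k) * hsym k" by (rule Newton_hsym[symmetric])
    finally show ?thesis by (rule cst_cancel[rotated]) (use False in simp)
  qed
qed

text \<open>The image of \<open>Pieri_esym\<close> under conjugation, which exchanges vertical and
  horizontal strips.\<close>

theorem Pieri_hsym:
  assumes f: "f \<in> Sym" and D: "young D"
  shows "schur_coeff (hsym k * f) D = (\<Sum>K | hstrip K D \<and> card (D - K) = k. schur_coeff f K)"
proof -
  have "hsym k * f = conj_op (esym k * conj_op f)"
    by (simp add: conj_op_mult esym_in_Sym conj_op_in_Sym f conj_op_esym conj_op_conj_op)
  then have "schur_coeff (hsym k * f) D = schur_coeff (esym k * conj_op f) (conjugate D)"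
    by (simp add: schur_coeff_conj_op Sym_mult esym_in_Sym conj_op_in_Sym f)
  also have "\<dots> = (\<Sum>K | vstrip K (conjugate D) \<and> card (conjugate D - K) = k. schur_coeff f (conjugate K))"
    using D by (simp add: Pieri_esym conj_op_in_Sym f schur_coeff_conj_op)
  also have "\<dots> = (\<Sum>K | hstrip K D \<and> card (D - K) = k. schur_coeff f K)"
  proof (rule sum.reindex_bij_witness[where i = conjugate and j = conjugate])
    have card: "card (conjugate D - conjugate K) = card (D - K)" for K
    proof -
      have "conjugate D - conjugate K = conjugate (D - K)" by auto
      then show ?thesis by simp
    qed
    fix K assume "K \<in> {K. vstrip K (conjugate D) \<and> card (conjugate D - K) = k}"
    then show "conjugate K \<in> {K. hstrip K D \<and> card (D - K) = k}"
      using vstrip_conjugate[of "conjugate K" D] card[of "conjugate K"] by simp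
  next
    fix K assume "K \<in> {K. hstrip K D \<and> card (D - K) = k}"
    moreover have "conjugate D - conjugate K = conjugate (D - K)" by auto
    ultimately show "conjugate K \<in> {K. vstrip K (conjugate D) \<and> card (conjugate D - K) = k}"
      by (simp add: vstrip_conjugate)
  qed auto
  finally show ?thesis .
qed

lemma neg_in_Sym: "f \<in> Sym \<Longrightarrow> neg f \<in> Sym"
  unfolding Sym_def by (auto simp: mcoeff_neg)

lemma neg_power_sum: "neg (power_sum k) = cst ((- 1) ^ k) * power_sum k"
  by (rule pseries_eqI) (auto simp: mcoeff_neg mcoeff_cst_times power_sum_def)

text \<open>On the k-th power sum omega gives (-1)^(k-1) and the sign change gives (-1)^k, together
  -1. Since power sums generate, these values determine the homomorphism and resolve the definite
  description.\<close>

lemma antipode_eq_conj_op: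
  assumes f: "f \<in> Sym"
  shows "antipode f = conj_op (neg f)"
proof -
  define P where "P S \<longleftrightarrow> S \<in> Sym \<rightarrow>\<^sub>E Sym \<and> S 1 = 1 \<and>
     (\<forall>f\<in>Sym. \<forall>g\<in>Sym. S (f + g) = S f + S g \<and> S (f * g) = S f * S g) \<and>
     (\<forall>k\<ge>1. S (power_sum k) = - power_sum k)" for S
  define A where "A = restrict (\<lambda>f. conj_op (neg f)) Sym"
  have neg_ps: "conj_op (neg (power_sum k)) = - power_sum k" if "1 \<le> k" for k
  proof -
    have "conj_op (neg (power_sum k)) = cst ((- 1) ^ k * (- 1) ^ (k - 1)) * power_sum k"
      using that by (simp add: neg_power_sum conj_op_linear power_sum_in_Sym conj_op_power_sum cst_mult flip: mult.assoc)
    also have "(- 1 :: rat) ^ k * (- 1) ^ (k - 1) = - 1"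
      using that by (cases k) (simp_all flip: power_mult_distrib)
    finally show ?thesis by (simp add: cst_minus cst_1)
  qed
  have PA: "P A"
    unfolding P_def
  proof (intro conjI ballI allI impI)
    show "A \<in> Sym \<rightarrow>\<^sub>E Sym" by (auto simp: A_def conj_op_in_Sym neg_in_Sym)
    show "A 1 = 1" by (simp add: A_def Sym_1 conj_op_1)
  next
    fix f g assume "f \<in> Sym" "g \<in> Sym"
    then show "A (f + g) = A f + A g" "A (f * g) = A f * A g"
      by (simp_all add: A_def Sym_add Sym_mult neg.hom_add neg.hom_mult conj_op_linear conj_op_mult neg_in_Sym)
  next
    fix k :: nat assume "1 \<le> k"
    then show "A (power_sum k) = - power_sum k" by (simp add: A_def power_sum_in_Sym neg_ps)
  qed
  have unique: "S = A" if S: "P S" for S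
  proof -
    have S1: "S 1 = 1" and add: "\<And>f g. f \<in> Sym \<Longrightarrow> g \<in> Sym \<Longrightarrow> S (f + g) = S f + S g"
      and mult: "\<And>f g. f \<in> Sym \<Longrightarrow> g \<in> Sym \<Longrightarrow> S (f * g) = S f * S g"
      and ps: "\<And>k. 1 \<le> k \<Longrightarrow> S (power_sum k) = - power_sum k" and ext: "S \<in> extensional Sym"
      using S by (auto simp: P_def PiE_def)
    \<comment> \<open>The defining conditions do not mention scalars. Additivity, multiplicativity
      and \<open>S 1 = 1\<close> force rational constants to be fixed: first integers, then
      quotients.\<close>
    have cst_add: "cst (p + q) = (cst p + cst q :: nat pseries)" for p q
      by (rule pseries_eqI) (simp add: mcoeff_cst mcoeff_basic)
    have S0: "S 0 = 0" using add[OF Sym_0 Sym_0] by simp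
    have Snat: "S (cst (of_nat n)) = cst (of_nat n)" for n
    proof (induction n)
      case (Suc n)
      have "S (cst (1 + of_nat n)) = S (cst 1) + S (cst (of_nat n))"
        unfolding cst_add by (rule add[OF cst_in_Sym cst_in_Sym])
      then show ?case using Suc by (simp add: cst_add cst_1 S1)
    qed (simp add: cst_0 S0)
    have Sneg: "S (cst (- q)) = - S (cst q)" for q
      using add[OF cst_in_Sym cst_in_Sym, of q "- q"] cst_add[of q "- q"] by (simp add: cst_0 S0 eq_neg_iff_add_eq_0 add.commute)
    have Sint: "S (cst (of_int a)) = cst (of_int a)" for a
    proof (cases a rule: int_cases2)
      case (nonneg n)
      then show ?thesis using Snat[of n] by simp
    next
      case (nonpos n)
      then show ?thesis using Snat[of n] Sneg[of "of_nat n"] by (simp add: cst_minus)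
    qed
    have Scst: "S (cst q) = cst q" for q
    proof -
      obtain a b where q: "q = of_int a / of_int b" "0 < b" by (metis Fract_of_int_quotient quotient_of_unique)
      have "cst (of_int b) * S (cst q) = S (cst (of_int b) * cst q)"
        by (simp add: mult cst_in_Sym Sint)
      also have "cst (of_int b) * cst q = (cst (of_int a) :: nat pseries)" using q by (simp add: cst_mult)
      also have "S \<dots> = cst (of_int b) * cst q" using q by (simp add: Sint cst_mult)
      finally show ?thesis by (rule cst_cancel[rotated]) (use q in simp)
    qed
    have "S f = conj_op (neg f)" if "f \<in> Sym" for f
      using that
    proof (induction f rule: Sym_power_induct)
      case (cst q)
      then show ?case by (simp add: Scst neg_cst conj_op_cst)
    next
      case (power_sum k)
      then show ?case by (simp add: ps neg_ps)
    next
      case (add f g)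
      then show ?case by (simp add: \<open>\<And>f g. f \<in> Sym \<Longrightarrow> g \<in> Sym \<Longrightarrow> S (f + g) = S f + S g\<close> neg.hom_add conj_op_linear neg_in_Sym)
    next
      case (mult f g)
      then show ?case by (simp add: \<open>\<And>f g. f \<in> Sym \<Longrightarrow> g \<in> Sym \<Longrightarrow> S (f * g) = S f * S g\<close> neg.hom_mult conj_op_mult neg_in_Sym)
    qed
    then show ?thesis using ext by (auto simp: A_def fun_eq_iff extensional_def)
  qed
  have "antipode = (THE S. P S)" by (simp add: antipode_def P_def)
  also have "\<dots> = A" by (rule the_equality[where P = P, OF PA unique])
  finally have "antipode f = A f" by (rule fun_cong)
  also have "\<dots> = conj_op (neg f)" using f by (simp add: A_def)
  finally show ?thesis .
qed

section \<open>The total square\<close>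

lemma pm_cst: "pm \<sigma> (cst q) = cst q"
  by (rule pseries_eqI) (simp add: mcoeff_pm mcoeff_cst)

lemma pm_sqgen:
  assumes "bij \<sigma>"
  shows "pm \<sigma> (sqgen t (image_mset \<sigma> k)) = sqgen t k"
proof -
  interpret comm_ring_hom "pm \<sigma>" using assms by (rule pm_hom)
  have "pm \<sigma> (var (\<sigma> i)) = var i" for i
    using assms by (simp add: var_def pm_mon bij_is_inj)
  then show ?thesis by (induction k) (auto simp: sqgen_simps hom_distribs pm_cst)
qed

lemma pm_phi:
  assumes \<sigma>: "bij \<sigma>"
  shows "pm \<sigma> (phi t f) = phi t (pm \<sigma> f)"
proof (rule pseries_eqI)
  fix m
  have inv: "bij (inv_into UNIV \<sigma>)" using \<sigma> by (rule bij_imp_bij_inv)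
  have "mcoeff (pm \<sigma> (phi t f)) m = (\<Sum>k | k \<subseteq># image_mset \<sigma> m. mcoeff f k * mcoeff (sqgen t k) (image_mset \<sigma> m))"
    by (simp add: mcoeff_pm mcoeff_phi)
  also have "\<dots> = (\<Sum>k | k \<subseteq># m. mcoeff f (image_mset \<sigma> k) * mcoeff (sqgen t (image_mset \<sigma> k)) (image_mset \<sigma> m))"
    by (rule sum.reindex_bij_witness[where i = "image_mset \<sigma>" and j = "image_mset (inv_into UNIV \<sigma>)"])
       (auto simp: image_mset_bij_cancel[OF \<sigma>] image_mset_subseteq_mono
         dest: image_mset_subseteq_mono[where f = "inv_into UNIV \<sigma>"])
  also have "\<dots> = mcoeff (phi t (pm \<sigma> f)) m"
    using pm_sqgen[OF \<sigma>, of t] by (auto simp: mcoeff_phi mcoeff_pm intro!: sum.cong) (metis mcoeff_pm)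
  finally show "mcoeff (pm \<sigma> (phi t f)) m = mcoeff (phi t (pm \<sigma> f)) m" .
qed

lemma phi_in_Sym:
  assumes "f \<in> Sym"
  shows "phi t f \<in> Sym"
proof -
  obtain d where d: "deg_le d f" using Sym_deg[OF assms] by blast
  have "deg_le (2 * d) (phi t f)"
    unfolding deg_le_def
  proof (intro allI impI)
    fix m :: "nat multiset" assume m: "2 * d < size m"
    have "mcoeff f k * mcoeff (sqgen t k) m = 0" for k
    proof (rule ccontr)
      assume "mcoeff f k * mcoeff (sqgen t k) m \<noteq> 0"
      then have "size k \<le> d" "size m \<le> 2 * size k"
        using d sqgen_support[of t k m] by (auto simp: deg_le_def not_le[symmetric])
      then show False using m by linarith
    qed
    then show "mcoeff (phi t f) m = 0" unfolding mcoeff_phi by (intro sum.neutral ballI)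
  qed
  then show ?thesis using Sym_pm[OF assms] by (auto simp: Sym_iff pm_phi)
qed

lemma sqgen_replicate:
  "sqgen t (replicate_mset k i) = (\<Sum>j\<le>k. cst (of_nat (k choose j) * t ^ j) * mon (replicate_mset (k + j) i))"
proof -
  have "sqgen t (replicate_mset k i) = (cst t * (var i * var i) + var i) ^ k"
    by (induction k) (simp_all add: sqgen_simps add.commute)
  also have "\<dots> = (\<Sum>j\<le>k. of_nat (k choose j) * (cst t * (var i * var i)) ^ j * var i ^ (k - j))"
    by (rule binomial_ring)
  also have "\<dots> = (\<Sum>j\<le>k. cst (of_nat (k choose j) * t ^ j) * mon (replicate_mset (k + j) i))"
  proof (rule sum.cong[OF refl])
    fix j assume j: "j \<in> {..k}"
    have pw: "cst t ^ j = (cst (t ^ j) :: 'a pseries)"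
      by (induction j) (simp_all add: cst_1 cst_mult)
    have "var i ^ (2 * j) * var i ^ (k - j) = mon (replicate_mset (k + j) i)"
      using j by (simp add: add.commute flip: power_add var_power)
    moreover have "of_nat (k choose j) = (cst (of_nat (k choose j)) :: 'a pseries)"
      by (metis cst_of_int of_int_of_nat_eq)
    ultimately show "of_nat (k choose j) * (cst t * (var i * var i)) ^ j * var i ^ (k - j) =
        cst (of_nat (k choose j) * t ^ j) * mon (replicate_mset (k + j) i)"
      by (simp add: power_mult_distrib pw mult.assoc power_mult power2_eq_square flip: cst_mult)
  qed
  finally show ?thesis .
qed

lemma phi_power_sum:
  assumes k: "1 \<le> k"
  shows "phi t (power_sum k) = (\<Sum>j\<le>k. cst (of_nat (k choose j) * t ^ j) * power_sum (k + j))"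
proof (rule pseries_eqI)
  fix m :: "nat multiset"
  have sub: "{i. k \<le> count m i} \<subseteq> set_mset m" using k by (auto simp flip: count_greater_zero_iff)
  then have fin: "finite {i. k \<le> count m i}" by (rule finite_subset) simp
  have inj: "inj_on (\<lambda>i. replicate_mset k i) {i. k \<le> count m i}"
    using k by (auto simp: inj_on_def replicate_mset_eq_iff)
  have "mcoeff (phi t (power_sum k)) m =
      (\<Sum>a | a \<subseteq># m \<and> (\<exists>i. a = replicate_mset k i). mcoeff (sqgen t a) m)"
    unfolding mcoeff_phi
    by (subst sum.mono_neutral_right[where S = "{a. a \<subseteq># m \<and> (\<exists>i. a = replicate_mset k i)}"])
       (auto simp: power_sum_def finite_submultisets intro!: sum.cong)
  also have "{a. a \<subseteq># m \<and> (\<exists>i. a = replicate_mset k i)} = (\<lambda>i. replicate_mset k i) ` {i. k \<le> count m i}"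
    by (auto simp: count_le_replicate_mset_subset_eq)
  also have "(\<Sum>a\<in>\<dots>. mcoeff (sqgen t a) m) = (\<Sum>i | k \<le> count m i. mcoeff (sqgen t (replicate_mset k i)) m)"
    by (simp add: sum.reindex[OF inj])
  also have "\<dots> = (\<Sum>i | k \<le> count m i. \<Sum>j\<le>k. of_nat (k choose j) * t ^ j * (if m = replicate_mset (k + j) i then 1 else 0))"
    by (simp add: sqgen_replicate mcoeff_sum mcoeff_cst_times mcoeff_mon)
  also have "\<dots> = (\<Sum>j\<le>k. of_nat (k choose j) * t ^ j * (\<Sum>i | k \<le> count m i. if m = replicate_mset (k + j) i then 1 else 0))"
    by (subst sum.swap) (simp add: sum_distrib_left)
  also have "\<dots> = (\<Sum>j\<le>k. of_nat (k choose j) * t ^ j * mcoeff (power_sum (k + j)) m)"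
  proof (intro sum.cong refl arg_cong2[where f = "(*)"])
    fix j
    show "(\<Sum>i | k \<le> count m i. if m = replicate_mset (k + j) i then 1 else 0) = mcoeff (power_sum (k + j)) m"
    proof (cases "\<exists>i. m = replicate_mset (k + j) i")
      case True
      then obtain i where i: "m = replicate_mset (k + j) i" by blast
      have eq: "m = replicate_mset (k + j) i' \<longleftrightarrow> i' = i" for i'
        using k by (auto simp: i replicate_mset_eq_iff)
      have "mcoeff (power_sum (k + j)) m = 1" using True by (simp add: power_sum_def)
      moreover have "k \<le> count m i" by (simp add: i)
      ultimately show ?thesis using fin unfolding eq by simp
    next
      case False
      then show ?thesis by (simp add: power_sum_def)
    qed
  qed
  finally show "mcoeff (phi t (power_sum k)) m =
      mcoeff (\<Sum>j\<le>k. cst (of_nat (k choose j) * t ^ j) * power_sum (k + j)) m"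
    by (simp add: mcoeff_sum mcoeff_cst_times)
qed

text \<open>On p_k, \<open>phi t\<close> produces p_(k+j) with a factor t^j. Omega contributes
  (-1)^(k+j-1), which is its sign on p_k times (-1)^j, and the latter turns t into -t.\<close>

theorem conj_op_phi:
  assumes "f \<in> Sym"
  shows "conj_op (phi t f) = phi (- t) (conj_op f)"
  using assms
proof (induction f rule: Sym_power_induct)
  case (cst q)
  have "phi t (cst q) = (cst q :: nat pseries)" for t using phi_cst[of t q "1 :: nat pseries"] by simp
  then show ?case by (simp add: conj_op_cst)
next
  case (power_sum k)
  have "conj_op (phi t (power_sum k)) =
      (\<Sum>j\<le>k. cst (of_nat (k choose j) * t ^ j) * (cst ((- 1) ^ (k + j - 1)) * power_sum (k + j)))"
    using power_sum unfolding phi_power_sum[OF power_sum]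
    by (subst conj_op_sum) (auto intro!: Sym_cst_times sum.cong simp: power_sum_in_Sym conj_op_linear conj_op_power_sum)
  also have "\<dots> = (\<Sum>j\<le>k. cst ((- 1) ^ (k - 1)) * (cst (of_nat (k choose j) * (- t) ^ j) * power_sum (k + j)))"
  proof (rule sum.cong[OF refl])
    fix j
    have "k + j - 1 = (k - 1) + j" using power_sum by simp
    then have "of_nat (k choose j) * t ^ j * (- 1) ^ (k + j - 1) = (- 1) ^ (k - 1) * (of_nat (k choose j) * (- t) ^ j)"
      by (simp only: power_add) (simp add: power_minus[of t])
    then show "cst (of_nat (k choose j) * t ^ j) * (cst ((- 1) ^ (k + j - 1)) * power_sum (k + j)) =
        cst ((- 1) ^ (k - 1)) * (cst (of_nat (k choose j) * (- t) ^ j) * power_sum (k + j))"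
      by (simp only: mult.assoc[symmetric] cst_mult)
  qed
  also have "\<dots> = phi (- t) (conj_op (power_sum k))"
    using power_sum by (simp add: conj_op_power_sum phi_cst phi_power_sum sum_distrib_left)
  finally show ?case .
next
  case (add f g)
  then show ?case by (simp add: phi.hom_add conj_op_linear phi_in_Sym)
next
  case (mult f g)
  then show ?case by (simp add: phi.hom_mult conj_op_mult phi_in_Sym)
qed

section \<open>The operators \<open>SQ n\<close> as graded parts of the substitution\<close>

definition mfact :: "nat multiset \<Rightarrow> rat" where
  "mfact b = (\<Prod>i\<in>set_mset b. fact (count b i))"

lemma mfact_superset: "finite A \<Longrightarrow> set_mset b \<subseteq> A \<Longrightarrow> mfact b = (\<Prod>i\<in>A. fact (count b i))"
  unfolding mfact_def by (rule prod.mono_neutral_left) (auto simp: not_in_iff)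

lemma mfact_add_mset: "mfact (add_mset i b) = of_nat (Suc (count b i)) * mfact b"
proof -
  let ?A = "insert i (set_mset b)"
  have "mfact (add_mset i b) = (\<Prod>j\<in>?A. fact (count (add_mset i b) j))" by (rule mfact_superset) auto
  also have "\<dots> = fact (Suc (count b i)) * (\<Prod>j\<in>?A - {i}. fact (count b j))"
    by (subst prod.remove[of _ i]) auto
  also have "\<dots> = of_nat (Suc (count b i)) * (fact (count b i) * (\<Prod>j\<in>?A - {i}. fact (count b j)))"
    by (simp add: mult.assoc)
  also have "fact (count b i) * (\<Prod>j\<in>?A - {i}. fact (count b j)) = (\<Prod>j\<in>?A. fact (count b j))"
    by (subst (2) prod.remove[of _ i]) auto
  also have "\<dots> = mfact b" by (rule mfact_superset[symmetric]) auto
  finally show ?thesis .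
qed

lemma mfact_nonzero: "mfact b \<noteq> 0"
  by (simp add: mfact_def)

text \<open>The multinomial theorem for the terms x_i^2 d/dx_i, which commute under
  \<open>vee\<close>. In the induction step one variable of \<open>b\<close> is split off, and the
  multiplicities of all candidates add up to the size of \<open>b\<close>.\<close>

lemma vee_power_D1:
  "vee_power n D1 a b = (if size b = n \<and> a = b + b then fact n / mfact b else 0)"
proof (induction n arbitrary: a b)
  case 0
  then show ?case by (auto simp: vee_power_def id_op_def mfact_def)
next
  case (Suc n)
  define Q where "Q = vee_power n D1"
  have split_b: "(\<Sum>q\<in>splits b. D1 a1 (fst q) * Q a2 (snd q)) =
      (\<Sum>i\<in>set_mset b. if a1 = {#i, i#} then Q a2 (b - {#i#}) else 0)" for a1 a2
  proof -
    have "(\<Sum>q\<in>splits b. D1 a1 (fst q) * Q a2 (snd q)) =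
        (\<Sum>q\<in>(\<lambda>i. ({#i#}, b - {#i#})) ` set_mset b. D1 a1 (fst q) * Q a2 (snd q))"
    proof (rule sum.mono_neutral_right)
      show "(\<lambda>i. ({#i#}, b - {#i#})) ` set_mset b \<subseteq> splits b" by (auto simp: splits_def)
      show "\<forall>q\<in>splits b - (\<lambda>i. ({#i#}, b - {#i#})) ` set_mset b. D1 a1 (fst q) * Q a2 (snd q) = 0"
        by (auto simp: splits_def D1_def image_iff)
    qed simp
    also have "\<dots> = (\<Sum>i\<in>set_mset b. D1 a1 {#i#} * Q a2 (b - {#i#}))"
      by (subst sum.reindex) (auto simp: inj_on_def)
    also have "\<dots> = (\<Sum>i\<in>set_mset b. if a1 = {#i, i#} then Q a2 (b - {#i#}) else 0)"
      by (rule sum.cong) (auto simp: D1_def)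
    finally show ?thesis .
  qed
  have "vee_power (Suc n) D1 a b = vee D1 Q a b" by (simp add: vee_power_def Q_def)
  also have "\<dots> = (\<Sum>p\<in>splits a. \<Sum>i\<in>set_mset b. if fst p = {#i, i#} then Q (snd p) (b - {#i#}) else 0)"
    by (simp add: vee_def split_def split_b)
  also have "\<dots> = (\<Sum>i\<in>set_mset b. \<Sum>p\<in>splits a. if fst p = {#i, i#} then Q (snd p) (b - {#i#}) else 0)"
    by (rule sum.swap)
  also have "\<dots> = (\<Sum>i\<in>set_mset b. if size b = Suc n \<and> a = b + b then fact n * of_nat (count b i) / mfact b else 0)"
  proof (rule sum.cong[OF refl])
    fix i assume i: "i \<in># b"
    then obtain b' where b': "b = add_mset i b'" by (metis insert_DiffM)
    have "(\<Sum>p\<in>splits a. if fst p = {#i, i#} then Q (snd p) (b - {#i#}) else 0) =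
        (\<Sum>p\<in>splits a \<inter> {p. fst p = {#i, i#}}. Q (snd p) (b - {#i#}))"
      by (simp add: sum.inter_restrict)
    also have "splits a \<inter> {p. fst p = {#i, i#}} = (if {#i, i#} \<subseteq># a then {({#i, i#}, a - {#i, i#})} else {})"
      using subset_mset.add_diff_inverse[of "{#i, i#}" a] by (auto simp: splits_def)
    also have "(\<Sum>p\<in>\<dots>. Q (snd p) (b - {#i#})) =
        (if {#i, i#} \<subseteq># a \<and> size b' = n \<and> a - {#i, i#} = b' + b' then fact n / mfact b' else 0)"
      by (simp add: Q_def Suc.IH b')
    also have "{#i, i#} \<subseteq># a \<and> size b' = n \<and> a - {#i, i#} = b' + b' \<longleftrightarrow> size b = Suc n \<and> a = b + b"
    proof -
      have "{#i, i#} \<subseteq># a \<and> a - {#i, i#} = b' + b' \<longleftrightarrow> a = {#i, i#} + (b' + b')"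
        by (metis add_diff_cancel_left' mset_subset_eq_add_left subset_mset.add_diff_inverse)
      then show ?thesis by (auto simp: b')
    qed
    also have "fact n / mfact b' = fact n * of_nat (count b i) / mfact b"
    proof -
      have "of_nat (Suc (count b' i)) \<noteq> (0 :: rat)" by (simp only: of_nat_eq_0_iff)
      then show ?thesis
        by (simp add: b' mfact_add_mset del: of_nat_Suc)
    qed
    finally show "(\<Sum>p\<in>splits a. if fst p = {#i, i#} then Q (snd p) (b - {#i#}) else 0) =
        (if size b = Suc n \<and> a = b + b then fact n * of_nat (count b i) / mfact b else 0)" .
  qed
  also have "\<dots> = (if size b = Suc n \<and> a = b + b then fact (Suc n) / mfact b else 0)"
  proof (cases "size b = Suc n \<and> a = b + b")
    case True
    have "(\<Sum>i\<in>set_mset b. fact n * of_nat (count b i) / mfact b) = fact n * of_nat (size b) / mfact b"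
      by (simp add: size_multiset_overloaded_eq sum_distrib_left sum_divide_distrib)
    then show ?thesis using True by (simp add: algebra_simps)
  qed auto
  finally show ?case .
qed

text \<open>Each use of a square term raises the degree by 1 and contributes one factor t.\<close>

lemma mcoeff_sqgen_power: "mcoeff (sqgen t k) m = t ^ (size m - size k) * mcoeff (sqgen 1 k) m"
proof (induction k arbitrary: m)
  case empty
  then show ?case by (simp add: sqgen_simps mcoeff_basic)
next
  case (add i k)
  have 1: "(if i \<in># m then mcoeff (sqgen t k) (m - {#i#}) else 0) =
      t ^ (size m - size (add_mset i k)) * (if i \<in># m then mcoeff (sqgen 1 k) (m - {#i#}) else 0)"
    using add[of "m - {#i#}"] by (simp add: size_Diff_singleton)
  have 2: "(if {#i, i#} \<subseteq># m then t * mcoeff (sqgen t k) (m - {#i, i#}) else 0) =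
      t ^ (size m - size (add_mset i k)) * (if {#i, i#} \<subseteq># m then mcoeff (sqgen 1 k) (m - {#i, i#}) else 0)"
  proof (cases "{#i, i#} \<subseteq># m \<and> mcoeff (sqgen 1 k) (m - {#i, i#}) \<noteq> 0")
    case True
    then have "size k \<le> size (m - {#i, i#})" "size (m - {#i, i#}) + 2 = size m"
      using sqgen_support[of 1 k "m - {#i, i#}"] size_mset_mono[of "{#i, i#}" m] size_mset_mono[of k "m - {#i, i#}"]
      by (auto simp: size_Diff_submset)
    then have "Suc (size (m - {#i, i#}) - size k) = size m - size (add_mset i k)" by simp
    then show ?thesis using True add[of "m - {#i, i#}"] by (simp flip: power_Suc mult.assoc)
  next
    case False
    then show ?thesis using add[of "m - {#i, i#}"] by auto
  qed
  show ?case unfolding mcoeff_sqgen_add_mset 1 2 by (simp add: distrib_left)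
qed

text \<open>Pascal's rule in one variable. \<open>A\<close> is fixed beforehand so that the range of
  the product stays the same during the induction; the condition guards against truncated
  subtraction, where the binomial coefficient would be 1.\<close>

lemma mcoeff_sqgen_binomial:
  assumes "finite A"
  shows "set_mset k \<union> set_mset m \<subseteq> A \<Longrightarrow> mcoeff (sqgen 1 k) m =
    (\<Prod>i\<in>A. if count k i \<le> count m i then of_nat (count k i choose (count m i - count k i)) else 0)"
proof (induction k arbitrary: m)
  case empty
  show ?case
  proof (cases "m = {#}")
    case False
    then obtain i where "i \<in># m" by (meson multiset_nonemptyE)
    then have "i \<in> A" "count m i > 0" using empty by auto
    then have "\<exists>i\<in>A. of_nat (0 choose count m i) = (0 :: rat)" by (intro bexI[of _ i]) auto
    then show ?thesis using assms False by (simp add: sqgen_simps mcoeff_basic)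
  qed (simp add: sqgen_simps mcoeff_basic)
next
  case (add i k)
  define g where "g c d = (if c \<le> d then of_nat (c choose (d - c)) else 0 :: rat)" for c d
  have iA: "i \<in> A" and sub: "set_mset k \<union> set_mset m \<subseteq> A" using add.prems by auto
  define R where "R = (\<Prod>j\<in>A - {i}. g (count k j) (count m j))"
  have IH: "mcoeff (sqgen 1 k) m' = g (count k i) (count m' i) * (\<Prod>j\<in>A - {i}. g (count k j) (count m' j))"
    if "set_mset m' \<subseteq> set_mset m" for m'
    using add.IH[of m'] that sub assms iA by (auto simp: g_def prod.remove[of A i])
  have t1: "mcoeff (sqgen 1 k) (m - {#i#}) = g (count k i) (count m i - 1) * R"
  proof -
    have "(\<Prod>j\<in>A - {i}. g (count k j) (count (m - {#i#}) j)) = R"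
      unfolding R_def by (rule prod.cong) auto
    then show ?thesis by (subst IH) (auto dest: in_diffD)
  qed
  have t2: "mcoeff (sqgen 1 k) (m - {#i, i#}) = g (count k i) (count m i - 2) * R"
  proof -
    have "(\<Prod>j\<in>A - {i}. g (count k j) (count (m - {#i, i#}) j)) = R"
      unfolding R_def by (rule prod.cong) auto
    then show ?thesis by (subst IH) (auto dest: in_diffD simp: numeral_2_eq_2)
  qed
  have sub2: "{#i, i#} \<subseteq># m \<longleftrightarrow> 2 \<le> count m i"
    using count_le_replicate_mset_subset_eq[of 2 m i] by (simp add: numeral_2_eq_2)
  have mem: "i \<in># m \<longleftrightarrow> 1 \<le> count m i" by (simp add: Suc_le_eq)
  have pascal: "(if 1 \<le> d then g c (d - 1) else 0) + (if 2 \<le> d then g c (d - 2) else 0) = g (Suc c) d" for c d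
  proof (cases "Suc c < d")
    case True
    then obtain e where "d = Suc (Suc (c + e))" by (metis add_Suc less_iff_Suc_add)
    then show ?thesis by (simp add: g_def)
  next
    case False
    then consider "d = Suc c" | "d < Suc c" by linarith
    then show ?thesis by cases (auto simp: g_def)
  qed
  have "mcoeff (sqgen 1 (add_mset i k)) m = ((if 1 \<le> count m i then g (count k i) (count m i - 1) else 0) +
      (if 2 \<le> count m i then g (count k i) (count m i - 2) else 0)) * R"
    unfolding mcoeff_sqgen_add_mset t1 t2 sub2 mem by (simp add: distrib_right)
  also have "\<dots> = g (count (add_mset i k) i) (count m i) * (\<Prod>j\<in>A - {i}. g (count (add_mset i k) j) (count m j))"
  proof -
    have "R = (\<Prod>j\<in>A - {i}. g (count (add_mset i k) j) (count m j))"
      unfolding R_def by (rule prod.cong) auto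
    then show ?thesis unfolding pascal by simp
  qed
  also have "\<dots> = (\<Prod>j\<in>A. g (count (add_mset i k) j) (count m j))"
    using prod.remove[OF assms iA, of "\<lambda>j. g (count (add_mset i k) j) (count m j)"] by simp
  finally show ?case unfolding g_def .
qed

text \<open>Applied to x^k, the operator x^(2b) d^b / b! gives x^(k+b) times the product of the
  binomial coefficients of k_i over b_i, which is the coefficient of x^(k+b) in prod (x_i +
  x_i^2)^(k_i). At a fixed monomial m = k + b, choosing \<open>b\<close> amounts to choosing the
  divisor k = m - b.\<close>

lemma mcoeff_SQ:
  "mcoeff (SQ n f) m = (\<Sum>k | k \<subseteq># m \<and> size m - size k = n. mcoeff f k * mcoeff (sqgen 1 k) m)"
proof -
  define P where "P a b = vee_power n D1 a b / fact n" for a b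
  have P: "P a b = (if size b = n \<and> a = b + b then 1 / mfact b else 0)" for a b
    by (simp add: P_def vee_power_D1)
  define B where "B = {b. b + b \<subseteq># m \<and> size b = n}"
  have "B \<subseteq> {b. b \<subseteq># m}" using add_subseteq_msetD by (auto simp: B_def)
  have fin: "finite {k. k \<subseteq># m \<and> size m - size k = n}"
    using finite_submultisets[of m] by (rule finite_subset[rotated]) auto
  have "{(a, b). a \<subseteq># m \<and> P a b \<noteq> 0} = (\<lambda>b. (b + b, b)) ` B"
    by (auto simp: P B_def mfact_nonzero)
  then have "mcoeff (SQ n f) m = (\<Sum>b\<in>B. P (b + b) b * mcoeff (partial_deriv b f) (m - (b + b)))"
    unfolding SQ_def apply_op_def mcoeff_Abs P_def[symmetric]
    by (simp add: sum.reindex inj_on_def)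
  also have "\<dots> = (\<Sum>k | k \<subseteq># m \<and> size m - size k = n \<and> m - k \<subseteq># k. mcoeff f k * mcoeff (sqgen 1 k) m)"
  proof (rule sum.reindex_bij_witness[where i = "\<lambda>k. m - k" and j = "\<lambda>b. m - b"])
    fix b assume "b \<in> B"
    then have b: "b + b \<subseteq># m" "size b = n" by (auto simp: B_def)
    define k where "k = m - b"
    have bm: "b \<subseteq># m" using add_subseteq_msetD[OF b(1)] by simp
    have cnt: "count m i = count k i + count b i" "count b i \<le> count k i" for i
      using mset_subset_eq_count[OF b(1), of i] by (auto simp: k_def)
    show "m - (m - b) = b" using bm by (auto intro: multiset_eqI simp: mset_subset_eq_count)
    show "m - b \<in> {k. k \<subseteq># m \<and> size m - size k = n \<and> m - k \<subseteq># k}"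
    proof -
      have "size m - size (m - b) = n"
        using b(2) size_mset_mono[OF bm] by (simp add: size_Diff_submset[OF bm])
      moreover have "b \<subseteq># m - b" using cnt(2) by (simp add: subseteq_mset_def k_def)
      ultimately show ?thesis using \<open>m - (m - b) = b\<close> by simp
    qed
    define A where "A = set_mset m"
    have A: "finite A" "set_mset b \<subseteq> A" "set_mset k \<union> set_mset m \<subseteq> A"
      using set_mset_mono[OF bm] by (auto simp: A_def k_def dest: in_diffD)
    have "mcoeff (sqgen 1 k) m = (\<Prod>i\<in>A. of_nat (count k i choose count b i))"
      using mcoeff_sqgen_binomial[OF A(1,3)] by (simp add: cnt(1))
    also have "\<dots> = (\<Prod>i\<in>A. (fact (count k i) / fact (count k i - count b i)) / fact (count b i))"
      using cnt(2) by (intro prod.cong) (simp_all add: binomial_fact mult.commute)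
    also have "\<dots> = (\<Prod>i\<in>A. fact (count k i) / fact (count k i - count b i)) / mfact b"
      using mfact_superset[OF A(1,2)] by (simp add: prod_dividef prod.distrib)
    also have "(\<Prod>i\<in>A. fact (count k i) / fact (count k i - count b i)) =
        (\<Prod>i\<in>set_mset b. fact (count k i) / fact (count k i - count b i) :: rat)"
      using A by (intro prod.mono_neutral_right) (auto simp: not_in_iff)
    finally have sq: "mcoeff (sqgen 1 k) m =
        (\<Prod>i\<in>set_mset b. fact (count k i) / fact (count k i - count b i)) / mfact b" .
    have "m - (b + b) + b = k"
    proof (rule multiset_eqI)
      fix x
      show "count (m - (b + b) + b) x = count k x" using cnt(2)[of x] by (simp add: k_def)
    qed
    moreover have "count (m - (b + b)) i = count k i - count b i" for i by (simp add: k_def)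
    ultimately have "mcoeff (partial_deriv b f) (m - (b + b)) =
        (\<Prod>i\<in>set_mset b. fact (count k i) / fact (count k i - count b i)) * mcoeff f k"
      by (simp add: partial_deriv_def cnt(2))
    then show "mcoeff f (m - b) * mcoeff (sqgen 1 (m - b)) m = P (b + b) b * mcoeff (partial_deriv b f) (m - (b + b))"
      using b(2) by (simp add: P sq flip: k_def)
  next
    fix k assume "k \<in> {k. k \<subseteq># m \<and> size m - size k = n \<and> m - k \<subseteq># k}"
    then have k: "k \<subseteq># m" "size m - size k = n" "m - k \<subseteq># k" by auto
    show "m - (m - k) = k" using k(1) by (auto intro: multiset_eqI simp: mset_subset_eq_count)
    have "(m - k) + (m - k) \<subseteq># (m - k) + k" using k(3) by simp
    then show "m - k \<in> B" using k by (simp add: B_def size_Diff_submset subset_mset.diff_add)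
  qed
  also have "\<dots> = (\<Sum>k | k \<subseteq># m \<and> size m - size k = n. mcoeff f k * mcoeff (sqgen 1 k) m)"
  proof (intro sum.mono_neutral_left fin ballI)
    \<comment> \<open>Here some variable would be squared more often than it occurs in
      \<open>k\<close>, so its binomial coefficient is 0.\<close>
    fix k assume "k \<in> {k. k \<subseteq># m \<and> size m - size k = n} - {k. k \<subseteq># m \<and> size m - size k = n \<and> m - k \<subseteq># k}"
    then have k: "k \<subseteq># m" "\<not> m - k \<subseteq># k" by auto
    then obtain i where i: "count k i < count m i - count k i" by (auto simp: subseteq_mset_def not_le)
    then have "i \<in># m" by (metis count_eq_zero_iff diff_0_eq_0 not_less_zero)
    have "(if count k i \<le> count m i then of_nat (count k i choose (count m i - count k i)) else 0) = (0 :: rat)"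
      using i by simp
    then have "(\<Prod>i\<in>set_mset m. if count k i \<le> count m i
        then of_nat (count k i choose (count m i - count k i)) else 0) = (0 :: rat)"
      using \<open>i \<in># m\<close> by (intro prod_zero bexI[of _ i]) auto
    then have "mcoeff (sqgen 1 k) m = 0"
      using mcoeff_sqgen_binomial[of "set_mset m" k m] set_mset_mono[OF k(1)] by simp
    then show "mcoeff f k * mcoeff (sqgen 1 k) m = 0" by simp
  qed auto
  finally show ?thesis .
qed

text \<open>The substitution raises the degree of a monomial of degree at most d by at most d, so
  stopping at \<open>SQ d\<close> loses nothing. With d the weight of \<pi> this is the index in the
  theorem.\<close>

lemma SQ_alt_eq_phi:
  assumes "deg_le d f"
  shows "SQ_alt d f = phi (- 1) f"
proof (rule pseries_eqI)
  fix m
  have "mcoeff (SQ_alt d f) m = (\<Sum>i\<le>d. (- 1) ^ i * (\<Sum>k | k \<subseteq># m \<and> size m - size k = i. mcoeff f k * mcoeff (sqgen 1 k) m))"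
    by (simp add: SQ_alt_def mcoeff_sum mcoeff_minus_one_power mcoeff_SQ)
  also have "\<dots> = (\<Sum>i\<le>d. \<Sum>k | k \<in> {k. k \<subseteq># m \<and> size m - size k \<le> d} \<and> size m - size k = i. mcoeff f k * mcoeff (sqgen (- 1) k) m)"
    by (auto simp: sum_distrib_left mcoeff_sqgen_power[of "- 1"] intro!: sum.cong arg_cong[where f = "sum _"])
  also have "\<dots> = (\<Sum>k | k \<subseteq># m \<and> size m - size k \<le> d. mcoeff f k * mcoeff (sqgen (- 1) k) m)"
    by (rule sum.group) (auto intro: finite_subset[OF _ finite_submultisets[of m]])
  also have "\<dots> = mcoeff (phi (- 1) f) m"
    unfolding mcoeff_phi
  proof (intro sum.mono_neutral_left finite_submultisets ballI)
    fix k assume "k \<in> {k. k \<subseteq># m} - {k. k \<subseteq># m \<and> size m - size k \<le> d}"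
    then have "d < size m - size k" by auto
    then have "d < size k \<or> 2 * size k < size m" by linarith
    then show "mcoeff f k * mcoeff (sqgen (- 1) k) m = 0"
      using assms sqgen_support[of "- 1" k m] by (auto simp: deg_le_def)
  qed auto
  finally show "mcoeff (SQ_alt d f) m = mcoeff (phi (- 1) f) m" .
qed

lemma SQ_schur:
  assumes D: "young D"
  shows "SQ n (schur D) \<in> Sym"
    "size m = card D + n \<Longrightarrow> mcoeff (SQ n (schur D)) m = mcoeff (phi 1 (schur D)) m"
proof -
  have c: "mcoeff (SQ n (schur D)) m = (if size m = card D + n then mcoeff (phi 1 (schur D)) m else 0)" for m
  proof -
    have "mcoeff (SQ n (schur D)) m = (\<Sum>k | k \<subseteq># m. if size m - size k = n then mcoeff (schur D) k * mcoeff (sqgen 1 k) m else 0)"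
      unfolding mcoeff_SQ using finite_submultisets[of m] by (simp add: sum.inter_filter[symmetric] Collect_conj_eq[symmetric])
    also have "\<dots> = (\<Sum>k | k \<subseteq># m. if size m = card D + n then mcoeff (schur D) k * mcoeff (sqgen 1 k) m else 0)"
    proof (rule sum.cong[OF refl])
      fix k assume "k \<in> {k. k \<subseteq># m}"
      then have "size k \<le> size m" by (simp add: size_mset_mono)
      then show "(if size m - size k = n then mcoeff (schur D) k * mcoeff (sqgen 1 k) m else 0) =
          (if size m = card D + n then mcoeff (schur D) k * mcoeff (sqgen 1 k) m else 0)"
        using mcoeff_schur_size[of k D] by (cases "size k = card D") auto
    qed
    also have "\<dots> = (if size m = card D + n then mcoeff (phi 1 (schur D)) m else 0)"
      by (simp add: mcoeff_phi)
    finally show ?thesis .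
  qed
  then show "size m = card D + n \<Longrightarrow> mcoeff (SQ n (schur D)) m = mcoeff (phi 1 (schur D)) m" by simp
  have "phi 1 (schur D) \<in> Sym" using D by (intro phi_in_Sym schur_in_Sym)
  then show "SQ n (schur D) \<in> Sym"
    by (auto simp: Sym_def c)
qed

lemma sq_coeff_phi:
  assumes "young lam" "young mu" "lam \<subseteq> mu"
  shows "sq_coeff lam mu = schur_coeff (phi 1 (schur lam)) mu"
  unfolding sq_coeff_def
proof (rule schur_coeff_cong_size)
  have "card lam \<le> card mu" using assms by (intro card_mono young_finite)
  then show "mcoeff (SQ (card mu - card lam) (schur lam)) m = mcoeff (phi 1 (schur lam)) m" if "size m = card mu" for m
    using that by (intro SQ_schur assms) simp
qed (use assms in \<open>auto intro: SQ_schur phi_in_Sym schur_in_Sym\<close>)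

section \<open>Principal specialisation and skewing\<close>

text \<open>A range of summation for \<open>eval_ones\<close> that depends only on a degree bound;
  the support used in its definition varies with the function and would obstruct linearity.\<close>

definition msets_le :: "nat \<Rightarrow> nat \<Rightarrow> nat multiset set" where
  "msets_le c d = {m. set_mset m \<subseteq> {..<c} \<and> size m \<le> d}"

lemma finite_msets_le: "finite (msets_le c d)"
proof (rule finite_surj)
  show "finite {xs :: nat list. set xs \<subseteq> {..<c} \<and> length xs \<le> d}" by (rule finite_lists_length_le) simp
  show "msets_le c d \<subseteq> mset ` {xs. set xs \<subseteq> {..<c} \<and> length xs \<le> d}"
  proof
    fix m assume m: "m \<in> msets_le c d"
    obtain xs where "mset xs = m" using ex_mset by blast
    then show "m \<in> mset ` {xs. set xs \<subseteq> {..<c} \<and> length xs \<le> d}"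
      using m by (intro image_eqI[of _ _ xs]) (auto simp: msets_le_def)
  qed
qed

lemma eval_ones_eq:
  assumes "deg_le d f"
  shows "eval_ones c f = (\<Sum>m\<in>msets_le c d. mcoeff f m)"
  unfolding eval_ones_def
  using assms finite_msets_le by (intro sum.mono_neutral_left) (auto simp: msets_le_def deg_le_def not_le[symmetric])

lemma eval_ones_cst_times: "eval_ones c (cst q * f) = q * eval_ones c f"
proof (cases "q = 0")
  case False
  then show ?thesis by (simp add: eval_ones_def mcoeff_cst_times sum_distrib_left)
qed (simp add: eval_ones_def mcoeff_cst_times)

lemma eval_ones_sum:
  assumes "finite A" "\<And>x. x \<in> A \<Longrightarrow> h x \<in> Sym"
  shows "eval_ones c (sum h A) = (\<Sum>x\<in>A. eval_ones c (h x))"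
proof -
  have "\<exists>d. \<forall>x\<in>A. deg_le d (h x)"
    using assms
  proof (induction A rule: finite_induct)
    case (insert x A)
    then obtain d e where "\<forall>x\<in>A. deg_le d (h x)" "deg_le e (h x)" using Sym_deg by blast
    then have "\<forall>y\<in>insert x A. deg_le (max d e) (h y)" by (auto intro: deg_le_mono)
    then show ?case by blast
  qed simp
  then obtain d where d: "\<And>x. x \<in> A \<Longrightarrow> deg_le d (h x)" by blast
  then show ?thesis
    by (simp add: eval_ones_eq[OF deg_le_sum[OF d]] eval_ones_eq[OF d] mcoeff_sum sum.swap[of _ A])
qed

lemma eval_ones_branching:
  assumes D: "young D"
  shows "eval_ones (Suc c) (schur D) = (\<Sum>K | hstrip K D. eval_ones c (schur K))"
proof -
  define d where "d = card D"
  have inner: "(\<Sum>m\<in>msets_le (Suc c) d. mcoeff (var c ^ card (D - K) * tr {..<c} (schur K)) m) = eval_ones c (schur K)"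
    if K: "hstrip K D" for K
  proof -
    define k where "k = card (D - K)"
    define g where "g = tr {..<c} (schur K)"
    \<comment> \<open>Multiplication by the k-th power of the last variable; all nonzero terms of
      the product lie in its image.\<close>
    define r where "r m = replicate_mset k c + m" for m
    have "card (D - K) = card D - card K" "card K \<le> card D"
      using K young_finite[OF D] finite_subset by (auto simp: hstrip_def intro!: card_Diff_subset card_mono)
    then have kd: "k + card K = d" by (simp add: k_def d_def)
    have "(\<Sum>m\<in>msets_le (Suc c) d. mcoeff (var c ^ k * g) m) = (\<Sum>m\<in>r ` msets_le c (card K). mcoeff (var c ^ k * g) m)"
    proof (intro sum.mono_neutral_right finite_msets_le ballI)
      show "r ` msets_le c (card K) \<subseteq> msets_le (Suc c) d"
        using kd by (force simp: r_def msets_le_def split: if_splits intro: less_SucI)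
      fix m assume m: "m \<in> msets_le (Suc c) d - r ` msets_le c (card K)"
      show "mcoeff (var c ^ k * g) m = 0"
      proof (rule ccontr)
        assume "mcoeff (var c ^ k * g) m \<noteq> 0"
        then have sub: "replicate_mset k c \<subseteq># m" and nz: "mcoeff g (m - replicate_mset k c) \<noteq> 0"
          by (auto simp: var_power mcoeff_mon_times split: if_splits)
        then have "m - replicate_mset k c \<in> msets_le c (card K)"
          using deg_le_schur[of K] by (auto simp: g_def mcoeff_tr msets_le_def deg_le_def not_le[symmetric] split: if_splits)
        moreover have "m = r (m - replicate_mset k c)" using sub by (simp add: r_def)
        ultimately show False using m by blast
      qed
    qed
    also have "\<dots> = (\<Sum>m\<in>msets_le c (card K). mcoeff g m)"
      by (subst sum.reindex) (auto simp: inj_on_def r_def var_power mcoeff_mon_times)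
    also have "\<dots> = eval_ones c (schur K)"
      unfolding eval_ones_eq[OF deg_le_schur] by (rule sum.cong) (auto simp: g_def mcoeff_tr msets_le_def)
    finally show ?thesis by (simp add: k_def g_def)
  qed
  have "eval_ones (Suc c) (schur D) = (\<Sum>m\<in>msets_le (Suc c) d. mcoeff (tr {..<Suc c} (schur D)) m)"
    unfolding eval_ones_eq[OF deg_le_schur] d_def by (rule sum.cong) (auto simp: mcoeff_tr msets_le_def)
  also have "\<dots> = (\<Sum>K | hstrip K D. \<Sum>m\<in>msets_le (Suc c) d. mcoeff (var c ^ card (D - K) * tr {..<c} (schur K)) m)"
    unfolding tr_schur_branching[OF D] mcoeff_sum by (rule sum.swap)
  also have "\<dots> = (\<Sum>K | hstrip K D. eval_ones c (schur K))"
    by (rule sum.cong) (auto simp: inner)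
  finally show ?thesis .
qed

text \<open>Truncations of prod (1 + x_i) and, in \<open>hsyms\<close>, of prod 1/(1 - x_i). Members
  of \<open>Sym\<close> have bounded degree, so \<open>schur_coeff\<close> cannot be used on the
  full products.\<close>

definition esyms :: "nat \<Rightarrow> nat pseries" where
  "esyms d = (\<Sum>k\<le>d. esym k)"

definition hsyms :: "nat \<Rightarrow> nat pseries" where
  "hsyms d = (\<Sum>k\<le>d. hsym k)"

lemma hsyms_in_Sym: "hsyms d \<in> Sym" and esyms_in_Sym: "esyms d \<in> Sym"
  by (auto simp: hsyms_def esyms_def intro!: Sym_sum hsym_in_Sym esym_in_Sym)

text \<open>By the Pieri rule the coefficient counts chains of c horizontal strips from the empty
  diagram to \<open>D\<close>. Peeling off largest entries shows that the evaluation at c ones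
  counts the same chains. The bound on the weight keeps every strip within the truncation.\<close>

lemma schur_coeff_hsyms_power:
  "young D \<Longrightarrow> card D \<le> d \<Longrightarrow> schur_coeff (hsyms d ^ c) D = eval_ones c (schur D)"
proof (induction c arbitrary: D)
  case 0
  have "{m. set_mset m \<subseteq> {..<0} \<and> mcoeff (schur D) m \<noteq> 0} = (if D = {} then {{#}} else {})"
    using mcoeff_schur_size[of "{#}" D] young_finite[OF 0(1)]
    by (auto simp: schur_empty mcoeff_basic)
  then have "eval_ones 0 (schur D) = (if D = {} then 1 else 0)"
    by (simp add: eval_ones_def schur_empty mcoeff_basic)
  then show ?case using schur_coeff_schur[OF young_empty, of D] by (auto simp: schur_empty)
next
  case (Suc c)
  have fin: "finite {K. hstrip K D}" by (rule finite_hstrip) fact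
  have S: "hsyms d ^ c \<in> Sym" by (intro Sym_power hsyms_in_Sym)
  have cD: "card (D - K) \<le> d" for K
    using card_mono[of D "D - K"] young_finite[OF Suc.prems(1)] Suc.prems(2) by auto
  have cK: "card K \<le> d" if "hstrip K D" for K
    using card_mono[of D K] young_finite[OF Suc.prems(1)] Suc.prems(2) that by (auto simp: hstrip_def)
  have "schur_coeff (hsyms d ^ Suc c) D = schur_coeff (\<Sum>k\<le>d. hsym k * hsyms d ^ c) D"
    by (simp add: hsyms_def sum_distrib_right)
  also have "\<dots> = (\<Sum>k\<le>d. \<Sum>K | K \<in> {K. hstrip K D} \<and> card (D - K) = k. schur_coeff (hsyms d ^ c) K)"
    by (subst schur_coeff_sum) (auto intro: Sym_mult S hsym_in_Sym simp: Pieri_hsym[OF S Suc.prems(1)])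
  also have "\<dots> = (\<Sum>K | hstrip K D. schur_coeff (hsyms d ^ c) K)"
    by (rule sum.group) (use fin cD in auto)
  also have "\<dots> = (\<Sum>K | hstrip K D. eval_ones c (schur K))"
    by (rule sum.cong) (auto simp: Suc.IH cK hstrip_def)
  also have "\<dots> = eval_ones (Suc c) (schur D)"
    by (rule eval_ones_branching[symmetric]) fact
  finally show ?case .
qed

section \<open>Skewing and its specialisation\<close>

definition youngs_le :: "nat \<Rightarrow> (nat \<times> nat) set set" where
  "youngs_le d = {D. young D \<and> card D \<le> d}"

text \<open>\<open>f * schur D\<close> has no terms of degree below the weight of \<open>D\<close>,
  so diagrams heavier than \<open>R\<close> do not contribute.\<close>

lemma schur_coeff_mult_expand:
  assumes f: "f \<in> Sym" and g: "g \<in> Sym"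
  shows "schur_coeff (f * g) R = (\<Sum>D\<in>youngs_le (card R). schur_coeff g D * schur_coeff (f * schur D) R)"
    and "\<And>D. young D \<Longrightarrow> card R < card D \<Longrightarrow> schur_coeff (f * schur D) R = 0"
proof -
  have fs: "f * schur D \<in> Sym" if "young D" for D using f that by (intro Sym_mult schur_in_Sym)
  show low: "schur_coeff (f * schur D) R = 0" if "young D" "card R < card D" for D
  proof (rule schur_coeff_eq_0[OF fs[OF that(1)]])
    fix m :: "nat multiset" assume "size m = card R"
    then show "mcoeff (f * schur D) m = 0"
      using that by (intro mcoeff_times_order[of 0 _ "card D"]) (auto intro: mcoeff_schur_size)
  qed
  define G where "G = {D. schur_coeff g D \<noteq> 0}"
  have fin: "finite G" "finite (youngs_le (card R))"
    using finite_schur_coeff[OF g] finite_young_bounded by (auto simp: G_def youngs_le_def)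
  have G: "young D" if "D \<in> G" for D using that schur_coeff_support_young[OF g] by (auto simp: G_def)
  have "f * g = (\<Sum>D\<in>G. cst (schur_coeff g D) * (f * schur D))"
    by (subst (1) schur_expansion[OF g]) (simp add: G_def sum_distrib_left mult_ac)
  then have "schur_coeff (f * g) R = (\<Sum>D\<in>G. schur_coeff g D * schur_coeff (f * schur D) R)"
    using G fs by (simp add: schur_coeff_sum Sym_cst_times schur_coeff_linear)
  also have "\<dots> = (\<Sum>D\<in>G \<inter> youngs_le (card R). schur_coeff g D * schur_coeff (f * schur D) R)"
  proof (intro sum.mono_neutral_right fin ballI)
    fix D assume "D \<in> G - G \<inter> youngs_le (card R)"
    then have "young D" "card R < card D" using G by (auto simp: youngs_le_def)
    then show "schur_coeff g D * schur_coeff (f * schur D) R = 0" by (simp add: low)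
  qed auto
  also have "\<dots> = (\<Sum>D\<in>youngs_le (card R). schur_coeff g D * schur_coeff (f * schur D) R)"
    using fin by (intro sum.mono_neutral_left) (auto simp: G_def)
  finally show "schur_coeff (f * g) R = (\<Sum>D\<in>youngs_le (card R). schur_coeff g D * schur_coeff (f * schur D) R)" .
qed

lemma scalar_prod_schur:
  assumes "young R"
  shows "scalar_prod (schur R) g = schur_coeff g R"
    and "f \<in> Sym \<Longrightarrow> scalar_prod f (schur R) = schur_coeff f R"
proof -
  have "{D. schur_coeff (schur R) D \<noteq> 0} = {R}" using assms by (auto simp: schur_coeff_schur split: if_splits)
  then show "scalar_prod (schur R) g = schur_coeff g R"
    using assms by (simp add: Defs.scalar_prod_def schur_coeff_schur)
  show "scalar_prod f (schur R) = schur_coeff f R" if f: "f \<in> Sym"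
  proof -
    have "scalar_prod f (schur R) = (\<Sum>D | schur_coeff f D \<noteq> 0. schur_coeff f D * (if D = R then 1 else 0))"
      unfolding Defs.scalar_prod_def using assms by (intro sum.cong) (auto simp: schur_coeff_schur)
    then show ?thesis using finite_schur_coeff[OF f] by (simp add: sum_kronecker)
  qed
qed

text \<open>Testing the adjointness against s_D dictates the coefficient at \<open>D\<close>. It
  vanishes for diagrams heavier than \<open>R\<close>, so a finite sum meets the description and is
  the only function to do so.\<close>

theorem perp_schur:
  assumes f: "f \<in> Sym" and R: "young R"
  shows "perp f (schur R) = (\<Sum>D\<in>youngs_le (card R). cst (schur_coeff (f * schur D) R) * schur D)"
proof -
  define h where "h = (\<Sum>D\<in>youngs_le (card R). cst (schur_coeff (f * schur D) R) * schur D)"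
  have fin: "finite (youngs_le d)" for d using finite_young_bounded by (simp add: youngs_le_def)
  have hS: "h \<in> Sym" unfolding h_def by (intro Sym_sum Sym_cst_times schur_in_Sym) (simp add: youngs_le_def)
  have ch: "schur_coeff h E = schur_coeff (f * schur E) R" if E: "young E" for E
  proof -
    have "schur_coeff h E = (\<Sum>D\<in>youngs_le (card R). schur_coeff (cst (schur_coeff (f * schur D) R) * schur D) E)"
      unfolding h_def by (rule schur_coeff_sum) (auto simp: youngs_le_def intro: Sym_cst_times schur_in_Sym)
    also have "\<dots> = (\<Sum>D\<in>youngs_le (card R). schur_coeff (f * schur D) R * (if D = E then 1 else 0))"
      by (rule sum.cong) (auto simp: youngs_le_def schur_coeff_linear schur_in_Sym schur_coeff_schur)
    also have "\<dots> = (if E \<in> youngs_le (card R) then schur_coeff (f * schur E) R else 0)"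
      by (rule sum_kronecker[OF fin])
    also have "\<dots> = schur_coeff (f * schur E) R"
      using schur_coeff_mult_expand(2)[OF f f E, of R] E by (auto simp: youngs_le_def)
    finally show ?thesis .
  qed
  have adj: "scalar_prod h u = scalar_prod (schur R) (f * u)" if u: "u \<in> Sym" for u
  proof -
    have supp: "{D. schur_coeff h D \<noteq> 0} \<subseteq> youngs_le (card R)"
    proof
      fix D assume "D \<in> {D. schur_coeff h D \<noteq> 0}"
      then have "schur_coeff h D \<noteq> 0" by simp
      then have D: "young D" "schur_coeff (f * schur D) R \<noteq> 0"
        using schur_coeff_support_young[OF hS, of D] ch[of D] by simp_all
      then show "D \<in> youngs_le (card R)"
        using schur_coeff_mult_expand(2)[OF f f D(1), of R] by (auto simp: youngs_le_def not_less[symmetric])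
    qed
    have "scalar_prod h u = (\<Sum>D\<in>youngs_le (card R). schur_coeff h D * schur_coeff u D)"
      unfolding Defs.scalar_prod_def using supp fin by (intro sum.mono_neutral_left) auto
    also have "\<dots> = (\<Sum>D\<in>youngs_le (card R). schur_coeff u D * schur_coeff (f * schur D) R)"
      by (rule sum.cong) (auto simp: youngs_le_def ch)
    also have "\<dots> = scalar_prod (schur R) (f * u)"
      by (simp add: scalar_prod_schur[OF R] schur_coeff_mult_expand(1)[OF f u])
    finally show ?thesis .
  qed
  have "perp f (schur R) = h"
    unfolding Defs.perp_def
  proof (rule the_equality)
    show "h \<in> Sym \<and> (\<forall>u\<in>Sym. scalar_prod h u = scalar_prod (schur R) (f * u))" using hS adj by simp
    fix h' assume h': "h' \<in> Sym \<and> (\<forall>u\<in>Sym. scalar_prod h' u = scalar_prod (schur R) (f * u))"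
    show "h' = h"
    proof (rule Sym_eqI)
      fix D assume D: "young D"
      then have "schur_coeff h' D = scalar_prod (schur R) (f * schur D)"
        using h' schur_in_Sym scalar_prod_schur(2)[of D h'] by simp
      then show "schur_coeff h' D = schur_coeff h D" by (simp add: scalar_prod_schur(1)[OF R] ch[OF D])
    qed (use h' hS in auto)
  qed
  then show ?thesis by (simp add: h_def)
qed

lemma neg_schur: "neg (schur D) = cst ((- 1) ^ card D) * schur D"
  by (rule pseries_eqI) (metis mcoeff_cst_times mcoeff_neg mcoeff_schur_size mult_zero_right)

lemma schur_coeff_neg: "f \<in> Sym \<Longrightarrow> schur_coeff (neg f) D = (- 1) ^ card D * schur_coeff f D"
  using schur_coeff_cong_size[of "neg f" "cst ((- 1) ^ card D) * f" D]
  by (simp add: neg_in_Sym Sym_cst_times mcoeff_neg mcoeff_cst_times schur_coeff_linear)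

text \<open>Truncations at degree \<open>d\<close> of \<open>\<Prod>\<^sub>i (1 + x\<^sub>i)\<^sup>c\<close>.\<close>
definition twist :: "nat \<Rightarrow> int \<Rightarrow> nat pseries" where
  "twist d c = (if c \<ge> 0 then esyms d ^ nat c else neg (hsyms d) ^ nat (- c))"

lemma twist_in_Sym: "twist d c \<in> Sym"
  by (simp add: twist_def Sym_power esyms_in_Sym hsyms_in_Sym neg_in_Sym)

lemma conj_op_esyms: "conj_op (esyms d) = hsyms d"
  unfolding esyms_def hsyms_def by (simp add: conj_op_sum esym_in_Sym conj_op_esym)

text \<open>In the expansion of \<open>conj_op (twist d c)\<close> the coefficients at weights up to
  d are specialisations (\<open>schur_coeff_hsyms_power\<close>); the other factors are the
  coefficients in \<open>perp_schur\<close>. For c < 0 the sign and the conjugation in the antipode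
  match those coming from \<open>neg (hsyms d)\<close> and \<open>conj_op\<close>.\<close>

theorem ps1_perp_schur:
  assumes f: "f \<in> Sym" and R: "young R" and d: "card R \<le> d"
  shows "ps1 c (perp f (schur R)) = schur_coeff (f * conj_op (twist d c)) R"
proof -
  let ?Y = "youngs_le (card R)"
  have fin: "finite ?Y" using finite_young_bounded by (simp add: youngs_le_def)
  have Y: "young D" "card D \<le> d" if "D \<in> ?Y" for D using that d by (auto simp: youngs_le_def)
  have term_in_Sym: "cst q * schur D \<in> Sym" if "D \<in> ?Y" for D q
    using Y that by (intro Sym_cst_times schur_in_Sym) auto
  have expand: "schur_coeff (f * conj_op (twist d c)) R =
      (\<Sum>D\<in>?Y. schur_coeff (conj_op (twist d c)) D * schur_coeff (f * schur D) R)"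
    by (rule schur_coeff_mult_expand[OF f conj_op_in_Sym[OF twist_in_Sym]])
  show ?thesis
  proof (cases "c \<ge> 0")
    case True
    have "schur_coeff (conj_op (twist d c)) D = eval_ones (nat c) (schur D)" if "D \<in> ?Y" for D
      using True Y[OF that] by (simp add: twist_def conj_op_power esyms_in_Sym conj_op_esyms schur_coeff_hsyms_power)
    then have "schur_coeff (f * conj_op (twist d c)) R = (\<Sum>D\<in>?Y. eval_ones (nat c) (cst (schur_coeff (f * schur D) R) * schur D))"
      unfolding expand by (intro sum.cong) (auto simp: eval_ones_cst_times mult.commute[of "eval_ones _ _"])
    also have "\<dots> = ps1 c (perp f (schur R))"
      using True fin term_in_Sym by (simp add: ps1_def perp_schur[OF f R] eval_ones_sum)
    finally show ?thesis by simp
  next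
    case False
    have coeff: "schur_coeff (conj_op (twist d c)) D = (- 1) ^ card D * eval_ones (nat (- c)) (schur (conjugate D))"
      if "D \<in> ?Y" for D
    proof -
      have "schur_coeff (conj_op (twist d c)) D = schur_coeff (neg (hsyms d ^ nat (- c))) (conjugate D)"
        using False by (simp add: twist_def schur_coeff_conj_op Sym_power neg_in_Sym hsyms_in_Sym neg.hom_power)
      also have "\<dots> = (- 1) ^ card D * eval_ones (nat (- c)) (schur (conjugate D))"
        using Y[OF that] by (simp add: schur_coeff_neg Sym_power hsyms_in_Sym schur_coeff_hsyms_power)
      finally show ?thesis .
    qed
    have "antipode (perp f (schur R)) =
        (\<Sum>D\<in>?Y. conj_op (cst (schur_coeff (f * schur D) R) * (cst ((- 1) ^ card D) * schur D)))"
    proof -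
      have "neg (perp f (schur R)) = (\<Sum>D\<in>?Y. cst (schur_coeff (f * schur D) R) * (cst ((- 1) ^ card D) * schur D))"
        by (simp add: perp_schur[OF f R] neg.hom_sum neg.hom_mult neg_cst neg_schur)
      moreover have "perp f (schur R) \<in> Sym"
        unfolding perp_schur[OF f R] by (intro Sym_sum term_in_Sym)
      ultimately show ?thesis
        using term_in_Sym by (simp add: antipode_eq_conj_op conj_op_sum Sym_cst_times)
    qed
    also have "\<dots> = (\<Sum>D\<in>?Y. cst (schur_coeff (f * schur D) R * (- 1) ^ card D) * schur (conjugate D))"
      using Y by (intro sum.cong) (auto simp: conj_op_linear Sym_cst_times schur_in_Sym conj_op_schur cst_mult simp flip: mult.assoc)
    finally have "ps1 c (perp f (schur R)) =
        eval_ones (nat (- c)) (\<Sum>D\<in>?Y. cst (schur_coeff (f * schur D) R * (- 1) ^ card D) * schur (conjugate D))"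
      using False by (simp add: ps1_def)
    also have "\<dots> = (\<Sum>D\<in>?Y. eval_ones (nat (- c)) (cst (schur_coeff (f * schur D) R * (- 1) ^ card D) * schur (conjugate D)))"
      using Y by (intro eval_ones_sum fin Sym_cst_times schur_in_Sym) auto
    also have "\<dots> = schur_coeff (f * conj_op (twist d c)) R"
      unfolding expand by (intro sum.cong) (auto simp: eval_ones_cst_times coeff)
    finally show ?thesis .
  qed
qed

corollary rhs_eq:
  assumes "young p" "young r" "card r \<le> d"
  shows "ps1 c (perp (SQ_alt (card p) (schur (conjugate p))) (schur (conjugate r))) =
    schur_coeff (phi 1 (schur p) * twist d c) r"
proof -
  have sp: "schur p \<in> Sym" "schur (conjugate p) \<in> Sym" using assms by (auto intro: schur_in_Sym)
  have "SQ_alt (card p) (schur (conjugate p)) = phi (- 1) (schur (conjugate p))"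
    using deg_le_schur[of "conjugate p"] by (intro SQ_alt_eq_phi) simp
  also have "\<dots> = conj_op (phi 1 (schur p))"
    using assms sp by (simp add: conj_op_phi conj_op_schur)
  finally have eq: "SQ_alt (card p) (schur (conjugate p)) = conj_op (phi 1 (schur p))" .
  have "ps1 c (perp (SQ_alt (card p) (schur (conjugate p))) (schur (conjugate r))) =
      schur_coeff (conj_op (phi 1 (schur p)) * conj_op (twist d c)) (conjugate r)"
    unfolding eq using assms sp by (intro ps1_perp_schur conj_op_in_Sym phi_in_Sym) auto
  also have "conj_op (phi 1 (schur p)) * conj_op (twist d c) = conj_op (phi 1 (schur p) * twist d c)"
    by (simp add: conj_op_mult phi_in_Sym sp twist_in_Sym)
  finally show ?thesis
    by (simp add: schur_coeff_conj_op Sym_mult phi_in_Sym sp twist_in_Sym)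
qed

section \<open>Deleting rows without boxes\<close>

definition sqvar :: "nat \<Rightarrow> nat pseries" where
  "sqvar i = var i * (1 + var i)"

definition unitprod :: "nat set \<Rightarrow> nat pseries" where
  "unitprod I = (\<Prod>i\<in>I. 1 + var i)"

text \<open>For y = x + x^2 the quotient (y_j - y_i) / (x_j - x_i) is 1 + x_i + x_j, so this is the
  factor by which the substitution changes the Vandermonde determinant
  (\<open>phi_alt\<close>).\<close>

definition pairprod :: "nat \<Rightarrow> nat pseries" where
  "pairprod n = (\<Prod>j<n. \<Prod>i<j. 1 + var i + var j)"

text \<open>
  With \<open>K\<close> the inverse of \<^term>\<open>pairprod n\<close> and \<open>l\<close>, \<open>m\<close> the beta numbers of \<open>\<lambda>\<close>, \<open>\<mu>\<close>, this is \<open>a\<^sub>\<lambda>\<^sub>\<mu>\<close>.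
\<close>
definition skewc :: "nat set \<Rightarrow> nat pseries \<Rightarrow> (nat \<Rightarrow> nat) \<Rightarrow> (nat \<Rightarrow> nat) \<Rightarrow> rat" where
  "skewc I K l m = mcoeff (K * gdet I sqvar l) (expo I m)"

lemma phi_var: "phi 1 (var i) = sqvar i"
  by (simp add: var_def phi_mon sqgen_def sqvar_def cst_1 algebra_simps)

lemma phi_alt: "phi 1 (alt n) = alt n * pairprod n"
proof -
  have "phi 1 (alt n) = gdet {..<n} sqvar id"
    by (simp add: alt_def gdet_hom[OF phi.comm_ring_hom_axioms] phi_var)
  also have "\<dots> = (\<Prod>j<n. \<Prod>i<j. (var j - var i) * (1 + var i + var j))"
    unfolding gdet_Vandermonde by (intro prod.cong) (auto simp: sqvar_def algebra_simps)
  finally show ?thesis by (simp add: prod.distrib alt_def gdet_Vandermonde pairprod_def)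
qed

lemma prod_sqvar_power:
  assumes "finite I"
  shows "(\<Prod>j\<in>I. sqvar j ^ e j) = mon (expo I e) * (\<Prod>j\<in>I. (1 + var j) ^ e j)"
  by (simp add: sqvar_def power_mult_distrib prod.distrib mon_expo[OF assms])

lemma skewc_eq_sum:
  assumes "finite I"
  shows "skewc I K l m = (\<Sum>w | w permutes I. of_int (sign w) *
    (if expo I (l \<circ> w) \<subseteq># expo I m
     then mcoeff (K * (\<Prod>j\<in>I. (1 + var j) ^ l (w j))) (expo I m - expo I (l \<circ> w)) else 0))"
proof -
  have "K * gdet I sqvar l = (\<Sum>w | w permutes I. of_int (sign w) *
      (mon (expo I (l \<circ> w)) * (K * (\<Prod>j\<in>I. (1 + var j) ^ l (w j)))))"
    unfolding gdet_def sum_distrib_left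
    by (rule sum.cong) (simp_all add: prod_sqvar_power[OF assms] o_def mult_ac)
  then show ?thesis
    by (simp add: skewc_def mcoeff_sum mcoeff_of_int_times mcoeff_mon_times)
qed

lemma expo_subset_iff: "finite I \<Longrightarrow> expo I e \<subseteq># expo I e' \<longleftrightarrow> (\<forall>i\<in>I. e i \<le> e' i)"
  by (auto simp: subseteq_mset_def count_expo)

lemma expo_diff: "finite I \<Longrightarrow> expo I e - expo I e' = expo I (\<lambda>i. e i - e' i)"
  by (rule multiset_eqI) (simp add: count_expo)

text \<open>
  Where \<open>l\<close> and \<open>m\<close> agree at \<open>i\<close>, degree reasons force a contributing permutation to fix \<open>i\<close> and the
  variable \<open>i\<close> to enter the remaining factors with exponent 0.
\<close>
lemma skewc_delete:
  assumes I: "finite I" "i \<in> I" and lm: "l i = m i"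
    and l: "\<And>r s. r \<in> I \<Longrightarrow> s \<in> I \<Longrightarrow> r < s \<Longrightarrow> l r < l s"
    and m: "\<And>r s. r \<in> I \<Longrightarrow> s \<in> I \<Longrightarrow> r < s \<Longrightarrow> m r < m s"
  shows "skewc I K l m = skewc (I - {i}) (tr (- {i}) K) l m"
proof -
  define J where "J = I - {i}"
  have J: "finite J" "i \<notin> J" "I = insert i J" using I by (auto simp: J_def)
  have l_le: "r \<le> s" if "r \<in> I" "s \<in> I" "l r \<le> l s" for r s
    using l[of s r] that by (meson not_le)
  \<comment> \<open>Indices j below i are mapped below i, since l (w j) <= m j < m i = l i. Being
    injective, \<open>w\<close> permutes them, so w i >= i, while l (w i) <= m i = l i gives the
    other inequality.\<close>
  have fixed: "w i = i" if w: "w permutes I" and le: "\<And>j. j \<in> I \<Longrightarrow> l (w j) \<le> m j" for w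
  proof -
    let ?A = "{j \<in> I. j < i}"
    have wI: "w j \<in> I" if "j \<in> I" for j using permutes_in_image[OF w] that by simp
    have "w j \<in> ?A" if j: "j \<in> ?A" for j
    proof -
      have "l (w j) < l i" using le[of j] m[of j i] j I(2) lm by simp
      then have "w j \<le> i" "w j \<noteq> i" using l_le[of "w j" i] wI[of j] j I(2) by auto
      then show ?thesis using wI[of j] j by auto
    qed
    then have "w ` ?A \<subseteq> ?A" by blast
    moreover have inj: "inj w" using w by (rule permutes_inj)
    ultimately have "w ` ?A = ?A"
      using I(1) by (intro endo_inj_surj) (auto intro: inj_on_subset)
    moreover have "w i \<notin> w ` ?A" using inj by (auto dest: injD)
    ultimately have "\<not> w i < i" using wI[OF I(2)] by blast
    moreover have "w i \<le> i" using le[OF I(2)] l_le[of "w i" i] wI[OF I(2)] I(2) lm by simp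
    ultimately show ?thesis by simp
  qed
  define T where "T w = (if expo I (l \<circ> w) \<subseteq># expo I m
     then mcoeff (K * (\<Prod>j\<in>I. (1 + var j) ^ l (w j))) (expo I m - expo I (l \<circ> w)) else 0)" for w
  have "skewc I K l m = (\<Sum>w | w permutes I. of_int (sign w) * T w)"
    by (simp add: skewc_eq_sum[OF I(1)] T_def)
  also have "\<dots> = (\<Sum>w | w permutes J. of_int (sign w) * T w)"
  proof (intro sum.mono_neutral_right ballI)
    show "finite {w. w permutes I}" using I(1) by (rule finite_permutations)
    show "{w. w permutes J} \<subseteq> {w. w permutes I}" using J by (auto intro: permutes_subset)
    fix w assume "w \<in> {w. w permutes I} - {w. w permutes J}"
    then have w: "w permutes I" "\<not> w permutes J" by auto
    then have "w i \<noteq> i" using permutes_superset[OF w(1), of J] J by auto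
    then have "\<not> (\<forall>j\<in>I. l (w j) \<le> m j)" using fixed[OF w(1)] by blast
    then have "\<not> expo I (l \<circ> w) \<subseteq># expo I m" unfolding expo_subset_iff[OF I(1)] comp_apply .
    then show "of_int (sign w) * T w = 0" by (simp add: T_def)
  qed
  also have "\<dots> = skewc J (tr (- {i}) K) l m"
    unfolding skewc_eq_sum[OF J(1)]
  proof (intro sum.cong refl arg_cong2[where f = "(*)"])
    fix w assume "w \<in> {w. w permutes J}"
    then have wi: "w i = i" using J(2) by (auto simp: permutes_def)
    have sub: "expo I (l \<circ> w) \<subseteq># expo I m \<longleftrightarrow> expo J (l \<circ> w) \<subseteq># expo J m"
      using I J wi lm by (simp add: expo_subset_iff)
    have diff: "expo I m - expo I (l \<circ> w) = expo J m - expo J (l \<circ> w)" (is "?d = ?d'")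
      using J wi lm unfolding expo_diff[OF I(1)] expo_diff[OF J(1)] by (simp add: expo_def)
    have "set_mset ?d' \<subseteq> - {i}"
      using set_expo[of J] J unfolding expo_diff[OF J(1)] by blast
    then have "mcoeff (K * (\<Prod>j\<in>I. (1 + var j) ^ l (w j))) ?d' =
        mcoeff (tr (- {i}) (K * (\<Prod>j\<in>I. (1 + var j) ^ l (w j)))) ?d'" by (simp add: mcoeff_tr)
    also have "tr (- {i}) (K * (\<Prod>j\<in>I. (1 + var j) ^ l (w j))) = tr (- {i}) K * (\<Prod>j\<in>J. (1 + var j) ^ l (w j))"
    proof -
      have "tr (- {i}) (\<Prod>j\<in>I. (1 + var j) ^ l (w j)) =
          (\<Prod>j\<in>I. (1 + tr (- {i}) (var j)) ^ l (w j) :: nat pseries)"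
        by (simp add: tr.hom_prod tr.hom_power tr.hom_add)
      also have "\<dots> = (\<Prod>j\<in>J. (1 + tr (- {i}) (var j)) ^ l (w j))"
        using J by (simp add: tr_var)
      also have "\<dots> = (\<Prod>j\<in>J. (1 + var j) ^ l (w j))"
        using J by (intro prod.cong) (auto simp: tr_var)
      finally show ?thesis by (simp add: tr.hom_mult)
    qed
    finally show "T w = (if expo J (l \<circ> w) \<subseteq># expo J m
        then mcoeff (tr (- {i}) K * (\<Prod>j\<in>J. (1 + var j) ^ l (w j))) (expo J m - expo J (l \<circ> w)) else 0)"
      unfolding T_def sub diff by (rule arg_cong)
  qed
  finally show ?thesis by (simp add: J_def)
qed

lemma skewc_tr: "finite I \<Longrightarrow> skewc I (tr I K) l m = skewc I K l m"
  unfolding skewc_def by (rule eqb_D[OF eqb_mult[OF eqb_tr eqb_refl]]) (rule set_expo)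

lemma skewc_delete_set:
  assumes I: "finite I" "J \<subseteq> I" and lm: "\<And>i. i \<in> I - J \<Longrightarrow> l i = m i"
    and l: "\<And>r s. r < s \<Longrightarrow> l r < l s" and m: "\<And>r s. r < s \<Longrightarrow> m r < m s"
  shows "skewc I K l m = skewc J (tr J K) l m"
proof -
  have "skewc I K l m = skewc (I - R) (tr (- R) K) l m" if "R \<subseteq> I - J" for R
  proof -
    have "finite R" using that I(1) finite_subset by blast
    then show ?thesis using that
    proof (induction R rule: finite_induct)
      case empty
      have "tr UNIV K = K" by (rule pseries_eqI) (simp add: mcoeff_tr)
      then show ?case by simp
    next
      case (insert i R)
      have "skewc (I - R) (tr (- R) K) l m = skewc (I - R - {i}) (tr (- {i}) (tr (- R) K)) l m"
        using insert.prems insert.hyps I(1) lm l m by (intro skewc_delete) auto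
      moreover have "- {i} \<inter> - R = - insert i R" "I - R - {i} = I - insert i R" by auto
      ultimately show ?case using insert by (simp add: tr_tr)
    qed
  qed
  from this[of "I - J"] have "skewc I K l m = skewc J (tr (- (I - J)) K) l m"
    using I(2) by (simp add: double_diff)
  also have "\<dots> = skewc J (tr J (tr (- (I - J)) K)) l m"
    using I finite_subset by (subst skewc_tr) auto
  also have "J \<inter> - (I - J) = J" by auto
  then have "tr J (tr (- (I - J)) K) = tr J K" by (simp add: tr_tr)
  finally show ?thesis .
qed

lemma skewc_cong:
  assumes "\<And>i. i \<in> I \<Longrightarrow> l i = l' i" "\<And>i. i \<in> I \<Longrightarrow> m i = m' i"
  shows "skewc I K l m = skewc I K l' m'"
  unfolding skewc_def using gdet_cong[of I sqvar sqvar l l'] expo_cong[of I m m'] assms by simp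

text \<open>Everything belonging to the variable j gains a factor (x_j (1 + x_j))^s. The powers of
  x_j merely shift exponents; the powers of 1 + x_j remain as \<open>unitprod\<close>. This is the
  effect of s full columns.\<close>

lemma skewc_shift:
  assumes I: "finite I"
  shows "skewc I K (\<lambda>i. l i + s) (\<lambda>i. m i + s) = skewc I (K * unitprod I ^ s) l m"
proof -
  have "gdet I sqvar (\<lambda>i. l i + s) = (\<Prod>j\<in>I. sqvar j ^ s) * gdet I sqvar l"
    by (simp add: gdet_def power_add prod.distrib sum_distrib_left mult_ac)
  also have "(\<Prod>j\<in>I. sqvar j ^ s) = mon (expo I (\<lambda>_. s)) * unitprod I ^ s"
    by (simp add: prod_sqvar_power[OF I] unitprod_def prod_power_distrib)
  finally have "K * gdet I sqvar (\<lambda>i. l i + s) = mon (expo I (\<lambda>_. s)) * (K * unitprod I ^ s * gdet I sqvar l)"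
    by (simp add: mult_ac)
  moreover have "expo I (\<lambda>i. m i + s) = expo I (\<lambda>_. s) + expo I m"
    by (rule multiset_eqI) (simp add: count_expo[OF I])
  ultimately show ?thesis by (simp add: skewc_def mcoeff_mon_times)
qed

text \<open>The substitution is applied to the bialternant formula: the denominator becomes
  \<open>alt n * pairprod n\<close>, and \<open>F\<close> cancels its second factor.\<close>

lemma schur_coeff_skewc:
  assumes D: "young D" "rows_le D n" and E: "young E" "rows_le E n"
    and L: "L \<in> Sym" and F: "pairprod n * F = 1"
  shows "schur_coeff (phi 1 (schur D) * L) E = skewc {..<n} (L * F) (beta n D) (beta n E)"
proof -
  define t where "t = tr {..<n} (schur D)"
  let ?m = "expo {..<n} (beta n E)"
  have "phi 1 t * (alt n * pairprod n) = phi 1 (t * alt n)" by (simp add: phi.hom_mult phi_alt)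
  also have "t * alt n = gdet {..<n} var (beta n D)"
    using bialternant[OF D(1), of n] D(2) by (simp add: t_def alt_def)
  also have "phi 1 \<dots> = gdet {..<n} sqvar (beta n D)"
    by (simp add: gdet_hom[OF phi.comm_ring_hom_axioms] phi_var)
  finally have "phi 1 t * (alt n * pairprod n) * F = F * gdet {..<n} sqvar (beta n D)" by simp
  then have eq: "phi 1 t * alt n = F * gdet {..<n} sqvar (beta n D)"
    using F by (simp add: mult.assoc)
  have "schur_coeff (phi 1 (schur D) * L) E = mcoeff (phi 1 (schur D) * (L * alt n)) ?m"
    using schur_coeff_altc[OF Sym_mult[OF phi_in_Sym[OF schur_in_Sym[OF D(1)]] L] E]
    by (simp add: altc_def mult.assoc)
  \<comment> \<open>The monomial read off involves the first n variables only, so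
    \<open>schur D\<close> may be restricted to them.\<close>
  also have "\<dots> = mcoeff (phi 1 t * (L * alt n)) ?m"
    unfolding t_def
    by (rule eqb_D[OF eqb_mult[OF eqb_phi eqb_refl]]) (simp add: eqb_def mcoeff_tr, meson finite_lessThan set_expo set_mset_mono order_trans)
  also have "phi 1 t * (L * alt n) = L * F * gdet {..<n} sqvar (beta n D)"
    using eq by (simp add: mult_ac)
  finally show ?thesis by (simp add: skewc_def)
qed

text \<open>The full product prod (1 + x_i), with prod 1/(1 + x_i) following. They are compared with
  \<open>twist\<close> at a single monomial (\<open>eqb_twist\<close>), and restricted to a finite
  \<open>J\<close> they become \<open>unitprod J\<close> and its inverse.\<close>

definition elementary_series :: "nat pseries" where
  "elementary_series = Abs_pseries (\<lambda>m. if squarefree_mset m then 1 else 0)"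

definition alternating_series :: "nat pseries" where
  "alternating_series = Abs_pseries (\<lambda>m. (- 1) ^ size m)"

definition twist_series :: "int \<Rightarrow> nat pseries" where
  "twist_series c = (if c \<ge> 0 then elementary_series ^ nat c else alternating_series ^ nat (- c))"

lemma eqb_twist:
  assumes "size m \<le> d"
  shows "eqb m (twist d c) (twist_series c)"
proof -
  have "size a \<le> d" if "a \<subseteq># m" for a using size_mset_mono[OF that] assms by simp
  then have "eqb m (esyms d) elementary_series" "eqb m (neg (hsyms d)) alternating_series"
    by (auto simp: eqb_def esyms_def hsyms_def elementary_series_def alternating_series_def
        mcoeff_sum mcoeff_esym mcoeff_hsym mcoeff_neg)
  then show ?thesis by (simp add: twist_def twist_series_def eqb_power)
qed

lemma tr_elementary_series:
  assumes J: "finite J"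
  shows "tr J elementary_series = unitprod J"
proof (rule pseries_eqI)
  fix m
  have sub: "finite S" if "S \<subseteq> J" for S using that J finite_subset by blast
  have "unitprod J = (\<Sum>S\<in>Pow J. \<Prod>i\<in>S. var i)"
    using prod_add[OF J, of var "\<lambda>_. 1"] by (simp add: unitprod_def add.commute)
  also have "\<dots> = (\<Sum>S\<in>Pow J. mon (mset_set S))"
  proof (rule sum.cong[OF refl])
    fix S assume "S \<in> Pow J"
    then have "finite S" using sub by simp
    then show "(\<Prod>i\<in>S. var i) = mon (mset_set S)"
      by (induction S rule: finite_induct) (auto simp: mon_empty mon_add_mset)
  qed
  finally have "mcoeff (unitprod J) m = (\<Sum>S\<in>Pow J. if m = mset_set S then 1 else 0)"
    by (simp add: mcoeff_sum mcoeff_mon)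
  also have "\<dots> = (\<Sum>S\<in>Pow J. if S = set_mset m then if squarefree_mset m then 1 else 0 else 0)"
  proof (rule sum.cong[OF refl])
    fix S assume "S \<in> Pow J"
    then have "finite S" using sub by simp
    then have "m = mset_set S \<longleftrightarrow> S = set_mset m \<and> squarefree_mset m"
      unfolding squarefree_mset_iff by (metis finite_set_mset_mset_set)
    then show "(if m = mset_set S then 1 else 0) = (if S = set_mset m then if squarefree_mset m then 1 else 0 else (0 :: rat))"
      by simp
  qed
  also have "\<dots> = mcoeff (tr J elementary_series) m"
    using J by (simp add: mcoeff_tr elementary_series_def)
  finally show "mcoeff (tr J elementary_series) m = mcoeff (unitprod J) m" by simp
qed

text \<open>Multiplication by 1 + x_i cancels all monomials containing x_i, because the signs
  alternate.\<close>

lemma tr_alternating_series: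
  assumes "finite J"
  shows "tr J alternating_series * unitprod J = 1"
  using assms
proof (induction J rule: finite_induct)
  case empty
  have "tr {} alternating_series = 1"
    by (rule pseries_eqI) (auto simp: mcoeff_tr alternating_series_def mcoeff_basic)
  then show ?case by (simp add: unitprod_def)
next
  case (insert i J)
  have "tr (insert i J) alternating_series * (1 + var i) = tr J alternating_series"
  proof (rule pseries_eqI)
    fix m
    have "tr (insert i J) alternating_series * (1 + var i) =
        tr (insert i J) alternating_series + mon {#i#} * tr (insert i J) alternating_series"
      by (simp add: var_def algebra_simps)
    then have c: "mcoeff (tr (insert i J) alternating_series * (1 + var i)) m =
        mcoeff (tr (insert i J) alternating_series) m +
        (if i \<in># m then mcoeff (tr (insert i J) alternating_series) (m - {#i#}) else 0)"
      by (simp add: mcoeff_basic mcoeff_mon_times)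
    show "mcoeff (tr (insert i J) alternating_series * (1 + var i)) m = mcoeff (tr J alternating_series) m"
    proof (cases "i \<in># m")
      case True
      then obtain m' where "m = add_mset i m'" by (metis insert_DiffM)
      then show ?thesis unfolding c using insert.hyps
        by (auto simp: mcoeff_tr alternating_series_def)
    next
      case False
      then show ?thesis unfolding c by (auto simp: mcoeff_tr alternating_series_def)
    qed
  qed
  then have "tr (insert i J) alternating_series * unitprod (insert i J) = tr J alternating_series * unitprod J"
    using insert.hyps by (simp add: unitprod_def mult.assoc[symmetric])
  then show ?case using insert.IH by simp
qed

text \<open>Each further index lies outside \<open>J\<close>, so its variable becomes 0, and its
  factors with the indices k in \<open>J\<close> become 1 + x_k and multiply to
  \<open>unitprod J\<close>.\<close>

lemma tr_pairprod:
  assumes "J \<subseteq> {..<n}"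
  shows "tr J (pairprod (n + i)) = tr J (pairprod n) * unitprod J ^ i"
proof (induction i)
  case (Suc i)
  have "tr J (\<Prod>k<n + i. 1 + var k + var (n + i)) = (\<Prod>k<n + i. 1 + tr J (var k) :: nat pseries)"
    using assms by (auto simp: tr.hom_prod tr.hom_add tr_var intro!: prod.cong)
  also have "\<dots> = (\<Prod>k\<in>J. 1 + tr J (var k))"
    using assms by (intro prod.mono_neutral_right) (auto simp: tr_var)
  also have "\<dots> = unitprod J" unfolding unitprod_def by (intro prod.cong) (auto simp: tr_var)
  finally have "tr J (\<Prod>k<n + i. 1 + var k + var (n + i)) = unitprod J" .
  then show ?case using Suc by (simp add: pairprod_def tr.hom_mult mult_ac)
qed simp

lemma ex_pairprod_inverse: "\<exists>F. pairprod n * F = 1"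
proof (rule ex_inverse)
  have "tr {} (pairprod n) = 1"
    by (simp add: pairprod_def tr.hom_prod tr.hom_add tr_var)
  then show "mcoeff (pairprod n) {#} = 1" by (metis mcoeff_basic(2) mcoeff_tr empty_subsetI set_mset_empty)
qed

text \<open>With U = \<open>unitprod J\<close>, restriction to \<open>J\<close> turns
  \<open>G\<close> into U^(-a) times \<open>F\<close>, and \<open>twist_series c\<close> into U^c.
  Here a deleted rows and b removed columns combine to the exponent b - a.\<close>

lemma twist_units:
  assumes J: "finite J" "J \<subseteq> {..<n}" and F: "pairprod n * F = 1" and G: "pairprod (n + a) * G = 1"
  shows "tr J G * unitprod J ^ b = tr J (twist_series (int b - int a) * F)"
proof -
  define U P F' G' where "U = unitprod J" and "P = tr J (pairprod n)" and "F' = tr J F" and "G' = tr J G"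
  define V where "V = tr J alternating_series"
  have PF: "P * F' = 1" using arg_cong[OF F, of "tr J"] by (simp add: P_def F'_def tr.hom_mult)
  have PG: "P * U ^ a * G' = 1"
    using arg_cong[OF G, of "tr J"] by (simp add: P_def G'_def U_def tr.hom_mult tr_pairprod[OF J(2)])
  have VU: "V * U = 1" using tr_alternating_series[OF J(1)] by (simp add: V_def U_def)
  define T where "T = tr J (twist_series (int b - int a))"
  \<comment> \<open>Stated without inverses, so that both signs of the exponent fit.\<close>
  have TU: "T * U ^ a = U ^ b"
  proof (cases "a \<le> b")
    case True
    then have "T = U ^ (b - a)"
      by (simp add: T_def twist_series_def tr.hom_power tr_elementary_series[OF J(1)] U_def nat_diff_distrib')
    then show ?thesis using True by (simp flip: power_add)
  next
    case False
    then have "T = V ^ (a - b)"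
      by (simp add: T_def twist_series_def tr.hom_power V_def nat_diff_distrib')
    moreover have "U ^ a = U ^ (a - b) * U ^ b" using False by (simp flip: power_add)
    ultimately have "T * U ^ a = (V * U) ^ (a - b) * U ^ b" by (simp add: power_mult_distrib mult_ac)
    then show ?thesis by (simp add: VU)
  qed
  have "G' * U ^ b = G' * U ^ b * (P * F')" by (simp add: PF)
  also have "\<dots> = (P * U ^ a * G') * (T * F')" by (simp add: mult_ac flip: TU)
  also have "\<dots> = T * F'" by (simp only: PG mult_1)
  finally show ?thesis by (simp add: G'_def U_def T_def F'_def tr.hom_mult)
qed

section \<open>The minimal presentation\<close>

text \<open>Drops the first \<open>u\<close> rows and \<open>v\<close> columns and moves the rest
  into the corner.\<close>

definition shift_back :: "nat \<Rightarrow> nat \<Rightarrow> (nat \<times> nat) set \<Rightarrow> (nat \<times> nat) set" where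
  "shift_back u v D = {(i, j). (i + u, j + v) \<in> D}"

lemma shift_back_vimage: "shift_back u v D = (\<lambda>(i, j). (i + u, j + v)) -` D"
  by (auto simp: shift_back_def)

lemma inj_add_pair: "inj (\<lambda>(i, j). (i + u, j + v :: nat) :: nat \<times> nat)"
  by (auto simp: inj_on_def)

lemma presentation_shift_back:
  assumes pr: "is_presentation lam mu (p, r)" and ge: "\<And>i j. (i, j) \<in> r - p \<Longrightarrow> u \<le> i \<and> v \<le> j"
  shows "is_presentation lam mu (shift_back u v p, shift_back u v r)"
proof -
  have *: "young p" "young r" "p \<subseteq> r" "translate_of (r - p) (mu - lam)"
    using pr by (auto simp: is_presentation_def)
  have "young (shift_back u v D)" if "young D" for D
  proof -
    have "finite (shift_back u v D)"
      unfolding shift_back_vimage using that by (intro finite_vimageI inj_add_pair young_finite)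
    then show ?thesis
      unfolding young_def
    proof (intro conjI allI impI)
      fix i j i' j' assume "(i, j) \<in> shift_back u v D \<and> i' \<le> i \<and> j' \<le> j"
      then show "(i', j') \<in> shift_back u v D"
        using young_down[OF that, of "i + u" "j + v" "i' + u" "j' + v"] by (simp add: shift_back_def)
    qed
  qed
  moreover have "shift_back u v p \<subseteq> shift_back u v r" using *(3) by (auto simp: shift_back_def)
  moreover have "translate_of (shift_back u v r - shift_back u v p) (mu - lam)"
  proof -
    obtain a b :: int where ab: "(\<lambda>(i, j). (int i, int j)) ` (r - p) = (\<lambda>(i, j). (int i + a, int j + b)) ` (mu - lam)"
      using *(4) by (auto simp: translate_of_def)
    have "(\<lambda>(i, j). (int i, int j)) ` (shift_back u v r - shift_back u v p) =
        (\<lambda>(x, y). (x - int u, y - int v)) ` (\<lambda>(i, j). (int i, int j)) ` (r - p)"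
    proof (intro subset_antisym subsetI)
      fix z assume "z \<in> (\<lambda>(i, j). (int i, int j)) ` (shift_back u v r - shift_back u v p)"
      then obtain i j where "z = (int i, int j)" "(i + u, j + v) \<in> r - p" by (auto simp: shift_back_def)
      then show "z \<in> (\<lambda>(x, y). (x - int u, y - int v)) ` (\<lambda>(i, j). (int i, int j)) ` (r - p)"
        by (force simp: image_image image_iff)
    next
      fix z assume "z \<in> (\<lambda>(x, y). (x - int u, y - int v)) ` (\<lambda>(i, j). (int i, int j)) ` (r - p)"
      then obtain i j where ij: "z = (int i - int u, int j - int v)" "(i, j) \<in> r - p" by auto
      then have "z = (int (i - u), int (j - v))" "(i - u, j - v) \<in> shift_back u v r - shift_back u v p"
        using ge[OF ij(2)] by (auto simp: shift_back_def of_nat_diff)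
      then show "z \<in> (\<lambda>(i, j). (int i, int j)) ` (shift_back u v r - shift_back u v p)"
        by (intro image_eqI[of _ _ "(i - u, j - v)"]) auto
    qed
    also have "\<dots> = (\<lambda>(i, j). (int i + (a - int u), int j + (b - int v))) ` (mu - lam)"
      unfolding ab image_image by (intro image_cong) auto
    finally show ?thesis unfolding translate_of_def by blast
  qed
  ultimately show ?thesis using * by (simp add: is_presentation_def)
qed

lemma card_shift_back_less:
  assumes "young r" "r \<noteq> {}" "0 < u + v"
  shows "card (shift_back u v r) < card r"
proof -
  let ?g = "\<lambda>(i, j). (i + u, j + v)"
  have fin: "finite r" using assms(1) by (rule young_finite)
  have "(0, 0) \<in> r" using assms(1,2) young_down by fastforce
  moreover have "(0, 0) \<notin> ?g ` shift_back u v r" using assms(3) by auto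
  moreover have "?g ` shift_back u v r \<subseteq> r" by (auto simp: shift_back_def)
  ultimately have "card (?g ` shift_back u v r) < card r" by (intro psubset_card_mono fin) blast
  then show ?thesis using card_image[OF inj_on_subset[OF inj_add_pair subset_UNIV]] by simp
qed

text \<open>If row 0 or column 0 contained no box of \<open>r - p\<close>, shifting would give a
  lighter presentation. So the smallest row and column indices correspond, and the translation is by
  (i0, j0).\<close>

lemma pi_rho_reduced:
  assumes "young lam" "young mu" "lam \<subseteq> mu" "lam \<noteq> mu"
  defines "p \<equiv> pi_shape lam mu" and "r \<equiv> rho_shape lam mu"
  defines "i0 \<equiv> Min (fst ` (mu - lam))" and "j0 \<equiv> Min (snd ` (mu - lam))"
  shows "young p" "young r" "p \<subseteq> r"
    and "\<And>i j. (i, j) \<in> mu - lam \<Longrightarrow> i0 \<le> i \<and> j0 \<le> j"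
    and "\<And>i j. (i, j) \<in> r - p \<longleftrightarrow> (i + i0, j + j0) \<in> mu - lam"
proof -
  let ?B = "mu - lam"
  let ?P = "is_presentation lam mu"
  have "translate_of ?B ?B" unfolding translate_of_def by (intro exI[of _ 0]) simp
  then have "?P (lam, mu)" using assms(1-3) by (simp add: is_presentation_def)
  then have "?P (pi_rho lam mu) \<and> (\<forall>y. ?P y \<longrightarrow> (\<lambda>(p, r). card r) (pi_rho lam mu) \<le> (\<lambda>(p, r). card r) y)"
    unfolding pi_rho_def by (rule arg_min_nat_lemma)
  moreover have eq: "pi_rho lam mu = (p, r)" by (simp add: p_def r_def pi_shape_def rho_shape_def)
  ultimately have P: "?P (p, r)" and min: "\<And>p' r'. ?P (p', r') \<Longrightarrow> card r \<le> card r'" by auto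
  show pr: "young p" "young r" "p \<subseteq> r" using P by (auto simp: is_presentation_def)
  have fin: "finite ?B" using assms(2) by (simp add: young_finite)
  have ne: "?B \<noteq> {}" using assms(3,4) by auto
  show ge: "i0 \<le> i \<and> j0 \<le> j" if "(i, j) \<in> ?B" for i j
    unfolding i0_def j0_def using that fin by (force intro!: Min_le)
  have "i0 \<in> fst ` ?B" "j0 \<in> snd ` ?B"
    unfolding i0_def j0_def using fin ne by (simp_all only: Min_in finite_imageI image_is_empty not_False_eq_True)
  then obtain i1 j1 where j1: "(i0, j1) \<in> ?B" and i1: "(i1, j0) \<in> ?B" by auto
  obtain a b :: int where ab: "(\<lambda>(i, j). (int i, int j)) ` (r - p) = (\<lambda>(i, j). (int i + a, int j + b)) ` ?B"
    using P by (auto simp: is_presentation_def translate_of_def)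
  have to_B: "\<exists>i' j'. (i', j') \<in> ?B \<and> int i = int i' + a \<and> int j = int j' + b" if "(i, j) \<in> r - p" for i j
  proof -
    have "(int i, int j) \<in> (\<lambda>(i, j). (int i, int j)) ` (r - p)" using that by force
    then show ?thesis unfolding ab by auto
  qed
  have from_B: "\<exists>i' j'. (i', j') \<in> r - p \<and> int i' = int i + a \<and> int j' = int j + b" if "(i, j) \<in> ?B" for i j
  proof -
    have "(int i + a, int j + b) \<in> (\<lambda>(i, j). (int i + a, int j + b)) ` ?B" using that by force
    then show ?thesis unfolding ab[symmetric] by auto
  qed
  have rne: "r \<noteq> {}" using from_B[OF j1] by auto
  have none: False if "0 < u + v" "\<And>i j. (i, j) \<in> r - p \<Longrightarrow> u \<le> i \<and> v \<le> j" for u v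
    using min[OF presentation_shift_back[OF P that(2)]] card_shift_back_less[OF pr(2) rne that(1)] by simp
  have "\<exists>j. (0, j) \<in> r - p"
  proof (rule ccontr)
    assume *: "\<nexists>j. (0, j) \<in> r - p"
    show False
    proof (rule none[of 1 0])
      fix i j assume "(i, j) \<in> r - p"
      then show "1 \<le> i \<and> 0 \<le> j" using * by (cases i) auto
    qed simp
  qed
  then obtain j2 where j2: "(0, j2) \<in> r - p" by blast
  have "\<exists>i. (i, 0) \<in> r - p"
  proof (rule ccontr)
    assume *: "\<nexists>i. (i, 0) \<in> r - p"
    show False
    proof (rule none[of 0 1])
      fix i j assume "(i, j) \<in> r - p"
      then show "0 \<le> i \<and> 1 \<le> j" using * by (cases j) auto
    qed simp
  qed
  then obtain i2 where i2: "(i2, 0) \<in> r - p" by blast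
  \<comment> \<open>The box of \<open>mu - lam\<close> in row i0 has its partner in a row >= 0, and
    the box of \<open>r - p\<close> in row 0 has its partner in a row >= i0; this bounds a from both
    sides.\<close>
  have a: "a = - int i0"
    using from_B[OF j1] to_B[OF j2] ge by fastforce
  have b: "b = - int j0"
    using from_B[OF i1] to_B[OF i2] ge by fastforce
  show "(i, j) \<in> r - p \<longleftrightarrow> (i + i0, j + j0) \<in> ?B" for i j
  proof
    assume "(i, j) \<in> r - p"
    then obtain i' j' where "(i', j') \<in> ?B" "int i = int i' + a" "int j = int j' + b" using to_B by blast
    moreover then have "i' = i + i0" "j' = j + j0" using a b by auto
    ultimately show "(i + i0, j + j0) \<in> ?B" by simp
  next
    assume "(i + i0, j + j0) \<in> ?B"
    then obtain i' j' where "(i', j') \<in> r - p" "int i' = int (i + i0) + a" "int j' = int (j + j0) + b"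
      using from_B by blast
    moreover then have "i' = i" "j' = j" using a b by auto
    ultimately show "(i, j) \<in> r - p" by simp
  qed
qed

theorem theorem12:
  fixes lam mu :: "(nat \<times> nat) set"
  assumes "young lam" and "young mu" and "lam \<subseteq> mu" and "lam \<noteq> mu"
  shows "sq_coeff lam mu =
    ps1 (top_left_content lam mu)
      (perp (SQ_alt (card (pi_shape lam mu)) (schur (conjugate (pi_shape lam mu))))
            (schur (conjugate (rho_shape lam mu))))"
proof -
  define p r where "p = pi_shape lam mu" and "r = rho_shape lam mu"
  define i0 j0 where "i0 = Min (fst ` (mu - lam))" and "j0 = Min (snd ` (mu - lam))"
  note red = pi_rho_reduced[OF assms, folded p_def r_def i0_def j0_def]
  \<comment> \<open>Enough rows for all four diagrams. \<lambda> and \<mu> get i0 more, so that row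
    i + i0 of \<mu> and row i of \<rho> have the same index counted from the bottom.\<close>
  define n where "n = card r + card mu"
  have rows: "rows_le r n" "rows_le p n" "rows_le mu (n + i0)" "rows_le lam (n + i0)"
  proof -
    have sub: "rows_le E k" if "rows_le D k" "E \<subseteq> D" for D E k using that unfolding rows_le_def by blast
    show "rows_le r n" "rows_le mu (n + i0)"
      by (rule rows_le_mono[OF rows_le_card]; use red assms in \<open>simp add: n_def\<close>)+
    then show "rows_le p n" "rows_le lam (n + i0)" using sub red(3) assms(3) by blast+
  qed
  obtain F where F: "pairprod n * F = 1" using ex_pairprod_inverse by blast
  obtain G where G: "pairprod (n + i0) * G = 1" using ex_pairprod_inverse by blast
  \<comment> \<open>The indices of the rows that contain boxes; the same set serves (\<lambda>,
    \<mu>) and (\<pi>, \<rho>).\<close>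
  define J where "J = {s. s < n \<and> beta n p s \<noteq> beta n r s}"
  have J: "finite J" "J \<subseteq> {..<n}" "J \<subseteq> {..<n + i0}" by (auto simp: J_def)
  have row: "rowlen p i \<le> j \<and> j < rowlen r i \<longleftrightarrow> rowlen lam (i + i0) \<le> j + j0 \<and> j + j0 < rowlen mu (i + i0)" for i j
    using red(5)[of i j] by (simp add: mem_young_iff[OF red(1)] mem_young_iff[OF red(2)]
        mem_young_iff[OF assms(1)] mem_young_iff[OF assms(2)] not_less conj_commute)
  have le: "rowlen p i \<le> rowlen r i" "rowlen lam i \<le> rowlen mu i" for i
    using rowlen_mono red assms by auto
  have box: "i0 \<le> i \<and> j0 \<le> rowlen lam i" if "rowlen lam i < rowlen mu i" for i
    using red(4)[of i "rowlen lam i"] that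
    by (simp add: mem_young_iff[OF assms(1)] mem_young_iff[OF assms(2)])
  \<comment> \<open>The boxes of a row determine its two ends only if there is at least one: the
    interval of \<rho>/\<pi>, shifted by j0, is then that of \<mu>/\<lambda>.\<close>
  have ends: "rowlen lam (i + i0) = rowlen p i + j0" "rowlen mu (i + i0) = rowlen r i + j0"
    if pr: "rowlen p i < rowlen r i" for i
  proof -
    let ?L = "rowlen lam (i + i0)" and ?M = "rowlen mu (i + i0)"
    have 1: "?L \<le> rowlen p i + j0" "rowlen p i + j0 < ?M" using row[of i "rowlen p i"] pr by auto
    then have "j0 \<le> ?L" using box[of "i + i0"] by simp
    then have 2: "rowlen p i \<le> ?L - j0" "?M - Suc j0 < rowlen r i"
      using row[of i "?L - j0"] row[of i "?M - Suc j0"] 1 by auto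
    have 3: "rowlen r i - 1 + j0 < ?M" using row[of i "rowlen r i - 1"] pr by auto
    show "?L = rowlen p i + j0" using 1 2 \<open>j0 \<le> ?L\<close> by linarith
    show "?M = rowlen r i + j0" using 1 2 3 pr by linarith
  qed
  have empty: "rowlen lam (i + i0) = rowlen mu (i + i0)" if "rowlen p i = rowlen r i" for i
  proof (rule ccontr)
    assume "rowlen lam (i + i0) \<noteq> rowlen mu (i + i0)"
    then have "rowlen lam (i + i0) < rowlen mu (i + i0)" using le(2)[of "i + i0"] by simp
    then show False using box[of "i + i0"] row[of i "rowlen lam (i + i0) - j0"] that by auto
  qed
  have inJ: "beta (n + i0) lam s = beta n p s + j0" "beta (n + i0) mu s = beta n r s + j0" if "s \<in> J" for s
  proof -
    have s: "s < n" "rowlen p (n - Suc s) < rowlen r (n - Suc s)"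
      using that le(1)[of "n - Suc s"] by (auto simp: J_def beta_def)
    have "n + i0 - Suc s = (n - Suc s) + i0" using s by simp
    then show "beta (n + i0) lam s = beta n p s + j0" "beta (n + i0) mu s = beta n r s + j0"
      using ends[OF s(2)] by (simp_all add: beta_def)
  qed
  have notJ: "beta (n + i0) lam s = beta (n + i0) mu s" if "s \<in> {..<n + i0} - J" for s
  proof (cases "s < n")
    case True
    then have "rowlen p (n - Suc s) = rowlen r (n - Suc s)" using that by (simp add: J_def beta_def)
    moreover have "n + i0 - Suc s = (n - Suc s) + i0" using True by simp
    ultimately show ?thesis using empty by (simp add: beta_def)
  next
    \<comment> \<open>The indices from n on are the top i0 rows, which lie above all boxes.\<close>
    case False
    then have "\<not> i0 \<le> n + i0 - Suc s" using that by auto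
    then have "rowlen lam (n + i0 - Suc s) = rowlen mu (n + i0 - Suc s)"
      using box[of "n + i0 - Suc s"] le(2)[of "n + i0 - Suc s"] by (meson le_neq_implies_less)
    then show ?thesis by (simp add: beta_def)
  qed
  define c where "c = int j0 - int i0"
  \<comment> \<open>The degree of the monomial at which \<open>skewc\<close> is read, up to which
    the truncation must be exact.\<close>
  define d where "d = card r + (\<Sum>s<n. s)"
  have "sq_coeff lam mu = schur_coeff (phi 1 (schur lam) * 1) mu"
    using sq_coeff_phi assms by simp
  also have "\<dots> = skewc {..<n + i0} (1 * G) (beta (n + i0) lam) (beta (n + i0) mu)"
    using assms rows G by (intro schur_coeff_skewc Sym_1)
  also have "\<dots> = skewc J (tr J G) (beta (n + i0) lam) (beta (n + i0) mu)"
    unfolding mult_1 using J notJ beta_less[OF assms(1)] beta_less[OF assms(2)] by (intro skewc_delete_set) auto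
  also have "\<dots> = skewc J (tr J G) (\<lambda>s. beta n p s + j0) (\<lambda>s. beta n r s + j0)"
    using inJ by (intro skewc_cong) auto
  also have "\<dots> = skewc J (tr J (twist_series c * F)) (beta n p) (beta n r)"
    unfolding skewc_shift[OF J(1)] twist_units[OF J(1,2) F G] c_def ..
  \<comment> \<open>The same deletion for (\<pi>, \<rho>), read backwards: the rows without boxes
    are put back.\<close>
  also have "\<dots> = skewc {..<n} (twist_series c * F) (beta n p) (beta n r)"
    using J beta_less[OF red(1)] beta_less[OF red(2)] by (intro skewc_delete_set[symmetric]) (auto simp: J_def)
  also have "\<dots> = skewc {..<n} (twist d c * F) (beta n p) (beta n r)"
  proof -
    have "size (expo {..<n} (beta n r)) \<le> d"
      using sum_beta[OF red(2) rows(1)] by (simp add: size_expo d_def)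
    then show ?thesis
      unfolding skewc_def by (intro eqb_D[symmetric] eqb_mult eqb_refl eqb_twist)
  qed
  also have "\<dots> = schur_coeff (phi 1 (schur p) * twist d c) r"
    using red rows F by (intro schur_coeff_skewc[symmetric] twist_in_Sym)
  also have "\<dots> = ps1 c (perp (SQ_alt (card p) (schur (conjugate p))) (schur (conjugate r)))"
    using red by (intro rhs_eq[symmetric]) (auto simp: d_def)
  finally show ?thesis
    by (simp add: p_def r_def c_def i0_def j0_def top_left_content_def)
qed

end
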